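(* Let $\Gamma$ be an infinite, finitely generated group that has property (A). Then $\mathrm{Conj}_\Gamma(n)\preceq n^d$ for some $d\in\mathbb{N}$. Moreover, there is some $n_0\in\mathbb{N}$ such that conjugacy separability of $\Gamma$ is realized by finite quotients that are subgroups of the finite groups $\mathrm{SL}(n_0,\mathbf{F}_p)$ with $p$ prime; that is, for all non-conjugate $\gamma,\eta\in\Gamma$ there exist a prime $p$ and a homomorphism $\varphi\colon\Gamma\to\mathrm{SL}(n_0,\mathbf{F}_p)$ such that $\varphi(\gamma)$ and $\varphi(\eta)$ are not conjugate in the finite group $\varphi(\Gamma)$.
   Context: $\mathbf{F}_p$ is the field of prime order $p$. Property (A): there exist an integer $n\ge1$ and $\rho\in\mathrm{Hom}(\Gamma,\mathrm{SL}(n,\mathbb{C}))$ such that $\mathrm{Tr}(\rho(\gamma))\ne\mathrm{Tr}(\rho(\eta))$ for all non-conjugate $\gamma,\eta\in\Gamma$. A group $\Gamma$ is conjugacy separable if for any non-conjugate $\gamma,\eta\in\Gamma$ there is a homomorphism $\varphi\colon\Gamma\to Q$ with $|Q|<\infty$ and $\varphi(\gamma),\varphi(\eta)$ not conjugate in $Q$. Let $X$ be a finite generating set of $\Gamma$ and $\|\gamma\|_X$ the word length. Write $[\gamma]$ for the $\Gamma$-conjugacy class of $\gamma$, $C_\Gamma$ for the set of conjugacy classes, $\|[\gamma]\|_X=\min\{\|\gamma'\|_X:\gamma'\in[\gamma]\}$, and $B_X(C_\Gamma,n)=\{[\gamma]:\|[\gamma]\|_X\le n\}$. For distinct classes $[\gamma]\neq[\eta]$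 let $\mathrm{CD}_\Gamma([\gamma],[\eta])\in\mathbb{N}\cup\{\infty\}$ be the minimum of $|Q|$ over all finite groups $Q$ for which there is a homomorphism $\varphi\colon\Gamma\to Q$ with $\varphi(\gamma),\varphi(\eta)$ not conjugate in $Q$ ($\infty$ if there is none). Define $$\mathrm{Conj}_{\Gamma,X}(n)=\max\{\mathrm{CD}_\Gamma([\gamma],[\eta]) : [\gamma],[\eta]\in B_X(C_\Gamma,n),\ [\gamma]\ne[\eta]\}.$$ For functions $f,g$ on $\mathbb{N}=\{1,2,\dots\}$, $f\preceq g$ means there is a constant $C\in\mathbb{N}$ with $f(n)\le C\,g(Cn)$ for all $n\in\mathbb{N}$; $f\approx g$ means $f\preceq g$ and $g\preceq f$. Up to $\approx$, $\mathrm{Conj}_{\Gamma,X}$ does not depend on $X$, so $X$ is dropped from the notation: $\mathrm{Conj}_\Gamma$. *)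

theory Defs
  imports
    "Jordan_Normal_Form.Determinant"
    "HOL-Algebra.Generated_Groups"
    "HOL-Number_Theory.Residues"
    "HOL-Library.Extended_Nat"
    Complex_Main
begin

subsection \<open>Conjugacy\<close>

definition conjugate_in :: "('a, 'b) monoid_scheme \<Rightarrow> 'a \<Rightarrow> 'a \<Rightarrow> bool" where
  "conjugate_in G x y \<longleftrightarrow> (\<exists>g\<in>carrier G. y = g \<otimes>\<^bsub>G\<^esub> x \<otimes>\<^bsub>G\<^esub> inv\<^bsub>G\<^esub> g)"

definition conj_class :: "('a, 'b) monoid_scheme \<Rightarrow> 'a \<Rightarrow> 'a set" where
  "conj_class G x = {y \<in> carrier G. conjugate_in G x y}"

definition conj_classes :: "('a, 'b) monoid_scheme \<Rightarrow> 'a set set" where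
  "conj_classes G = conj_class G ` carrier G"


subsection \<open>Special linear groups\<close>

definition SL :: "nat \<Rightarrow> 'a::comm_ring_1 mat monoid" where
  "SL n = \<lparr>carrier = {A \<in> carrier_mat n n. det A = 1}, monoid.mult = (*), one = 1\<^sub>m n\<rparr>"

text \<open>The field with \<open>p\<close> elements is \<open>residue_ring p\<close>, whose elements are the integers
  \<open>0, \<dots>, p - 1\<close> and whose operations are those of the integers reduced modulo \<open>p\<close>.
  (A type for it would not do, as \<open>p\<close> is bound inside the statement.)  Product and determinant
  of matrices are integer polynomials in the entries, so over this field they are the integer
  product and determinant reduced modulo \<open>p\<close>.\<close>

definition SL_Fp :: "nat \<Rightarrow> nat \<Rightarrow> int mat monoid" where
  "SL_Fp n p =
    \<lparr>carrier = {A \<in> carrier_mat n n.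
        elements_mat A \<subseteq> carrier (residue_ring (int p)) \<and> [det A = 1] (mod int p)},
     monoid.mult = (\<lambda>A B. map_mat (\<lambda>x. x mod int p) (A * B)),
     one = 1\<^sub>m n\<rparr>"

definition mat_trace :: "'a::comm_monoid_add mat \<Rightarrow> 'a" where
  "mat_trace A = (\<Sum>i<dim_row A. A $$ (i, i))"

definition property_A :: "('a, 'b) monoid_scheme \<Rightarrow> bool" where
  "property_A G \<longleftrightarrow>
    (\<exists>n\<ge>1. \<exists>\<rho>\<in>hom G (SL n :: complex mat monoid).
      \<forall>\<gamma>\<in>carrier G. \<forall>\<eta>\<in>carrier G.
        \<not> conjugate_in G \<gamma> \<eta> \<longrightarrow> mat_trace (\<rho> \<gamma>) \<noteq> mat_trace (\<rho> \<eta>))"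


subsection \<open>Conjugacy separability growth\<close>

definition finite_generating_set :: "('a, 'b) monoid_scheme \<Rightarrow> 'a set \<Rightarrow> bool" where
  "finite_generating_set G X \<longleftrightarrow> finite X \<and> X \<subseteq> carrier G \<and> generate G X = carrier G"

definition word_length :: "('a, 'b) monoid_scheme \<Rightarrow> 'a set \<Rightarrow> 'a \<Rightarrow> nat" where
  "word_length G X \<gamma> =
    (LEAST k. \<exists>ws. length ws = k \<and> set ws \<subseteq> X \<union> m_inv G ` X \<and>
                   foldr (\<otimes>\<^bsub>G\<^esub>) ws \<one>\<^bsub>G\<^esub> = \<gamma>)"

definition class_length :: "('a, 'b) monoid_scheme \<Rightarrow> 'a set \<Rightarrow> 'a set \<Rightarrow> nat" where
  "class_length G X c = (LEAST k. k \<in> word_length G X ` c)"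

definition class_ball :: "('a, 'b) monoid_scheme \<Rightarrow> 'a set \<Rightarrow> nat \<Rightarrow> 'a set set" where
  "class_ball G X n = {c \<in> conj_classes G. class_length G X c \<le> n}"

text \<open>Every finite group is isomorphic to one whose elements are natural numbers, so letting
  \<open>Q\<close> range over groups on type \<^typ>\<open>nat\<close> covers all finite groups.  Whether the images of
  \<open>\<gamma>\<close> and \<open>\<eta>\<close> are conjugate does not depend on the chosen representatives of the two
  classes.  The infimum of the empty set is \<open>\<infinity>\<close>.\<close>

definition CD :: "('a, 'b) monoid_scheme \<Rightarrow> 'a set \<Rightarrow> 'a set \<Rightarrow> enat" where
  "CD G c d = Inf {enat (order Q) | Q :: nat monoid.
     group Q \<and> finite (carrier Q) \<and>
     (\<exists>\<phi>\<in>hom G Q. \<exists>\<gamma>\<in>c. \<exists>\<eta>\<in>d. \<not> conjugate_in Q (\<phi> \<gamma>) (\<phi> \<eta>))}"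

text \<open>For finite \<open>X\<close> the ball is finite, so the supremum is a maximum (and \<open>0\<close> if the ball
  has fewer than two elements, which for \<open>n \<ge> 1\<close> happens only in the trivial group).\<close>

definition Conj :: "('a, 'b) monoid_scheme \<Rightarrow> 'a set \<Rightarrow> nat \<Rightarrow> enat" where
  "Conj G X n = Sup {CD G c d | c d. c \<in> class_ball G X n \<and> d \<in> class_ball G X n \<and> c \<noteq> d}"

text \<open>Functions are considered on the positive integers only.\<close>

definition growth_le :: "(nat \<Rightarrow> enat) \<Rightarrow> (nat \<Rightarrow> enat) \<Rightarrow> bool" (infix \<open>\<preceq>\<^sub>g\<close> 50) where
  "f \<preceq>\<^sub>g g \<longleftrightarrow> (\<exists>C\<ge>1. \<forall>n\<ge>1. f n \<le> enat C * g (C * n))"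

end

theory Submission
  imports Defs "Jordan_Normal_Form.Char_Poly"
begin

text \<open>Conjugate elements have equal traces.  By property (A) the converse holds for a representation
  \<open>\<rho>\<close>, so two elements \<open>\<gamma>\<close>, \<open>\<eta>\<close> that are not conjugate are told apart by the nonzero complex
  number \<open>z\<close> that is the difference of their traces.  It lies in the ring \<open>R\<close> generated by the
  entries of \<open>\<rho>\<close> at the finitely many generators and their inverses.  Suppose that \<open>\<phi>\<close> is a
  homomorphism from \<open>R\<close> to the matrices of some fixed size \<open>k\<close> over the field with \<open>p\<close> elements
  and that \<open>\<phi> z \<noteq> 0\<close>.  Applying \<open>\<phi>\<close> to the entries of \<open>\<rho>\<close> gives a representation of the group over
  that field in which the images of \<open>\<gamma>\<close> and \<open>\<eta>\<close> are not conjugate by the image of any group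
  element, because \<open>\<phi>\<close> of the trace can be recovered from the diagonal blocks
  (\<open>separation\<close>).  The size of the representation does not depend on \<open>\<gamma>\<close> and \<open>\<eta>\<close>, so the
  image has order polynomial in \<open>p\<close>.

  What remains is to find \<open>\<phi>\<close> with \<open>p\<close> polynomial in the word lengths.  If these are at most \<open>N\<close>,
  then \<open>z\<close> is the value at the generators of \<open>R\<close> of an integer polynomial whose degree, and the
  logarithm of whose coefficients, are linear in \<open>N\<close>.  Both are measured by the cost of \<open>z\<close>
  (\<open>cost_le\<close>), and \<open>small_prime_separable\<close> says that for some fixed \<open>k\<close> every
  nonzero element of cost at most \<open>m\<close> is detected at a prime bounded by a polynomial in \<open>m\<close>.  That this
  holds for every finitely generated subring of the complex numbers
  (\<open>small_prime_separable_finite\<close>) is shown by adjoining the generators one at a time.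
  For the integers it is Chebyshev's lower bound for the number of primes
  (\<open>exists_prime_not_dvd\<close>).  A transcendental generator is sent to a suitable integer
  (\<open>small_prime_separable_transcendental\<close>).  An algebraic one becomes integral after a
  leading coefficient is inverted (\<open>small_prime_separable_localize\<close>), and then acts by
  matrices on a free module over the smaller ring (\<open>small_prime_separable_integral\<close>).
  Working with matrices of bounded size instead of residue fields avoids extensions of finite fields,
  and lifting them to the integers localized at \<open>p\<close> turns congruences into equations between
  rational matrices.\<close>

hide_const (open) up_ring.coeff up_ring.monom

section \<open>Primes not dividing a given integer\<close>

text \<open>The numbers \<open>L n m = 1 / (m * (n choose m))\<close> form the harmonic triangle of Leibniz and satisfy
  \<open>L n (m + 1) = L (n - 1) m - L n m\<close>.  Starting from \<open>L n 1 = 1 / n\<close>, induction on \<open>m\<close> shows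
  that the least common multiple of the numbers up to \<open>n\<close> clears all their denominators.\<close>

lemma leibniz_dvd_Lcm:
  assumes "1 \<le> m" "m \<le> n"
  shows "m * (n choose m) dvd Lcm {1..n}"
  using assms
proof (induction m arbitrary: n)
  case 0 thus ?case by simp
next
  case (Suc m)
  show ?case
  proof (cases "m = 0")
    case True
    have "n \<in> {1..n}" using Suc.prems by auto
    hence "n dvd Lcm {1..n}" by (rule dvd_Lcm)
    with True show ?thesis by simp
  next
    case False
    define D where "D = Lcm {1..n}"
    define a where "a = m * ((n - 1) choose m)"
    define b where "b = m * (n choose m)"
    define c where "c = Suc m * (n choose Suc m)"
    obtain k where k: "n = Suc k" using Suc.prems by (cases n) auto
    have mk: "m \<le> k" using Suc.prems k by auto
    have "a dvd Lcm {1..n - 1}" unfolding a_def using Suc.IH[of "n - 1"] Suc.prems False by auto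
    moreover have "Lcm {1..n - 1} dvd D" unfolding D_def by (rule Lcm_subset) auto
    ultimately have "a dvd D" by (rule dvd_trans)
    moreover have "b dvd D" unfolding b_def D_def using Suc.IH[of n] Suc.prems False by auto
    ultimately obtain u v where u: "D = a * u" and v: "D = b * v" unfolding dvd_def by blast
    have pos: "a > 0" "b > 0" "c > 0"
      unfolding a_def b_def c_def using False mk k Suc.prems by (auto simp: zero_less_binomial_iff simp del: binomial_Suc_Suc)
    have c1: "c = n * (k choose m)" unfolding c_def k by (rule Suc_times_binomial)
    have "(k + 1 - m) * (Suc k choose m) = Suc k * (k choose m)"
      using binomial_absorb_comp[of "Suc k" m] mk by (simp add: Suc_diff_le)
    hence b1: "(k + 1 - m) * b = m * c" unfolding b_def c1 k by (simp add: algebra_simps)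
    have ac: "n * a = m * c" unfolding a_def c1 k by (simp add: algebra_simps)
    have i1: "int n * int a = int m * int c" using ac by (metis of_nat_mult)
    have i2: "int (k + 1 - m) * int b = int m * int c" using b1 by (metis of_nat_mult)
    have "int c * (int u - int v) = int D"
    proof -
      have "int m * (int c * (int u - int v)) = int n * int a * int u - int (k + 1 - m) * int b * int v"
        unfolding i1 i2 by (simp add: algebra_simps)
      also have "\<dots> = int n * int D - int (k + 1 - m) * int D"
      proof -
        have "int a * int u = int D" "int b * int v = int D" using u v by (metis of_nat_mult)+
        thus ?thesis by (simp add: mult.assoc)
      qed
      also have "\<dots> = int m * int D" using mk k by (simp add: algebra_simps of_nat_diff)
      finally show ?thesis using False by simp
    qed
    hence "int c dvd int D" by (metis dvd_triv_left)
    hence "c dvd D" by (simp only: int_dvd_int_iff)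
    thus ?thesis unfolding c_def D_def .
  qed
qed

lemma power_two_le_central_binomial: "2 ^ M \<le> (2 * M) choose M"
proof -
  have "(M + M) choose M \<ge> 2 ^ M"
  proof (cases "M = 0")
    case False
    have "((2*M) / M) ^ M \<le> real ((2*M) choose M)"
      using binomial_ge_n_over_k_pow_k[of M "2*M", where 'a = real] by simp
    hence "(2::real) ^ M \<le> real ((2*M) choose M)" using False by simp
    hence "2 ^ M \<le> (2*M) choose M" by (metis of_nat_le_iff of_nat_numeral of_nat_power)
    thus ?thesis by (simp add: mult_2)
  qed simp
  thus ?thesis by (simp add: mult_2)
qed

text \<open>Every maximal prime power dividing the least common multiple already divides one of the
  numbers up to \<open>n\<close>, so each prime contributes a factor of at most \<open>n\<close>.\<close>

lemma Lcm_le_power_card_primes: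
  assumes "n \<ge> 1"
  shows "Lcm {1..n} \<le> n ^ card {p::nat. prime p \<and> p \<le> n}"
proof -
  let ?L = "Lcm {1..n}"
  have L0: "?L \<noteq> 0" by (auto simp: Lcm_0_iff)
  have fin: "finite {p::nat. prime p \<and> p \<le> n}" by (rule finite_subset[of _ "{..n}"]) auto
  have dvdfact: "?L dvd fact n"
    by (rule Lcm_least) (auto intro: dvd_fact)
  have sub: "prime_factors ?L \<subseteq> {p::nat. prime p \<and> p \<le> n}"
  proof
    fix p assume "p \<in> prime_factors ?L"
    hence p: "prime p" "p dvd ?L" by (auto simp: in_prime_factors_iff)
    hence "p dvd fact n" using dvdfact dvd_trans by blast
    with p show "p \<in> {p. prime p \<and> p \<le> n}" by (simp add: prime_dvd_fact_iff)
  qed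
  have mult: "p ^ multiplicity p ?L \<le> n" if p: "prime p" for p
  proof (rule ccontr)
    assume a: "\<not> ?thesis"
    define e where "e = multiplicity p ?L"
    have e0: "e > 0" using a assms unfolding e_def by (cases "multiplicity p ?L") auto
    have "p ^ e dvd ?L" unfolding e_def by (rule multiplicity_dvd)
    \<comment> \<open>dividing out one \<open>p\<close> leaves a common multiple\<close>
    then obtain c where c: "?L = p ^ e * c" by (auto simp: dvd_def)
    have "?L dvd p ^ (e - 1) * c"
    proof (rule Lcm_least)
      fix k assume k: "k \<in> {1..n}"
      hence kL: "k dvd p ^ e * c" using c dvd_Lcm[OF k] by simp
      show "k dvd p ^ (e - 1) * c"
      proof (rule multiplicity_le_imp_dvd)
        show "k \<noteq> 0" using k by auto
        fix q :: nat assume q: "prime q"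
        have c0: "c \<noteq> 0" "p ^ (e-1) * c \<noteq> 0" using c L0 p by (auto)
        have pc: "\<not> p dvd c"
        proof
          assume "p dvd c"
          hence "p ^ Suc e dvd ?L" unfolding c by (auto simp: mult_dvd_mono mult.commute)
          hence "Suc e \<le> multiplicity p ?L" using L0 p
            by (metis multiplicity_geI not_prime_unit)
          thus False unfolding e_def by simp
        qed
        show "multiplicity q k \<le> multiplicity q (p ^ (e - 1) * c)"
        proof (cases "q = p")
          case True
          have "multiplicity p (p ^ (e - 1) * c) = e - 1"
            using p c0 pc by (simp add: prime_elem_multiplicity_mult_distrib multiplicity_same_power not_dvd_imp_multiplicity_0)
          moreover have "multiplicity p k \<le> e - 1"
          proof (rule ccontr)
            assume "\<not> ?thesis"
            hence "p ^ e dvd k" by (intro multiplicity_dvd') auto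
            hence "p ^ e \<le> k" using k by (auto intro: dvd_imp_le)
            thus False using a k unfolding e_def by auto
          qed
          ultimately show ?thesis using True by simp
        next
          case False
          have "multiplicity q k \<le> multiplicity q (p ^ e * c)"
            using kL c L0 by (intro dvd_imp_multiplicity_le) auto
          thus ?thesis using False p q c0 by (simp add: prime_elem_multiplicity_mult_distrib multiplicity_distinct_prime_power)
        qed
      qed
    qed
    hence "p ^ e * c dvd p ^ (e - 1) * c" using c by simp
    moreover have "c \<noteq> 0" using c L0 by auto
    ultimately have "p ^ e \<le> p ^ (e - 1)" using p
      by (simp add: dvd_imp_le prime_gt_0_nat)
    moreover have "p ^ (e - 1) < p ^ e" using e0 prime_gt_1_nat[OF p] by (intro power_strict_increasing) auto
    ultimately show False by simp
  qed
  have "?L = (\<Prod>p\<in>prime_factors ?L. p ^ multiplicity p ?L)"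
    by (rule prime_factorization_nat) (use L0 in \<open>simp only: neq0_conv\<close>)
  also have "\<dots> \<le> (\<Prod>p\<in>prime_factors ?L. n)" by (rule prod_mono) (use mult in \<open>auto simp: in_prime_factors_iff\<close>)
  also have "\<dots> = n ^ card (prime_factors ?L)" by simp
  also have "\<dots> \<le> n ^ card {p::nat. prime p \<and> p \<le> n}"
    using assms by (intro power_increasing card_mono fin sub) auto
  finally show ?thesis .
qed

text \<open>Chebyshev's argument: the least common multiple of the numbers up to \<open>64 * m ^ 2\<close> exceeds a
  central binomial coefficient, which is at least \<open>2 ^ (32 * m ^ 2)\<close>, whereas \<open>2 * m\<close> primes account
  for no more than \<open>(64 * m ^ 2) ^ (2 * m)\<close>.\<close>

lemma many_primes:
  assumes "m \<ge> 1"
  shows "card {p::nat. prime p \<and> p \<le> 64 * m ^ 2} > 2 * m"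
proof (rule ccontr)
  let ?P = "{p::nat. prime p \<and> p \<le> 64 * m ^ 2}"
  assume a: "\<not> ?thesis"
  define M where "M = 32 * m ^ 2"
  have M1: "M \<ge> 1" using assms unfolding M_def by simp
  have e: "64 * m ^ 2 = 2 * M" unfolding M_def by simp
  have "2 ^ M \<le> (2 * M) choose M" by (rule power_two_le_central_binomial)
  also have "\<dots> \<le> M * ((2 * M) choose M)" using M1 by simp
  also have "\<dots> \<le> Lcm {1..2 * M}"
    using M1 by (intro dvd_imp_le leibniz_dvd_Lcm Nat.gr0I) (auto simp: Lcm_0_iff)
  also have "\<dots> \<le> (2 * M) ^ card ?P" unfolding e using M1 by (intro Lcm_le_power_card_primes) auto
  also have "\<dots> \<le> (2 * M) ^ (2 * m)" using a M1 by (intro power_increasing) auto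
  also have "\<dots> = (8 * m) ^ (4 * m)"
  proof -
    have "2 * M = (8 * m) ^ 2" unfolding M_def by (simp add: power2_eq_square)
    hence "(2 * M) ^ (2 * m) = (8 * m) ^ (2 * (2 * m))" by (simp only: power_mult)
    thus ?thesis by simp
  qed
  also have "\<dots> \<le> (2 ^ (3 + m)) ^ (4 * m)"
  proof (rule power_mono)
    have "m \<le> 2 ^ m" by (simp add: less_imp_le)
    thus "8 * m \<le> 2 ^ (3 + m)" by (simp add: power_add)
  qed simp
  also have "\<dots> = 2 ^ ((3 + m) * (4 * m))" by (simp only: power_mult)
  also have "\<dots> < 2 ^ M"
  proof (rule power_strict_increasing)
    have "(3 + m) * (4 * m) \<le> (4 * m) * (4 * m)" using assms by (intro mult_right_mono) auto
    also have "\<dots> < M" using assms unfolding M_def by (simp add: power2_eq_square)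
    finally show "(3 + m) * (4 * m) < M" .
  qed simp
  finally show False by simp
qed

text \<open>Of the more than \<open>2 * m\<close> primes up to \<open>64 * m ^ 2\<close>, more than \<open>m\<close> are larger than \<open>m\<close>; if all of
  these divided \<open>i\<close>, their product would show \<open>2 ^ m < \<bar>i\<bar>\<close>.\<close>

lemma exists_prime_not_dvd:
  fixes i :: int
  assumes "m \<ge> 1" "i \<noteq> 0" "\<bar>i\<bar> \<le> 2 ^ m"
  shows "\<exists>p. prime p \<and> m < p \<and> p \<le> 64 * m ^ 2 \<and> \<not> int p dvd i"
proof (rule ccontr)
  assume a: "\<not> ?thesis"
  define Q where "Q = {p::nat. prime p \<and> m < p \<and> p \<le> 64 * m ^ 2}"
  let ?P = "{p::nat. prime p \<and> p \<le> 64 * m ^ 2}"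
  define n where "n = nat \<bar>i\<bar>"
  have n0: "n \<noteq> 0" using assms unfolding n_def by simp
  have fP: "finite ?P" by (rule finite_subset[of _ "{..64 * m ^ 2}"]) auto
  have fQ: "finite Q" using fP unfolding Q_def by (rule rev_finite_subset) auto
  have "card ?P \<le> card (Q \<union> {1..m})" using fQ
    by (intro card_mono) (auto simp: Q_def Suc_le_eq prime_gt_0_nat)
  also have "\<dots> \<le> card Q + m" using card_Un_le[of Q "{1..m}"] by simp
  finally have cQ: "m < card Q" using many_primes[OF assms(1)] by simp
  have "Q \<subseteq> prime_factors n"
  proof
    fix p assume "p \<in> Q"
    hence "prime p" "int p dvd i" using a unfolding Q_def by auto
    thus "p \<in> prime_factors n" using n0 unfolding n_def
      by (auto simp: in_prime_factors_iff simp flip: int_dvd_int_iff)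
  qed
  hence "(\<Prod>p\<in>Q. p) dvd (\<Prod>p\<in>prime_factors n. p)" by (intro prod_dvd_prod_subset) auto
  also have "\<dots> dvd (\<Prod>p\<in>prime_factors n. p ^ multiplicity p n)"
    by (intro prod_dvd_prod) (auto simp: prime_factors_multiplicity intro!: dvd_power)
  also have "\<dots> = n" using n0 prime_factorization_nat[of n] by simp
  finally have "\<Prod>Q \<le> n" using n0 by (auto intro: dvd_imp_le)
  moreover have "(\<Prod>p\<in>Q. 2) \<le> \<Prod>Q" by (intro prod_mono) (auto simp: Q_def prime_ge_2_nat)
  ultimately have "2 ^ card Q \<le> n" by simp
  moreover have "(2::nat) ^ m < 2 ^ card Q" using cQ by simp
  moreover have "n \<le> 2 ^ m" using assms(3) unfolding n_def by (simp add: nat_le_iff)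
  ultimately show False by simp
qed

section \<open>The local ring of the integers at a prime\<close>

text \<open>The localization of the integers at \<open>p\<close>, realised inside the rational numbers: identities between
  matrices over it are then identities of rational matrices, and congruences enter only where
  the residue field is reached.\<close>

definition Zloc :: "nat \<Rightarrow> rat set" where
  "Zloc p = {q. \<exists>a b. q = of_int a / of_int b \<and> \<not> int p dvd b}"

text \<open>The residue map of the local ring, with values represented by \<open>0, \<dots>, p - 1\<close>.\<close>

definition residue :: "nat \<Rightarrow> rat \<Rightarrow> int" where
  "residue p q = (THE r. 0 \<le> r \<and> r < int p \<and>
     (\<exists>a b. q = of_int a / of_int b \<and> \<not> int p dvd b \<and> [r * b = a] (mod int p)))"

lemma residue_unique:
  assumes p: "prime p" and q: "(of_int a :: rat) / of_int b = of_int a' / of_int b'"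
    and b: "\<not> int p dvd b" "\<not> int p dvd b'"
    and r: "[r * b = a] (mod int p)" "[r' * b' = a'] (mod int p)"
  shows "[r = r'] (mod int p)"
proof -
  have b0: "b \<noteq> 0" "b' \<noteq> 0" using b by auto
  hence "(of_int (a * b') :: rat) = of_int (a' * b)" using q by (simp add: field_simps)
  hence e: "a * b' = a' * b" by (simp only: of_int_eq_iff)
  have "[(r * b) * b' = a * b'] (mod int p)" using r by (intro cong_mult) auto
  moreover have "[(r' * b') * b = a' * b] (mod int p)" using r by (intro cong_mult) auto
  ultimately have "[r * (b * b') = r' * (b * b')] (mod int p)"
    unfolding cong_def e[symmetric] by (simp add: ac_simps)
  moreover have "coprime (b * b') (int p)"
    using p b by (metis coprime_commute prime_dvd_mult_iff prime_imp_coprime prime_nat_int_transfer)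
  ultimately show ?thesis by (simp add: cong_mult_rcancel)
qed

lemma residue_eqI:
  assumes p: "prime p" and "q = of_int a / of_int b" "\<not> int p dvd b" "[r * b = a] (mod int p)"
  shows "residue p q = r mod int p"
  unfolding residue_def
proof (rule the_equality)
  have p0: "int p > 0" using p by (simp add: prime_gt_0_nat)
  have "[r mod int p * b = a] (mod int p)" using assms by (simp add: cong_def mod_mult_left_eq)
  thus "0 \<le> r mod int p \<and> r mod int p < int p \<and> (\<exists>a b. q = of_int a / of_int b \<and> \<not> int p dvd b \<and> [r mod int p * b = a] (mod int p))"
    using assms p0 by auto
next
  fix r' assume a: "0 \<le> r' \<and> r' < int p \<and> (\<exists>a b. q = of_int a / of_int b \<and> \<not> int p dvd b \<and> [r' * b = a] (mod int p))"
  then obtain a' b' where "q = of_int a' / of_int b'" "\<not> int p dvd b'" "[r' * b' = a'] (mod int p)" by blast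
  hence "[r = r'] (mod int p)" using residue_unique[OF p, of a b a' b' r r'] assms by auto
  thus "r' = r mod int p" using a by (simp add: cong_def)
qed

lemma residue_cong:
  assumes "prime p" "q \<in> Zloc p"
  obtains a b where "q = of_int a / of_int b" "\<not> int p dvd b" "[residue p q * b = a] (mod int p)"
proof -
  from assms obtain a b where q: "q = of_int a / of_int b" and b: "\<not> int p dvd b" by (auto simp: Zloc_def)
  have "coprime b (int p)" using assms(1) b by (metis coprime_commute prime_imp_coprime prime_nat_int_transfer)
  then obtain c where c: "[b * c = 1] (mod int p)" using cong_solve_coprime_int by blast
  have "[c * a * b = a] (mod int p)"
    using cong_mult[OF c cong_refl[of a]] by (simp add: ac_simps)
  hence "residue p q = (c * a) mod int p" "[c * a * b = a] (mod int p)" using residue_eqI[OF assms(1) q b] by auto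
  hence "[residue p q * b = a] (mod int p)" by (simp add: cong_def mod_mult_left_eq)
  with q b that show ?thesis by blast
qed

lemma residue_range: assumes "prime p" "q \<in> Zloc p" shows "residue p q \<in> {0..<int p}"
proof -
  obtain a b where "q = of_int a / of_int b" "\<not> int p dvd b" "[residue p q * b = a] (mod int p)"
    using residue_cong[OF assms] by blast
  hence "residue p q = residue p q mod int p" using residue_eqI[OF assms(1)] by blast
  thus ?thesis using prime_gt_0_nat[OF assms(1)]
    by (metis atLeastLessThan_iff of_nat_0_less_iff pos_mod_bound pos_mod_sign)
qed

lemma
  assumes p: "prime p" and x: "x \<in> Zloc p" and y: "y \<in> Zloc p"
  shows Zloc_add: "x + y \<in> Zloc p" and residue_add: "residue p (x + y) = (residue p x + residue p y) mod int p"
    and Zloc_mult: "x * y \<in> Zloc p" and residue_mult: "residue p (x * y) = (residue p x * residue p y) mod int p"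
proof -
  obtain a b where x': "x = of_int a / of_int b" "\<not> int p dvd b" "[residue p x * b = a] (mod int p)"
    using residue_cong[OF p x] by blast
  obtain c d where y': "y = of_int c / of_int d" "\<not> int p dvd d" "[residue p y * d = c] (mod int p)"
    using residue_cong[OF p y] by blast
  have bd: "\<not> int p dvd b * d" using x'(2) y'(2) p by (simp add: prime_dvd_mult_iff)
  have s: "x + y = of_int (a * d + c * b) / of_int (b * d)"
  proof -
    have "b \<noteq> 0" "d \<noteq> 0" using bd by auto
    thus ?thesis unfolding x'(1) y'(1) by (simp add: field_simps)
  qed
  have m: "x * y = of_int (a * c) / of_int (b * d)" unfolding x'(1) y'(1) by simp
  show "x + y \<in> Zloc p" "x * y \<in> Zloc p" unfolding Zloc_def using s m bd by blast+
  have "[residue p x * b * d + residue p y * d * b = a * d + c * b] (mod int p)"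
    using x'(3) y'(3) by (intro cong_add cong_mult) auto
  hence "[(residue p x + residue p y) * (b * d) = a * d + c * b] (mod int p)" by (simp add: algebra_simps)
  thus "residue p (x + y) = (residue p x + residue p y) mod int p" using residue_eqI[OF p s bd] by blast
  have "[residue p x * b * (residue p y * d) = a * c] (mod int p)"
    using x'(3) y'(3) by (intro cong_mult) auto
  hence "[(residue p x * residue p y) * (b * d) = a * c] (mod int p)" by (simp add: ac_simps)
  thus "residue p (x * y) = (residue p x * residue p y) mod int p" using residue_eqI[OF p m bd] by blast
qed

lemma
  assumes p: "prime p"
  shows Zloc_of_int: "of_int i \<in> Zloc p" and residue_of_int: "residue p (of_int i) = i mod int p"
proof -
  have "of_int i = (of_int i :: rat) / of_int 1" "\<not> int p dvd 1"
    using prime_gt_1_nat[OF p] by auto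
  thus "of_int i \<in> Zloc p" "residue p (of_int i) = i mod int p"
    using residue_eqI[OF p, of "of_int i" i 1 i] unfolding Zloc_def by (blast, simp)
qed

lemma Zloc_simps: assumes p: "prime p"
  shows "0 \<in> Zloc p" "1 \<in> Zloc p" "-1 \<in> Zloc p" "of_nat n \<in> Zloc p" "residue p 0 = 0" "residue p 1 = 1"
  using Zloc_of_int[OF p, of 0] Zloc_of_int[OF p, of 1] Zloc_of_int[OF p, of "-1"] Zloc_of_int[OF p, of "int n"]
   residue_of_int[OF p, of 0] residue_of_int[OF p, of 1] prime_gt_1_nat[OF p] by auto

lemma Zloc_uminus: assumes p: "prime p" "x \<in> Zloc p" shows "- x \<in> Zloc p"
  using Zloc_mult[OF p(1) Zloc_simps(3)[OF p(1)] p(2)] by simp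

lemma Zloc_diff: assumes p: "prime p" "x \<in> Zloc p" "y \<in> Zloc p" shows "x - y \<in> Zloc p"
  using Zloc_add[OF p(1,2) Zloc_uminus[OF p(1,3)]] by simp

lemma Zloc_sum: assumes "prime p" "\<And>i. i \<in> I \<Longrightarrow> f i \<in> Zloc p" shows "sum f I \<in> Zloc p"
  using assms(2) by (induction I rule: infinite_finite_induct) (auto simp: Zloc_simps[OF assms(1)] Zloc_add[OF assms(1)])

lemma residue_sum: assumes "prime p" "finite I" "\<And>i. i \<in> I \<Longrightarrow> f i \<in> Zloc p"
  shows "residue p (sum f I) = (\<Sum>i\<in>I. residue p (f i)) mod int p"
  using assms(2,3)
  by (induction I) (auto simp: Zloc_simps[OF assms(1)] residue_add[OF assms(1)] Zloc_sum[OF assms(1)] mod_add_right_eq)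

definition Zloc_unit :: "nat \<Rightarrow> rat \<Rightarrow> bool" where
  "Zloc_unit p q \<longleftrightarrow> q \<in> Zloc p \<and> residue p q \<noteq> 0"

lemma Zloc_unit_mult: assumes "prime p" "Zloc_unit p x" "Zloc_unit p y" shows "Zloc_unit p (x * y)"
  unfolding Zloc_unit_def
proof
  show "x * y \<in> Zloc p" using assms Zloc_mult by (auto simp: Zloc_unit_def)
  have r: "residue p x \<in> {0..<int p}" "residue p y \<in> {0..<int p}" using assms residue_range by (auto simp: Zloc_unit_def)
  hence "\<not> int p dvd residue p x" "\<not> int p dvd residue p y" using assms
    by (auto simp: Zloc_unit_def zdvd_not_zless order.order_iff_strict)
  hence "\<not> int p dvd residue p x * residue p y" using assms(1) by (simp add: prime_dvd_mult_iff)
  thus "residue p (x * y) \<noteq> 0" using assms residue_mult by (auto simp: Zloc_unit_def dvd_eq_mod_eq_0)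
qed

lemma Zloc_unit_add_nonunit: assumes "prime p" "Zloc_unit p x" "y \<in> Zloc p" "residue p y = 0" shows "Zloc_unit p (x + y)"
  using assms residue_add[of p x y] Zloc_add[of p x y] residue_range[of p x] by (auto simp: Zloc_unit_def)

lemma Zloc_unit_inverse: assumes p: "prime p" and x: "Zloc_unit p x" shows "inverse x \<in> Zloc p"
proof -
  obtain a b where x': "x = of_int a / of_int b" "\<not> int p dvd b" "[residue p x * b = a] (mod int p)"
    using residue_cong[OF p] x unfolding Zloc_unit_def by blast
  have "\<not> int p dvd a"
  proof
    assume "int p dvd a"
    hence "[0 * b = a] (mod int p)" by (auto simp: cong_def dvd_eq_mod_eq_0)
    hence "residue p x = 0" using residue_eqI[OF p x'(1,2)] by fastforce
    thus False using x by (simp add: Zloc_unit_def)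
  qed
  moreover have "inverse x = of_int b / of_int a" unfolding x' by simp
  ultimately show ?thesis by (auto simp: Zloc_def)
qed

text \<open>Modulo \<open>p\<close> this says that a polynomial with nonzero coefficient in degree \<open>D\<close> has at most \<open>D\<close>
  roots.  If the value at \<open>x\<close> is not a unit, divide by \<open>X - x\<close>: the quotient keeps the top
  coefficient, and \<open>y - x\<close> is a unit for every other \<open>y\<close> in \<open>S\<close>.\<close>

lemma poly_unit_value:
  fixes f :: "rat poly"
  assumes p: "prime p" and "\<And>i. coeff f i \<in> Zloc p" "degree f \<le> D" "Zloc_unit p (coeff f D)"
    and "finite S" "S \<subseteq> {..<p}" "card S > D"
  shows "\<exists>x\<in>S. Zloc_unit p (poly f (of_nat x))"
  using assms(2-)
proof (induction D arbitrary: f S)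
  case 0
  then obtain x where x: "x \<in> S" by (cases "S = {}") auto
  obtain c where "f = [:c:]" using 0 by (auto elim: degree_eq_zeroE)
  thus ?case using 0 x by auto
next
  case (Suc D)
  from Suc.prems obtain x where x: "x \<in> S" by (cases "S = {}") auto
  show ?case
  proof (cases "Zloc_unit p (poly f (of_nat x))")
    case True thus ?thesis using x by blast
  next
    case False
    define g where "g = synthetic_div f (of_nat x)"
    have fg: "f + smult (of_nat x) g = pCons (poly f (of_nat x)) g"
      unfolding g_def by (rule synthetic_div_correct)
    have g1: "coeff g i = coeff f (Suc i) + of_nat x * coeff g (Suc i)" for i
      using arg_cong[OF fg, of "\<lambda>h. coeff h (Suc i)"] by simp
    have dg: "degree g \<le> D" unfolding g_def using Suc.prems by (simp add: degree_synthetic_div)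
    have gD: "coeff g (Suc j) = 0" if "j \<ge> D" for j using dg that by (intro coeff_eq_0) auto
    have gZ: "coeff g i \<in> Zloc p" for i
    proof (cases "i \<le> D")
      case True
      thus ?thesis
      proof (induction rule: inc_induct)
        case base
        show ?case using g1[of D] gD[of D] Suc.prems by simp
      next
        case (step n)
        show ?case unfolding g1[of n]
          by (intro Zloc_add[OF p] Zloc_mult[OF p] Zloc_simps[OF p] Suc.prems step)
      qed
    next
      case False
      thus ?thesis using gD[of "i - 1"] by (cases i) (auto simp: Zloc_simps[OF p])
    qed
    have "\<exists>y\<in>S - {x}. Zloc_unit p (poly g (of_nat y))"
    proof (rule Suc.IH)
      show "Zloc_unit p (coeff g D)" using g1[of D] gD[of D] Suc.prems by simp
    qed (use gZ dg Suc.prems x in auto)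
    then obtain y where y: "y \<in> S" "y \<noteq> x" "Zloc_unit p (poly g (of_nat y))" by blast
    have fx: "poly f (of_nat x) \<in> Zloc p"
      unfolding poly_altdef
      by (intro Zloc_sum[OF p] Zloc_mult[OF p] Suc.prems)
        (metis Zloc_simps(4)[OF p] of_nat_power)
    have "poly f (of_nat y) = of_nat y * poly g (of_nat y) + poly f (of_nat x) - of_nat x * poly g (of_nat y)"
      using arg_cong[OF fg, of "\<lambda>h. poly h (of_nat y)"] by (simp add: algebra_simps)
    hence e: "poly f (of_nat y) = of_int (int y - int x) * poly g (of_nat y) + poly f (of_nat x)"
      by (simp add: algebra_simps)
    have "\<not> int p dvd int y - int x"
    proof
      assume "int p dvd int y - int x"
      moreover have "x < p" "y < p" using Suc.prems x y(1) by auto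
      hence "\<bar>int y - int x\<bar> < int p" by linarith
      ultimately show False using y(2) dvd_imp_le_int[of "int y - int x" "int p"] by auto
    qed
    hence "Zloc_unit p (of_int (int y - int x))"
      unfolding Zloc_unit_def residue_of_int[OF p] 
      using Zloc_of_int[OF p, of "int y - int x"] by (simp add: dvd_eq_mod_eq_0)
    hence "Zloc_unit p (poly f (of_nat y))" unfolding e
      using y False fx by (intro Zloc_unit_add_nonunit Zloc_unit_mult p) (auto simp: Zloc_unit_def)
    thus ?thesis using y by blast
  qed
qed

section \<open>Cost of an element of a finitely generated ring\<close>

text \<open>One number that controls both the degree and the size of the coefficients: an element of cost
  at most \<open>m\<close> is the value at elements of \<open>A\<close> of an integer polynomial of degree at most \<open>m\<close> whose
  coefficients have absolute values summing to at most \<open>2 ^ m\<close>.  Constants have cost \<open>1\<close> rather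
  than \<open>0\<close>, so that costs are positive and additive constants can be absorbed by quadratic
  bounds.\<close>

inductive cost_le :: "complex set \<Rightarrow> nat \<Rightarrow> complex \<Rightarrow> bool" for A where
  zero: "cost_le A 1 0"
| one: "cost_le A 1 1"
| minus_one: "cost_le A 1 (-1)"
| gen: "a \<in> A \<Longrightarrow> cost_le A 1 a"
| mult: "cost_le A i x \<Longrightarrow> cost_le A j y \<Longrightarrow> cost_le A (i + j) (x * y)"
| add: "cost_le A i x \<Longrightarrow> cost_le A i y \<Longrightarrow> cost_le A (Suc i) (x + y)"
| Suc: "cost_le A i x \<Longrightarrow> cost_le A (Suc i) x"

lemma cost_le_pos: "cost_le A m x \<Longrightarrow> m \<ge> 1"
  by (induction rule: cost_le.induct) auto

lemma cost_le_mono: "cost_le A i x \<Longrightarrow> i \<le> j \<Longrightarrow> cost_le A j x"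
  by (induction j) (auto simp: le_Suc_eq intro: cost_le.Suc)

lemma cost_le_add: "cost_le A i x \<Longrightarrow> cost_le A j y \<Longrightarrow> i < m \<Longrightarrow> j < m \<Longrightarrow> cost_le A m (x + y)"
  by (cases m) (auto intro!: cost_le.add elim!: cost_le_mono)

lemma cost_le_mult: "cost_le A i x \<Longrightarrow> cost_le A j y \<Longrightarrow> i + j \<le> m \<Longrightarrow> cost_le A m (x * y)"
  using cost_le.mult cost_le_mono by blast

lemma cost_le_uminus: "cost_le A i x \<Longrightarrow> cost_le A (Suc i) (- x)"
  using cost_le.mult[OF cost_le.minus_one, of A i x] by simp

lemma cost_le_sum:
  assumes "finite I" "\<And>i. i \<in> I \<Longrightarrow> cost_le A m (f i)" "m \<ge> 1"
  shows "cost_le A (m + card I) (sum f I)"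
  using assms
proof (induction I)
  case empty
  thus ?case using cost_le_mono[OF cost_le.zero, of m A] by simp
next
  case (insert i I)
  thus ?case by (auto intro!: cost_le_add[of A m "f i" "m + card I" "sum f I"])
qed

lemma cost_le_prod:
  assumes "finite I" "\<And>i. i \<in> I \<Longrightarrow> cost_le A m (f i)"
  shows "cost_le A (m * card I + 1) (prod f I)"
  using assms
proof (induction I)
  case empty
  thus ?case using cost_le.one by simp
next
  case (insert i I)
  thus ?case by (auto intro!: cost_le_mult[of A m "f i" "m * card I + 1" "prod f I"])
qed

text \<open>The Leibniz formula has \<open>fact e\<close> summands, each a sign times a product of \<open>e\<close> entries.\<close>

lemma cost_le_det:
  assumes M: "M \<in> carrier_mat e e" and "\<And>i j. i < e \<Longrightarrow> j < e \<Longrightarrow> cost_le A m (M $$ (i, j))"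
  shows "cost_le A (m * e + 2 + fact e) (det M)"
proof -
  have s: "cost_le A 1 (signof \<pi>)" for \<pi> :: "nat \<Rightarrow> nat"
    using cost_le.one[of A] cost_le.minus_one[of A] by (auto simp: sign_def)
  have "cost_le A (m * e + 2) (signof \<pi> * (\<Prod>i = 0..<e. M $$ (i, \<pi> i)))" if "\<pi> permutes {0..<e}" for \<pi>
  proof (rule cost_le_mult[OF s])
    have "cost_le A (m * card {0..<e} + 1) (\<Prod>i = 0..<e. M $$ (i, \<pi> i))"
      using that by (intro cost_le_prod assms) (auto simp: permutes_in_image[of \<pi> "{0..<e}", simplified])
    thus "cost_le A (m * e + 1) (\<Prod>i = 0..<e. M $$ (i, \<pi> i))" by simp
  qed simp
  hence "cost_le A (m * e + 2 + card {\<pi>. \<pi> permutes {0..<e}}) (\<Sum>\<pi>\<in>{\<pi>. \<pi> permutes {0..<e}}. signof \<pi> * (\<Prod>i = 0..<e. M $$ (i, \<pi> i)))"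
    by (intro cost_le_sum) (auto simp: finite_permutations)
  thus ?thesis using M by (simp add: det_def' card_permutations)
qed

definition generated_subring :: "complex set \<Rightarrow> complex set" where
  "generated_subring A = {z. \<exists>m. cost_le A m z}"

definition is_subring :: "'a::comm_ring_1 set \<Rightarrow> bool" where
  "is_subring R \<longleftrightarrow> 0 \<in> R \<and> 1 \<in> R \<and> (\<forall>x\<in>R. - x \<in> R) \<and> (\<forall>x\<in>R. \<forall>y\<in>R. x + y \<in> R \<and> x * y \<in> R)"

lemma is_subringD:
  assumes "is_subring R"
  shows "0 \<in> R" "1 \<in> R" "x \<in> R \<Longrightarrow> - x \<in> R" "x \<in> R \<Longrightarrow> y \<in> R \<Longrightarrow> x + y \<in> R"
    "x \<in> R \<Longrightarrow> y \<in> R \<Longrightarrow> x * y \<in> R" "x \<in> R \<Longrightarrow> y \<in> R \<Longrightarrow> x - y \<in> R" "x \<in> R \<Longrightarrow> x ^ n \<in> R"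
proof -
  show a: "0 \<in> R" "1 \<in> R" "x \<in> R \<Longrightarrow> - x \<in> R" "x \<in> R \<Longrightarrow> y \<in> R \<Longrightarrow> x + y \<in> R"
    "x \<in> R \<Longrightarrow> y \<in> R \<Longrightarrow> x * y \<in> R" for x y using assms by (auto simp: is_subring_def)
  show "x \<in> R \<Longrightarrow> y \<in> R \<Longrightarrow> x - y \<in> R" using a(4)[of x "- y"] a(3)[of y] by simp
  show "x \<in> R \<Longrightarrow> x ^ n \<in> R" by (induction n) (auto intro: a)
qed

lemma subring_sum: "is_subring R \<Longrightarrow> (\<And>i. i \<in> I \<Longrightarrow> f i \<in> R) \<Longrightarrow> sum f I \<in> R"
  by (induction I rule: infinite_finite_induct) (auto simp: is_subringD)

lemma subring_prod: "is_subring R \<Longrightarrow> (\<And>i. i \<in> I \<Longrightarrow> f i \<in> R) \<Longrightarrow> prod f I \<in> R"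
  by (induction I rule: infinite_finite_induct) (auto simp: is_subringD)

lemma subring_det:
  assumes R: "is_subring R" and M: "M \<in> carrier_mat e e" and "\<And>i j. i < e \<Longrightarrow> j < e \<Longrightarrow> M $$ (i, j) \<in> R"
  shows "det M \<in> R"
proof -
  have "signof \<pi> \<in> R" for \<pi> :: "nat \<Rightarrow> nat"
    using R by (auto simp: sign_def is_subringD)
  thus ?thesis unfolding det_def'[OF M]
    by (intro subring_sum is_subringD(5)[OF R] subring_prod R assms)
      (auto simp: permutes_in_image[of _ "{0..<e}", simplified])
qed

lemma subring_adj_mat:
  assumes R: "is_subring R" and M: "M \<in> carrier_mat e e" and "\<And>i j. i < e \<Longrightarrow> j < e \<Longrightarrow> M $$ (i, j) \<in> R"
    and "i < e" "j < e"
  shows "adj_mat M $$ (i, j) \<in> R"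
proof -
  have "det (mat_delete M j i) \<in> R"
    using M assms by (intro subring_det[OF R, of _ "e - 1"]) (auto simp: mat_delete_def)
  thus ?thesis using assms M by (auto simp: adj_mat_def cofactor_def intro!: is_subringD[OF R])
qed

lemma subring_poly_coeffs:
  assumes R: "is_subring R"
  shows "is_subring {f. \<forall>n. coeff f n \<in> R}"
  using R by (auto simp: is_subring_def coeff_mult coeff_1 intro!: subring_sum)

text \<open>The polynomials with coefficients in \<open>R\<close> form a subring that contains the entries of \<open>X - M\<close>.\<close>

lemma subring_char_poly:
  assumes R: "is_subring R" and M: "M \<in> carrier_mat e e" and "\<And>i j. i < e \<Longrightarrow> j < e \<Longrightarrow> M $$ (i, j) \<in> R"
  shows "coeff (char_poly M) n \<in> R"
proof -
  let ?P = "{f. \<forall>n. coeff f n \<in> R}"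
  have P: "is_subring ?P" by (rule subring_poly_coeffs[OF R])
  have "char_poly M \<in> ?P" unfolding char_poly_def
  proof (rule subring_det[OF P])
    show "char_poly_matrix M \<in> carrier_mat e e" using M by simp
    fix i j assume "i < e" "j < e"
    thus "char_poly_matrix M $$ (i, j) \<in> ?P" using M assms
      by (auto simp: char_poly_matrix_def coeff_pCons split: nat.split intro!: is_subringD[OF R])
  qed
  thus ?thesis by simp
qed

lemma is_subring_generated: "is_subring (generated_subring A)"
  unfolding is_subring_def generated_subring_def
proof (intro conjI ballI)
  fix x y assume "x \<in> {z. \<exists>m. cost_le A m z}" "y \<in> {z. \<exists>m. cost_le A m z}"
  then obtain i j where "cost_le A i x" "cost_le A j y" by blast
  hence "cost_le A (Suc (max i j)) (x + y)" "cost_le A (i + j) (x * y)"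
    by (auto intro: cost_le_add cost_le.mult)
  thus "x + y \<in> {z. \<exists>m. cost_le A m z}" "x * y \<in> {z. \<exists>m. cost_le A m z}" by blast+
next
  fix x assume "x \<in> {z. \<exists>m. cost_le A m z}"
  thus "- x \<in> {z. \<exists>m. cost_le A m z}" using cost_le_uminus by blast
next
  show "0 \<in> {z. \<exists>m. cost_le A m z}" "1 \<in> {z. \<exists>m. cost_le A m z}"
    using cost_le.zero cost_le.one by blast+
qed

lemma generated_subring_gen: "a \<in> A \<Longrightarrow> a \<in> generated_subring A"
  unfolding generated_subring_def using cost_le.gen by blast

lemma cost_le_in_generated_subring: "cost_le A m z \<Longrightarrow> z \<in> generated_subring A"
  unfolding generated_subring_def by blast

lemma generated_subring_least: assumes "is_subring R" "A \<subseteq> R" shows "generated_subring A \<subseteq> R"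
proof
  fix z assume "z \<in> generated_subring A"
  then obtain m where "cost_le A m z" unfolding generated_subring_def by blast
  thus "z \<in> R" by induction (use assms in \<open>auto simp: is_subringD\<close>)
qed

section \<open>Matrix representations over the local ring\<close>

definition Zloc_mat :: "nat \<Rightarrow> nat \<Rightarrow> rat mat set" where
  "Zloc_mat p k = {M \<in> carrier_mat k k. \<forall>i<k. \<forall>j<k. M $$ (i, j) \<in> Zloc p}"

text \<open>Ring homomorphisms from \<open>R\<close> to the \<open>k\<close> by \<open>k\<close> matrices over the local ring.  Outside \<open>R\<close> the
  function is arbitrary.\<close>

definition local_rep :: "nat \<Rightarrow> nat \<Rightarrow> complex set \<Rightarrow> (complex \<Rightarrow> rat mat) \<Rightarrow> bool" where
  "local_rep p k R \<phi> \<longleftrightarrow> (\<forall>x\<in>R. \<phi> x \<in> Zloc_mat p k) \<and> \<phi> 1 = 1\<^sub>m k \<and>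
     (\<forall>x\<in>R. \<forall>y\<in>R. \<phi> (x + y) = \<phi> x + \<phi> y \<and> \<phi> (x * y) = \<phi> x * \<phi> y)"

definition Zloc_unit_mat :: "nat \<Rightarrow> nat \<Rightarrow> rat mat \<Rightarrow> bool" where
  "Zloc_unit_mat p k M \<longleftrightarrow> (\<exists>N\<in>Zloc_mat p k. M * N = 1\<^sub>m k \<and> N * M = 1\<^sub>m k)"

lemma Zloc_mat_carrier: "M \<in> Zloc_mat p k \<Longrightarrow> M \<in> carrier_mat k k"
  by (simp add: Zloc_mat_def)

lemma Zloc_matD: "M \<in> Zloc_mat p k \<Longrightarrow> i < k \<Longrightarrow> j < k \<Longrightarrow> M $$ (i, j) \<in> Zloc p"
  by (simp add: Zloc_mat_def)

lemma Zloc_matI: "M \<in> carrier_mat k k \<Longrightarrow> (\<And>i j. i < k \<Longrightarrow> j < k \<Longrightarrow> M $$ (i, j) \<in> Zloc p) \<Longrightarrow> M \<in> Zloc_mat p k"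
  by (simp add: Zloc_mat_def)

lemma local_repD:
  assumes "local_rep p k R \<phi>"
  shows "x \<in> R \<Longrightarrow> \<phi> x \<in> carrier_mat k k" "x \<in> R \<Longrightarrow> \<phi> x \<in> Zloc_mat p k" "\<phi> 1 = 1\<^sub>m k"
    "x \<in> R \<Longrightarrow> y \<in> R \<Longrightarrow> \<phi> (x + y) = \<phi> x + \<phi> y" "x \<in> R \<Longrightarrow> y \<in> R \<Longrightarrow> \<phi> (x * y) = \<phi> x * \<phi> y"
  using assms Zloc_mat_carrier[of _ p k] unfolding local_rep_def by blast+

lemma local_repI:
  assumes "\<And>x. x \<in> R \<Longrightarrow> \<phi> x \<in> Zloc_mat p k" "\<phi> 1 = 1\<^sub>m k"
    "\<And>x y. x \<in> R \<Longrightarrow> y \<in> R \<Longrightarrow> \<phi> (x + y) = \<phi> x + \<phi> y" "\<And>x y. x \<in> R \<Longrightarrow> y \<in> R \<Longrightarrow> \<phi> (x * y) = \<phi> x * \<phi> y"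
  shows "local_rep p k R \<phi>"
  using assms unfolding local_rep_def by blast

lemma local_rep_zero:
  assumes "local_rep p k R \<phi>" "is_subring R" shows "\<phi> 0 = 0\<^sub>m k k"
proof -
  have 0: "0 \<in> R" using assms by (simp add: is_subringD)
  have c: "\<phi> 0 \<in> carrier_mat k k" using local_repD[OF assms(1)] 0 by blast
  have "\<phi> 0 + \<phi> 0 = \<phi> 0" using local_repD(4)[OF assms(1) 0 0] by simp
  hence e: "(\<phi> 0 + \<phi> 0) $$ (i, j) = \<phi> 0 $$ (i, j)" for i j by simp
  show ?thesis
  proof (rule eq_matI)
    fix i j assume "i < dim_row (0\<^sub>m k k :: rat mat)" "j < dim_col (0\<^sub>m k k :: rat mat)"
    thus "\<phi> 0 $$ (i, j) = (0\<^sub>m k k :: rat mat) $$ (i, j)" using e[of i j] c by simp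
  qed (use c in auto)
qed

lemma local_rep_uminus:
  assumes r: "local_rep p k R \<phi>" "is_subring R" and x: "x \<in> R" shows "\<phi> (- x) = - \<phi> x"
proof -
  have mx: "- x \<in> R" using assms by (simp add: is_subringD)
  have c: "\<phi> x \<in> carrier_mat k k" "\<phi> (- x) \<in> carrier_mat k k" using local_repD[OF r(1)] x mx by blast+
  have s: "\<phi> x + \<phi> (- x) = 0\<^sub>m k k" using local_repD(4)[OF r(1) x mx] local_rep_zero[OF r] by simp
  show ?thesis
  proof (rule eq_matI)
    fix i j assume "i < dim_row (- \<phi> x)" "j < dim_col (- \<phi> x)"
    hence ij: "i < k" "j < k" using c by auto
    have "(\<phi> x + \<phi> (- x)) $$ (i, j) = 0" using s ij by simp
    thus "\<phi> (- x) $$ (i, j) = (- \<phi> x) $$ (i, j)" using ij c by simp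
  qed (use c in auto)
qed

lemma local_rep_diff_index:
  assumes r: "local_rep p k R \<phi>" "is_subring R" and x: "x \<in> R" "y \<in> R" and ij: "i < k" "j < k"
  shows "\<phi> (x - y) $$ (i, j) = \<phi> x $$ (i, j) - \<phi> y $$ (i, j)"
proof -
  have my: "- y \<in> R" using assms by (simp add: is_subringD)
  have c: "\<phi> y \<in> carrier_mat k k" "\<phi> (- y) \<in> carrier_mat k k" using local_repD[OF r(1)] x my by blast+
  have "\<phi> (x - y) = \<phi> x + (- \<phi> y)" using local_repD(4)[OF r(1) x(1) my] local_rep_uminus[OF r x(2)] by simp
  thus ?thesis using c ij by simp
qed

lemma local_rep_sum_index:
  assumes r: "local_rep p k R \<phi>" "is_subring R" and "\<And>i. i \<in> I \<Longrightarrow> f i \<in> R" "finite I" and ij: "a < k" "b < k"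
  shows "\<phi> (sum f I) $$ (a, b) = (\<Sum>i\<in>I. \<phi> (f i) $$ (a, b))"
  using assms(4,3)
proof (induction I)
  case empty
  thus ?case using local_rep_zero[OF r] ij by simp
next
  case (insert i I)
  have "sum f I \<in> R" using insert by (intro subring_sum[OF r(2)]) auto
  hence "\<phi> (f i + sum f I) = \<phi> (f i) + \<phi> (sum f I)" "\<phi> (sum f I) \<in> carrier_mat k k"
    using local_repD[OF r(1)] insert by auto
  thus ?case using insert ij by simp
qed

lemma Zloc_mat_mult: assumes "prime p" "M \<in> Zloc_mat p k" "N \<in> Zloc_mat p k" shows "M * N \<in> Zloc_mat p k"
proof (rule Zloc_matI)
  fix i j assume "i < k" "j < k"
  thus "(M * N) $$ (i, j) \<in> Zloc p" using assms
    by (auto simp: scalar_prod_def Zloc_mat_def intro!: Zloc_sum Zloc_mult)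
qed (use Zloc_mat_carrier[OF assms(2)] Zloc_mat_carrier[OF assms(3)] in auto)

lemma Zloc_mat_one: "prime p \<Longrightarrow> 1\<^sub>m k \<in> Zloc_mat p k"
  by (rule Zloc_matI) (auto simp: Zloc_simps)

lemma subring_Zloc: "prime p \<Longrightarrow> is_subring (Zloc p)"
  by (auto simp: is_subring_def Zloc_simps Zloc_add Zloc_mult Zloc_uminus)

lemma Zloc_unit_matI_det:
  assumes p: "prime p" and M: "M \<in> Zloc_mat p k" and d: "Zloc_unit p (det M)"
  shows "Zloc_unit_mat p k M"
proof -
  have M': "M \<in> carrier_mat k k" using M by (rule Zloc_mat_carrier)
  have R: "is_subring (Zloc p)" by (rule subring_Zloc[OF p])
  define N where "N = inverse (det M) \<cdot>\<^sub>m adj_mat M"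
  note adj = adj_mat[OF M']
  have d0: "det M \<noteq> 0" using d Zloc_simps[OF p] by (auto simp: Zloc_unit_def)
  have "N \<in> Zloc_mat p k" unfolding N_def
  proof (rule Zloc_matI)
    fix i j assume ij: "i < k" "j < k"
    have "adj_mat M $$ (i, j) \<in> Zloc p" by (rule subring_adj_mat[OF R M' Zloc_matD[OF M] ij])
    hence "inverse (det M) * adj_mat M $$ (i, j) \<in> Zloc p" by (rule Zloc_mult[OF p Zloc_unit_inverse[OF p d]])
    thus "(inverse (det M) \<cdot>\<^sub>m adj_mat M) $$ (i, j) \<in> Zloc p"
      using adj(1) ij by simp
  qed (use adj in auto)
  moreover have s: "inverse (det M) \<cdot>\<^sub>m (det M \<cdot>\<^sub>m 1\<^sub>m k) = 1\<^sub>m k"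
    by (rule eq_matI) (use d0 in auto)
  have "M * N = 1\<^sub>m k"
    unfolding N_def mult_smult_distrib[OF M' adj(1)] adj(2) by (rule s)
  moreover have "N * M = 1\<^sub>m k"
    unfolding N_def mult_smult_assoc_mat[OF adj(1) M'] adj(3) by (rule s)
  ultimately show ?thesis unfolding Zloc_unit_mat_def by blast
qed

lemma inverse_mat_unique:
  assumes "(N::'a::comm_ring_1 mat) \<in> carrier_mat k k" "M \<in> carrier_mat k k" "N' \<in> carrier_mat k k" "N * M = 1\<^sub>m k" "M * N' = 1\<^sub>m k"
  shows "N = N'"
proof -
  have "N = N * (M * N')" unfolding assms(5) by (rule right_mult_one_mat[OF assms(1), symmetric])
  also have "\<dots> = (N * M) * N'" by (rule assoc_mult_mat[OF assms(1-3), symmetric])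
  also have "\<dots> = N'" unfolding assms(4) by (rule left_mult_one_mat[OF assms(3)])
  finally show ?thesis .
qed

text \<open>For commuting factors a one-sided inverse of \<open>M\<close> can be read off from an inverse of the product,
  on either side.\<close>

lemma Zloc_unit_mat_factor:
  assumes p: "prime p" and c: "M \<in> Zloc_mat p k" "N \<in> Zloc_mat p k" and comm: "M * N = N * M" and u: "Zloc_unit_mat p k (M * N)"
  shows "Zloc_unit_mat p k M"
proof -
  obtain L where L: "L \<in> Zloc_mat p k" "M * N * L = 1\<^sub>m k" "L * (M * N) = 1\<^sub>m k"
    using u unfolding Zloc_unit_mat_def by (elim bexE conjE)
  have cc: "M \<in> carrier_mat k k" "N \<in> carrier_mat k k" "L \<in> carrier_mat k k"
    using c L(1) by (auto intro: Zloc_mat_carrier)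
  have r: "M * (N * L) = 1\<^sub>m k" unfolding assoc_mult_mat[OF cc, symmetric] by (rule L(2))
  have l: "(L * N) * M = 1\<^sub>m k" unfolding assoc_mult_mat[OF cc(3,2,1)] comm[symmetric] by (rule L(3))
  have e: "L * N = N * L" using cc by (intro inverse_mat_unique[OF _ cc(1) _ l r]) auto
  have "N * L \<in> Zloc_mat p k" using Zloc_mat_mult[OF p c(2) L(1)] .
  thus ?thesis unfolding Zloc_unit_mat_def using r l[unfolded e] by (intro bexI[of _ "N * L"] conjI)
qed

text \<open>The property that is carried through the induction on the generators.  It asks for invertible,
  not merely for nonzero, images: this is what allows denominators to be adjoined.  The bound
  \<open>m < p\<close> leaves enough residues to choose the image of a transcendental generator from.\<close>

definition small_prime_separable :: "complex set \<Rightarrow> bool" where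
  "small_prime_separable A \<longleftrightarrow> (\<exists>k\<ge>1. \<exists>C\<ge>1. \<exists>e. \<forall>m z. cost_le A m z \<and> z \<noteq> 0 \<longrightarrow>
     (\<exists>p \<phi>. prime p \<and> m < p \<and> p \<le> C * m ^ e \<and> local_rep p k (generated_subring A) \<phi> \<and> Zloc_unit_mat p k (\<phi> z)))"

text \<open>Each step of the induction trades an element \<open>z\<close> of the larger ring for an element \<open>y\<close> of the
  smaller one, of at most quadratic cost, such that a representation making \<open>y\<close> invertible yields one
  making \<open>z\<close> invertible.  Composing polynomial bounds gives a polynomial bound.\<close>

lemma small_prime_separable_pullback:
  assumes "small_prime_separable A"
    and pull: "\<And>k. k \<ge> 1 \<Longrightarrow> \<exists>l\<ge>1. \<exists>c\<ge>1. \<forall>m z. cost_le B m z \<and> z \<noteq> 0 \<longrightarrow>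
      (\<exists>y. cost_le A (c * m ^ 2) y \<and> y \<noteq> 0 \<and>
        (\<forall>p \<phi>. prime p \<and> c * m ^ 2 < p \<and> local_rep p k (generated_subring A) \<phi> \<and> Zloc_unit_mat p k (\<phi> y) \<longrightarrow>
          (\<exists>\<psi>. local_rep p l (generated_subring B) \<psi> \<and> Zloc_unit_mat p l (\<psi> z))))"
  shows "small_prime_separable B"
proof -
  from assms(1) obtain k C e where k: "k \<ge> 1" "C \<ge> 1" and g: "\<And>m z. cost_le A m z \<Longrightarrow> z \<noteq> 0 \<Longrightarrow>
     (\<exists>p \<phi>. prime p \<and> m < p \<and> p \<le> C * m ^ e \<and> local_rep p k (generated_subring A) \<phi> \<and> Zloc_unit_mat p k (\<phi> z))"
    unfolding small_prime_separable_def by blast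
  from pull[OF k(1)] obtain l c where l: "l \<ge> 1" "c \<ge> 1" and h: "\<And>m z. cost_le B m z \<Longrightarrow> z \<noteq> 0 \<Longrightarrow>
      (\<exists>y. cost_le A (c * m ^ 2) y \<and> y \<noteq> 0 \<and>
        (\<forall>p \<phi>. prime p \<and> c * m ^ 2 < p \<and> local_rep p k (generated_subring A) \<phi> \<and> Zloc_unit_mat p k (\<phi> y) \<longrightarrow>
          (\<exists>\<psi>. local_rep p l (generated_subring B) \<psi> \<and> Zloc_unit_mat p l (\<psi> z))))" by blast
  have "\<exists>p \<psi>. prime p \<and> m < p \<and> p \<le> (C * c ^ e) * m ^ (2 * e) \<and> local_rep p l (generated_subring B) \<psi> \<and> Zloc_unit_mat p l (\<psi> z)"
    if z: "cost_le B m z" "z \<noteq> 0" for m z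
  proof -
    from h[OF z] obtain y where y: "cost_le A (c * m ^ 2) y" "y \<noteq> 0" and
      y': "\<And>p \<phi>. prime p \<Longrightarrow> c * m ^ 2 < p \<Longrightarrow> local_rep p k (generated_subring A) \<phi> \<Longrightarrow> Zloc_unit_mat p k (\<phi> y) \<Longrightarrow>
          (\<exists>\<psi>. local_rep p l (generated_subring B) \<psi> \<and> Zloc_unit_mat p l (\<psi> z))" by blast
    from g[OF y] obtain p \<phi> where p: "prime p" "c * m ^ 2 < p" "p \<le> C * (c * m ^ 2) ^ e"
      "local_rep p k (generated_subring A) \<phi>" "Zloc_unit_mat p k (\<phi> y)" by blast
    obtain \<psi> where "local_rep p l (generated_subring B) \<psi>" "Zloc_unit_mat p l (\<psi> z)" using y' p by blast
    moreover have "p \<le> (C * c ^ e) * m ^ (2 * e)"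
      using p(3) by (simp add: power_mult_distrib power_mult mult.assoc)
    moreover have "m < p"
    proof -
      have "1 \<le> c * m" using l(2) cost_le_pos[OF z(1)] by simp
      hence "1 * m \<le> (c * m) * m" by (intro mult_right_mono) auto
      hence "m \<le> c * m ^ 2" by (simp only: power2_eq_square mult.assoc mult_1_left)
      thus ?thesis using p(2) by (rule le_less_trans)
    qed
    ultimately show ?thesis using p(1) by blast
  qed
  moreover have "C * c ^ e \<ge> 1" using k l by simp
  ultimately show ?thesis unfolding small_prime_separable_def using l(1) by blast
qed

text \<open>The ring is that of the integers, and an integer of cost at most \<open>m\<close> has absolute value at most
  \<open>2 ^ m\<close>; a representation of size one over the local ring at a prime not dividing it suffices.\<close>

lemma small_prime_separable_empty: "small_prime_separable {}"
proof -
  \<comment> \<open>the height estimate behind the definition of the cost\<close>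
  have int: "\<exists>i. z = of_int i \<and> \<bar>i\<bar> \<le> 2 ^ m" if "cost_le {} m z" for m z
    using that
  proof induction
    case zero show ?case by (rule exI[of _ 0]) simp
  next
    case one show ?case by (rule exI[of _ 1]) simp
  next
    case minus_one show ?case by (rule exI[of _ "-1"]) simp
  next
    case (mult i x j y)
    then obtain a b where ab: "x = of_int a" "\<bar>a\<bar> \<le> 2 ^ i" "y = of_int b" "\<bar>b\<bar> \<le> 2 ^ j" by blast
    hence "\<bar>a * b\<bar> \<le> 2 ^ (i + j)" by (simp add: abs_mult power_add mult_mono)
    thus ?case using ab by (intro exI[of _ "a * b"]) simp
  next
    case (add i x y)
    then obtain a b where ab: "x = of_int a" "\<bar>a\<bar> \<le> 2 ^ i" "y = of_int b" "\<bar>b\<bar> \<le> 2 ^ i" by blast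
    hence "\<bar>a + b\<bar> \<le> 2 ^ Suc i" by simp
    thus ?case using ab by (intro exI[of _ "a + b"]) simp
  next
    case (Suc i x)
    then obtain a where ab: "x = of_int a" "\<bar>a\<bar> \<le> 2 ^ i" by blast
    hence "\<bar>a\<bar> \<le> 2 ^ Suc i" by simp
    thus ?case using ab by blast
  qed auto
  define \<phi> :: "complex \<Rightarrow> rat mat" where "\<phi> z = mat 1 1 (\<lambda>_. of_int (THE i. z = of_int i))" for z
  have \<phi>: "\<phi> (of_int i) = mat 1 1 (\<lambda>_. of_int i)" for i unfolding \<phi>_def by simp
  have sp: "generated_subring {} \<subseteq> range of_int" using int unfolding generated_subring_def by blast
  have "\<exists>p \<phi>. prime p \<and> m < p \<and> p \<le> 64 * m ^ 2 \<and> local_rep p 1 (generated_subring {}) \<phi> \<and> Zloc_unit_mat p 1 (\<phi> z)"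
    if z: "cost_le {} m z" "z \<noteq> 0" for m z
  proof -
    from int[OF z(1)] obtain i where i: "z = of_int i" "\<bar>i\<bar> \<le> 2 ^ m" by blast
    obtain p where p: "prime p" "m < p" "p \<le> 64 * m ^ 2" "\<not> int p dvd i"
      using exists_prime_not_dvd[of m i] i z cost_le_pos[OF z(1)] by auto
    have "local_rep p 1 (generated_subring {}) \<phi>"
    proof (rule local_repI)
      fix x assume "x \<in> generated_subring {}"
      then obtain a where a: "x = of_int a" using sp by blast
      thus "\<phi> x \<in> Zloc_mat p 1" by (intro Zloc_matI) (auto simp: \<phi> Zloc_of_int p)
      fix y assume "y \<in> generated_subring {}"
      then obtain b where b: "y = of_int b" using sp by blast
      show "\<phi> (x + y) = \<phi> x + \<phi> y" unfolding a b of_int_add[symmetric] \<phi> by (rule eq_matI) auto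
      show "\<phi> (x * y) = \<phi> x * \<phi> y" unfolding a b of_int_mult[symmetric] \<phi>
        by (rule eq_matI) (auto simp: scalar_prod_def)
    next
      show "\<phi> 1 = 1\<^sub>m 1" using \<phi>[of 1] by (intro eq_matI) auto
    qed
    moreover have "Zloc_unit_mat p 1 (\<phi> z)"
    proof (rule Zloc_unit_matI_det[OF p(1)])
      show "\<phi> z \<in> Zloc_mat p 1" unfolding i by (intro Zloc_matI) (auto simp: \<phi> Zloc_of_int p)
      have "det (\<phi> z) = of_int i" unfolding i \<phi> by (subst det_single) auto
      thus "Zloc_unit p (det (\<phi> z))" using p by (simp add: Zloc_unit_def Zloc_of_int residue_of_int dvd_eq_mod_eq_0)
    qed
    ultimately show ?thesis using p by blast
  qed
  moreover have "(1::nat) \<le> 1" "(1::nat) \<le> 64" by simp_all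
  ultimately show ?thesis unfolding small_prime_separable_def by blast
qed

section \<open>Block matrices\<close>

lemma block_index_less: "l < e \<Longrightarrow> s < k \<Longrightarrow> l * k + s < e * (k::nat)"
proof -
  assume a: "l < e" "s < k"
  hence "l * k + s < Suc l * k" by simp
  also have "\<dots> \<le> e * k" using a by (intro mult_right_mono) auto
  finally show ?thesis .
qed

lemma sum_div_mod:
  fixes f :: "nat \<Rightarrow> nat \<Rightarrow> 'a::comm_monoid_add"
  assumes "k \<ge> 1"
  shows "(\<Sum>t<e * k. f (t div k) (t mod k)) = (\<Sum>l<e. \<Sum>s<k. f l s)"
proof -
  have "(\<Sum>t<e * k. f (t div k) (t mod k)) = (\<Sum>(l, s)\<in>{..<e} \<times> {..<k}. f l s)"
    by (rule sum.reindex_bij_witness[of _ "\<lambda>(l, s). l * k + s" "\<lambda>t. (t div k, t mod k)"])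
      (use assms in \<open>auto simp: less_mult_imp_div_less intro: block_index_less\<close>)
  thus ?thesis by (simp add: sum.cartesian_product)
qed

definition block_mat :: "nat \<Rightarrow> nat \<Rightarrow> (nat \<Rightarrow> nat \<Rightarrow> rat mat) \<Rightarrow> rat mat" where
  "block_mat e k F = mat (e * k) (e * k) (\<lambda>(i, j). F (i div k) (j div k) $$ (i mod k, j mod k))"

lemma block_mat_carrier: "block_mat e k F \<in> carrier_mat (e * k) (e * k)"
  by (simp add: block_mat_def)

lemma block_mat_index:
  assumes "i < e" "j < e" "a < k" "b < k"
  shows "block_mat e k F $$ (i * k + a, j * k + b) = F i j $$ (a, b)"
proof -
  have "i * k + a < e * k" "j * k + b < e * k" using assms by (auto intro: block_index_less)
  thus ?thesis using assms by (simp add: block_mat_def)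
qed

lemma block_mat_Zloc_mat:
  assumes "k \<ge> 1" "\<And>i j. i < e \<Longrightarrow> j < e \<Longrightarrow> F i j \<in> Zloc_mat p k"
  shows "block_mat e k F \<in> Zloc_mat p (e * k)"
proof (rule Zloc_matI)
  fix i j assume ij: "i < e * k" "j < e * k"
  hence "F (i div k) (j div k) \<in> Zloc_mat p k" by (intro assms less_mult_imp_div_less)
  hence "F (i div k) (j div k) $$ (i mod k, j mod k) \<in> Zloc p" by (rule Zloc_matD) (use assms(1) in auto)
  thus "block_mat e k F $$ (i, j) \<in> Zloc p" using ij by (simp add: block_mat_def)
qed (simp add: block_mat_carrier)

lemma block_mat_eqI:
  assumes "k \<ge> 1" "\<And>i j a b. i < e \<Longrightarrow> j < e \<Longrightarrow> a < k \<Longrightarrow> b < k \<Longrightarrow> F i j $$ (a, b) = G i j $$ (a, b)"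
  shows "block_mat e k F = block_mat e k G"
  unfolding block_mat_def using assms by (intro eq_matI) (auto simp: less_mult_imp_div_less)

lemma block_mat_mult:
  assumes k: "k \<ge> 1" and H: "\<And>i j a b. i < e \<Longrightarrow> j < e \<Longrightarrow> a < k \<Longrightarrow> b < k \<Longrightarrow>
    H i j $$ (a, b) = (\<Sum>l<e. \<Sum>s<k. F i l $$ (a, s) * G l j $$ (s, b))"
  shows "block_mat e k F * block_mat e k G = block_mat e k H"
proof (rule eq_matI)
  fix i j assume "i < dim_row (block_mat e k H)" "j < dim_col (block_mat e k H)"
  hence ij: "i < e * k" "j < e * k" by (auto simp: block_mat_def)
  have "(block_mat e k F * block_mat e k G) $$ (i, j) =
      (\<Sum>t<e * k. F (i div k) (t div k) $$ (i mod k, t mod k) * G (t div k) (j div k) $$ (t mod k, j mod k))"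
    using ij by (auto simp: block_mat_def scalar_prod_def lessThan_atLeast0)
  also have "\<dots> = (\<Sum>l<e. \<Sum>s<k. F (i div k) l $$ (i mod k, s) * G l (j div k) $$ (s, j mod k))"
    by (rule sum_div_mod[OF k])
  also have "\<dots> = block_mat e k H $$ (i, j)"
    using ij k by (simp add: block_mat_def H less_mult_imp_div_less)
  finally show "(block_mat e k F * block_mat e k G) $$ (i, j) = block_mat e k H $$ (i, j)" .
qed (auto simp: block_mat_def)

lemma block_mat_one:
  assumes "k \<ge> 1"
  shows "block_mat e k (\<lambda>i j. if i = j then 1\<^sub>m k else 0\<^sub>m k k) = 1\<^sub>m (e * k)"
  unfolding block_mat_def
proof (rule eq_matI)
  fix i j assume "i < dim_row (1\<^sub>m (e * k) :: rat mat)" "j < dim_col (1\<^sub>m (e * k) :: rat mat)"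
  moreover have "i = j \<longleftrightarrow> i div k = j div k \<and> i mod k = j mod k"
    by (metis div_mult_mod_eq)
  ultimately show "mat (e * k) (e * k) (\<lambda>(i, j). (if i div k = j div k then 1\<^sub>m k else 0\<^sub>m k k) $$ (i mod k, j mod k)) $$ (i, j)
     = (1\<^sub>m (e * k) :: rat mat) $$ (i, j)" using assms by auto
qed auto

definition mat_over :: "'a set \<Rightarrow> nat \<Rightarrow> 'a mat \<Rightarrow> bool" where
  "mat_over R e M \<longleftrightarrow> M \<in> carrier_mat e e \<and> (\<forall>i<e. \<forall>j<e. M $$ (i, j) \<in> R)"

lemma mat_over_mult: assumes "is_subring R" "mat_over R e M" "mat_over R e N" shows "mat_over R e (M * N)"
  using assms unfolding mat_over_def
  by (auto simp: scalar_prod_def intro!: subring_sum is_subringD(5)[OF assms(1)])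

text \<open>The map on matrices over \<open>R\<close> that replaces each entry by the \<open>k\<close> by \<open>k\<close> block that represents it.\<close>

definition extend_rep :: "nat \<Rightarrow> nat \<Rightarrow> (complex \<Rightarrow> rat mat) \<Rightarrow> complex mat \<Rightarrow> rat mat" where
  "extend_rep e k \<phi> M = block_mat e k (\<lambda>i j. \<phi> (M $$ (i, j)))"

context
  fixes p k e :: nat and R :: "complex set" and \<phi> :: "complex \<Rightarrow> rat mat"
  assumes r: "local_rep p k R \<phi>" and R: "is_subring R" and k: "k \<ge> 1"
begin

lemma extend_rep_Zloc_mat: "mat_over R e M \<Longrightarrow> extend_rep e k \<phi> M \<in> Zloc_mat p (e * k)"
  unfolding extend_rep_def mat_over_def using local_repD(2)[OF r] by (intro block_mat_Zloc_mat k) auto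

lemma extend_rep_mult:
  assumes M: "mat_over R e M" and N: "mat_over R e N"
  shows "extend_rep e k \<phi> (M * N) = extend_rep e k \<phi> M * extend_rep e k \<phi> N"
  unfolding extend_rep_def
proof (rule block_mat_mult[OF k, symmetric])
  fix i j a b assume ij: "i < e" "j < e" and ab: "a < k" "b < k"
  have MN: "M $$ (i, l) \<in> R" "N $$ (l, j) \<in> R" if "l < e" for l
    using M N that ij by (auto simp: mat_over_def)
  have "(M * N) $$ (i, j) = (\<Sum>l<e. M $$ (i, l) * N $$ (l, j))"
    using M N ij by (auto simp: mat_over_def scalar_prod_def lessThan_atLeast0)
  moreover have "\<phi> (\<Sum>l<e. M $$ (i, l) * N $$ (l, j)) $$ (a, b) = (\<Sum>l<e. \<phi> (M $$ (i, l) * N $$ (l, j)) $$ (a, b))"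
    using MN by (intro local_rep_sum_index[OF r R _ _ ab] is_subringD(5)[OF R]) auto
  ultimately have "\<phi> ((M * N) $$ (i, j)) $$ (a, b) = (\<Sum>l<e. \<phi> (M $$ (i, l) * N $$ (l, j)) $$ (a, b))"
    by simp
  also have "\<dots> = (\<Sum>l<e. \<Sum>s<k. \<phi> (M $$ (i, l)) $$ (a, s) * \<phi> (N $$ (l, j)) $$ (s, b))"
  proof (rule sum.cong[OF refl])
    fix l assume "l \<in> {..<e}"
    hence l: "M $$ (i, l) \<in> R" "N $$ (l, j) \<in> R" using MN by auto
    show "\<phi> (M $$ (i, l) * N $$ (l, j)) $$ (a, b) = (\<Sum>s<k. \<phi> (M $$ (i, l)) $$ (a, s) * \<phi> (N $$ (l, j)) $$ (s, b))"
      using local_repD(5)[OF r l] local_repD(1)[OF r l(1)] local_repD(1)[OF r l(2)] ab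
      by (auto simp: scalar_prod_def lessThan_atLeast0)
  qed
  finally show "\<phi> ((M * N) $$ (i, j)) $$ (a, b) = (\<Sum>l<e. \<Sum>s<k. \<phi> (M $$ (i, l)) $$ (a, s) * \<phi> (N $$ (l, j)) $$ (s, b))" .
qed

lemma extend_rep_add:
  assumes M: "mat_over R e M" and N: "mat_over R e N"
  shows "extend_rep e k \<phi> (M + N) = extend_rep e k \<phi> M + extend_rep e k \<phi> N"
proof (rule eq_matI)
  fix i j assume "i < dim_row (extend_rep e k \<phi> M + extend_rep e k \<phi> N)" "j < dim_col (extend_rep e k \<phi> M + extend_rep e k \<phi> N)"
  hence ij: "i < e * k" "j < e * k" by (auto simp: extend_rep_def block_mat_def)
  hence d: "i div k < e" "j div k < e" by (auto intro: less_mult_imp_div_less)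
  hence MN: "M $$ (i div k, j div k) \<in> R" "N $$ (i div k, j div k) \<in> R" using M N by (auto simp: mat_over_def)
  show "extend_rep e k \<phi> (M + N) $$ (i, j) = (extend_rep e k \<phi> M + extend_rep e k \<phi> N) $$ (i, j)"
  proof -
    have "(M + N) $$ (i div k, j div k) = M $$ (i div k, j div k) + N $$ (i div k, j div k)"
      using d N by (auto simp: mat_over_def)
    thus ?thesis
      using ij d k local_repD(4)[OF r MN] local_repD(1)[OF r MN(1)] local_repD(1)[OF r MN(2)]
      by (simp add: extend_rep_def block_mat_def)
  qed
qed (auto simp: extend_rep_def block_mat_def)

lemma extend_rep_scalar:
  "extend_rep e k \<phi> (c \<cdot>\<^sub>m 1\<^sub>m e) = block_mat e k (\<lambda>i j. if i = j then \<phi> c else 0\<^sub>m k k)"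
  unfolding extend_rep_def using local_rep_zero[OF r R] by (intro block_mat_eqI k) auto

lemma extend_rep_one: "extend_rep e k \<phi> (1\<^sub>m e) = 1\<^sub>m (e * k)"
proof -
  have "(1::complex) \<cdot>\<^sub>m 1\<^sub>m e = 1\<^sub>m e" by (rule eq_matI) auto
  thus ?thesis using extend_rep_scalar[of 1] block_mat_one[OF k, of e] unfolding local_repD(3)[OF r] by simp
qed

text \<open>Multiplication by the adjugate gives the scalar matrix \<open>det M\<close>, which becomes block diagonal.\<close>

lemma unit_extend_rep:
  assumes p: "prime p" and M: "mat_over R e M" and u: "Zloc_unit_mat p k (\<phi> (det M))"
  shows "Zloc_unit_mat p (e * k) (extend_rep e k \<phi> M)"
proof -
  have M': "M \<in> carrier_mat e e" using M by (simp add: mat_over_def)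
  note adj = adj_mat[OF M']
  have A: "mat_over R e (adj_mat M)"
    unfolding mat_over_def using adj(1) subring_adj_mat[OF R M'] M by (auto simp: mat_over_def)
  let ?D = "\<lambda>X. block_mat e k (\<lambda>i j. if i = j then X else 0\<^sub>m k k)"
  have e1: "extend_rep e k \<phi> M * extend_rep e k \<phi> (adj_mat M) = ?D (\<phi> (det M))"
    using extend_rep_mult[OF M A] adj extend_rep_scalar by simp
  have e2: "extend_rep e k \<phi> (adj_mat M) * extend_rep e k \<phi> M = ?D (\<phi> (det M))"
    using extend_rep_mult[OF A M] adj extend_rep_scalar by simp
  from u obtain L where L: "L \<in> Zloc_mat p k" "\<phi> (det M) * L = 1\<^sub>m k" "L * \<phi> (det M) = 1\<^sub>m k"
    unfolding Zloc_unit_mat_def by (elim bexE conjE)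
  have L': "L \<in> carrier_mat k k" using L(1) by (rule Zloc_mat_carrier)
  have dR: "det M \<in> R" using subring_det[OF R M'] M by (auto simp: mat_over_def)
  have DD: "?D X * ?D Y = 1\<^sub>m (e * k)" if "X * Y = 1\<^sub>m k" "X \<in> carrier_mat k k" "Y \<in> carrier_mat k k" for X Y
    unfolding block_mat_one[OF k, symmetric]
  proof (rule block_mat_mult[OF k])
    fix i j a b assume ij: "i < e" "j < e" and ab: "a < k" "b < k"
    have "(\<Sum>l<e. \<Sum>s<k. (if i = l then X else 0\<^sub>m k k) $$ (a, s) * (if l = j then Y else 0\<^sub>m k k) $$ (s, b))
      = (\<Sum>l<e. if i = l then (\<Sum>s<k. X $$ (a, s) * (if l = j then Y else 0\<^sub>m k k) $$ (s, b)) else 0)"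
      using ab by (intro sum.cong) auto
    also have "\<dots> = (\<Sum>s<k. X $$ (a, s) * (if i = j then Y else 0\<^sub>m k k) $$ (s, b))"
      using ij by simp
    also have "\<dots> = (if i = j then (X * Y) $$ (a, b) else 0)"
      using ab that(2,3) by (auto simp: scalar_prod_def lessThan_atLeast0)
    finally show "(if i = j then 1\<^sub>m k else 0\<^sub>m k k) $$ (a, b) =
      (\<Sum>l<e. \<Sum>s<k. (if i = l then X else 0\<^sub>m k k) $$ (a, s) * (if l = j then Y else 0\<^sub>m k k) $$ (s, b))"
      using ab that(1) by simp
  qed
  have "?D L \<in> Zloc_mat p (e * k)"
    using L(1) by (intro block_mat_Zloc_mat k) (auto simp: Zloc_mat_def Zloc_simps p)
  hence "Zloc_unit_mat p (e * k) (?D (\<phi> (det M)))"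
    unfolding Zloc_unit_mat_def
    using DD[OF L(2) local_repD(1)[OF r dR] L'] DD[OF L(3) L' local_repD(1)[OF r dR]] by (intro bexI[of _ "?D L"] conjI)
  thus ?thesis
    using Zloc_unit_mat_factor[OF p extend_rep_Zloc_mat[OF M] extend_rep_Zloc_mat[OF A]] e1 e2 by simp
qed

end

section \<open>Adjoining an integral element\<close>

lemma subring_poly: assumes "is_subring R" "\<And>i. coeff g i \<in> R" "z \<in> R" shows "poly g z \<in> R"
  unfolding poly_altdef by (intro subring_sum is_subringD(5)[OF assms(1)] is_subringD(7)[OF assms(1)] assms)

text \<open>The lowest nonzero coefficient of a polynomial that vanishes at \<open>z \<noteq> 0\<close> is a multiple of \<open>z\<close>.\<close>

lemma algebraic_has_multiple:
  fixes z :: "'a::idom"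
  assumes "is_subring S" "R \<subseteq> S" "z \<in> S" "z \<noteq> 0" "g \<noteq> 0" "\<And>i. coeff g i \<in> R" "poly g z = 0"
  shows "\<exists>w\<in>S. z * w \<in> R \<and> w \<noteq> 0"
  using assms(5-)
proof (induction g)
  case (pCons c g)
  have cg: "coeff g i \<in> R" for i using pCons.prems(2)[of "Suc i"] by simp
  have cR: "c \<in> R" using pCons.prems(2)[of 0] by simp
  show ?case
  proof (cases "c = 0")
    case True
    hence "poly g z = 0" "g \<noteq> 0" using pCons assms(4) by auto
    thus ?thesis using pCons.IH cg by blast
  next
    case False
    have e: "z * (- poly g z) = c" using pCons.prems(3) by (simp add: add_eq_0_iff)
    moreover have "- poly g z \<in> S" using assms cg by (intro is_subringD(3)[OF assms(1)] subring_poly) auto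
    ultimately show ?thesis using False cR by (intro bexI[of _ "- poly g z"]) auto
  qed
qed simp

text \<open>The ring generated by \<open>A\<close> and \<open>a\<close> is free over the ring \<open>R\<close> generated by \<open>A\<close>, with basis
  \<open>1, a, \<dots>, a ^ (e - 1)\<close>.  It therefore embeds into the \<open>e\<close> by \<open>e\<close> matrices over \<open>R\<close>, and a
  representation of \<open>R\<close> extends blockwise.  An element is made invertible as soon as its norm, the
  determinant of its matrix, is; the entries of the matrix, and so the norm, have cost at most
  quadratic in that of the element.\<close>

lemma small_prime_separable_integral:
  fixes a :: complex
  assumes A: "small_prime_separable A" and e: "e \<ge> 1" and q: "\<And>i. i < e \<Longrightarrow> q i \<in> generated_subring A"
    and aq: "a ^ e = (\<Sum>i<e. q i * a ^ i)"
    and indep: "\<And>c. (\<And>i. i < e \<Longrightarrow> c i \<in> generated_subring A) \<Longrightarrow> (\<Sum>i<e. c i * a ^ i) = 0 \<Longrightarrow> (\<forall>i<e. c i = 0)"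
  shows "small_prime_separable (insert a A)"
proof -
  define R where "R = generated_subring A"
  define S where "S = generated_subring (insert a A)"
  have R: "is_subring R" and S: "is_subring S" unfolding R_def S_def by (rule is_subring_generated)+
  have RS: "R \<subseteq> S" unfolding R_def
    by (rule generated_subring_least[OF S]) (auto simp: S_def intro: generated_subring_gen)
  \<comment> \<open>\<open>M\<close> is the matrix of multiplication by \<open>z\<close> in the basis \<open>1, a, \<dots>, a ^ (e - 1)\<close>\<close>
  define acts where "acts M z \<longleftrightarrow> mat_over R e M \<and> (\<forall>i<e. (\<Sum>j<e. M $$ (i, j) * a ^ j) = z * a ^ i)" for M z
  have unique: "M = N" if "acts M z" "acts N z" for M N z
  proof (rule eq_matI)
    fix i j assume "i < dim_row N" "j < dim_col N"
    hence ij: "i < e" "j < e" using that by (auto simp: acts_def mat_over_def)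
    have "(\<Sum>j<e. (M $$ (i, j) - N $$ (i, j)) * a ^ j) = 0"
      using that ij by (simp add: acts_def left_diff_distrib sum_subtractf)
    hence "\<forall>j<e. M $$ (i, j) - N $$ (i, j) = 0"
      using that ij by (intro indep) (auto simp: acts_def mat_over_def R_def[symmetric] intro: is_subringD(6)[OF R])
    thus "M $$ (i, j) = N $$ (i, j)" using ij by simp
  qed (use that in \<open>auto simp: acts_def mat_over_def\<close>)
  have scalar: "acts (c \<cdot>\<^sub>m 1\<^sub>m e) c" if "c \<in> R" for c
    unfolding acts_def mat_over_def
  proof (intro conjI allI impI)
    fix i assume i: "i < e"
    have "(\<Sum>j<e. (c \<cdot>\<^sub>m 1\<^sub>m e) $$ (i, j) * a ^ j) = (\<Sum>j<e. if j = i then c * a ^ j else 0)"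
      using i by (intro sum.cong) auto
    thus "(\<Sum>j<e. (c \<cdot>\<^sub>m 1\<^sub>m e) $$ (i, j) * a ^ j) = c * a ^ i" using i by simp
  qed (use that R in \<open>auto simp: is_subringD\<close>)
  have acts_mult: "acts (M * N) (z * w)" if M: "acts M z" and N: "acts N w" for M N z w
    unfolding acts_def
  proof (intro conjI allI impI)
    show "mat_over R e (M * N)" using M N by (auto simp: acts_def intro: mat_over_mult R)
    fix i assume i: "i < e"
    have "(\<Sum>j<e. (M * N) $$ (i, j) * a ^ j) = (\<Sum>j<e. \<Sum>l<e. M $$ (i, l) * N $$ (l, j) * a ^ j)"
      using M N i by (intro sum.cong) (auto simp: acts_def mat_over_def scalar_prod_def lessThan_atLeast0 sum_distrib_right)
    also have "\<dots> = (\<Sum>l<e. M $$ (i, l) * (\<Sum>j<e. N $$ (l, j) * a ^ j))"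
      by (subst sum.swap) (simp add: sum_distrib_left mult.assoc)
    also have "\<dots> = (\<Sum>l<e. M $$ (i, l) * a ^ l) * w"
      using N by (simp add: acts_def sum_distrib_left sum_distrib_right ac_simps)
    also have "\<dots> = z * w * a ^ i" using M i by (simp add: acts_def)
    finally show "(\<Sum>j<e. (M * N) $$ (i, j) * a ^ j) = z * w * a ^ i" .
  qed
  have acts_add: "acts (M + N) (z + w)" if M: "acts M z" and N: "acts N w" for M N z w
    using M N R unfolding acts_def mat_over_def
    by (auto simp: is_subringD distrib_right sum.distrib)
  have "\<exists>K. \<forall>i<e. cost_le A K (q i)"
  proof -
    have "\<exists>K. cost_le A K (q i)" if "i < e" for i using q[OF that] by (simp add: generated_subring_def)
    then obtain K where K: "\<And>i. i < e \<Longrightarrow> cost_le A (K i) (q i)" by metis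
    have "cost_le A (\<Sum>i<e. K i) (q i)" if "i < e" for i
      using K[OF that] by (rule cost_le_mono) (use that in \<open>auto intro: member_le_sum\<close>)
    thus ?thesis by blast
  qed
  then obtain K where K: "\<And>i. i < e \<Longrightarrow> cost_le A K (q i)" by blast
  define C where "C = K + e + 1"
  have C1: "C \<ge> 1" "K \<le> C" "e \<le> C" by (auto simp: C_def)
  have main: "\<exists>M. acts M z \<and> (\<forall>i<e. \<forall>j<e. cost_le A (C * m ^ 2) (M $$ (i, j)))" if "cost_le (insert a A) m z" for m z
    using that
  proof (induction)
    case zero
    show ?case using scalar[of 0] C1 R
      by (intro exI[of _ "0 \<cdot>\<^sub>m 1\<^sub>m e"]) (auto simp: is_subringD intro: cost_le_mono[OF cost_le.zero])
  next
    case one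
    show ?case using scalar[of 1] C1 R
      by (intro exI[of _ "1 \<cdot>\<^sub>m 1\<^sub>m e"]) (auto simp: is_subringD intro: cost_le_mono[OF cost_le.zero] cost_le_mono[OF cost_le.one])
  next
    case minus_one
    show ?case using scalar[of "-1"] C1 R
      by (intro exI[of _ "-1 \<cdot>\<^sub>m 1\<^sub>m e"]) (auto simp: is_subringD intro: cost_le_mono[OF cost_le.zero] cost_le_mono[OF cost_le.minus_one])
  next
    case (gen b)
    show ?case
    proof (cases "b = a")
      case False
      hence b: "b \<in> A" using gen by simp
      thus ?thesis using scalar[of b] C1 generated_subring_gen[OF b]
        by (intro exI[of _ "b \<cdot>\<^sub>m 1\<^sub>m e"]) (auto simp: R_def intro: cost_le_mono[OF cost_le.zero] cost_le_mono[OF cost_le.gen[OF b]])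
    next
      case True
      \<comment> \<open>the companion matrix of the equation for \<open>a ^ e\<close>\<close>
      define M where "M = mat e e (\<lambda>(i, j). if i = e - 1 then q j else if j = Suc i then 1 else 0)"
      have "acts M a"
        unfolding acts_def mat_over_def
      proof (intro conjI allI impI)
        fix i assume i: "i < e"
        show "(\<Sum>j<e. M $$ (i, j) * a ^ j) = a * a ^ i"
        proof (cases "i = e - 1")
          case True
          thus ?thesis using i aq by (simp add: M_def flip: power_Suc)
        next
          case False
          hence "(\<Sum>j<e. M $$ (i, j) * a ^ j) = (\<Sum>j<e. if j = Suc i then a ^ j else 0)"
            using i by (intro sum.cong) (auto simp: M_def)
          thus ?thesis using i False by simp
        qed
      qed (use q R in \<open>auto simp: M_def R_def[symmetric] is_subringD\<close>)
      moreover have "cost_le A (C * 1\<^sup>2) (M $$ (i, j))" if "i < e" "j < e" for i j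
        using that C1 cost_le_mono[OF K[OF that(2)], of C] cost_le_mono[OF cost_le.zero, of C A] cost_le_mono[OF cost_le.one, of C A]
        by (auto simp: M_def)
      ultimately show ?thesis unfolding True by blast
    qed
  next
    case (mult i x j y)
    then obtain M N where M: "acts M x" "\<And>a b. a < e \<Longrightarrow> b < e \<Longrightarrow> cost_le A (C * i ^ 2) (M $$ (a, b))"
      and N: "acts N y" "\<And>a b. a < e \<Longrightarrow> b < e \<Longrightarrow> cost_le A (C * j ^ 2) (N $$ (a, b))" by blast
    have "cost_le A (C * (i + j) ^ 2) ((M * N) $$ (r, s))" if "r < e" "s < e" for r s
    proof -
      have ij: "i \<ge> 1" "j \<ge> 1" using mult.hyps cost_le_pos by blast+
      have "(M * N) $$ (r, s) = (\<Sum>l<e. M $$ (r, l) * N $$ (l, s))"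
        using M N that by (auto simp: acts_def mat_over_def scalar_prod_def lessThan_atLeast0)
      moreover have "cost_le A ((C * i ^ 2 + C * j ^ 2) + card {..<e}) (\<Sum>l<e. M $$ (r, l) * N $$ (l, s))"
      proof (rule cost_le_sum)
        show "1 \<le> C * i ^ 2 + C * j ^ 2" using C1(1) ij by (simp add: Suc_le_eq)
      qed (use M N that in \<open>auto intro!: cost_le.mult\<close>)
      moreover have "(C * i ^ 2 + C * j ^ 2) + card {..<e} \<le> C * (i + j) ^ 2"
      proof -
        have "e * 1 \<le> C * (2 * (i * j))" using C1 ij by (intro mult_mono) auto
        thus ?thesis by (simp add: power2_eq_square algebra_simps)
      qed
      ultimately show ?thesis using cost_le_mono by metis
    qed
    thus ?case using acts_mult[OF M(1) N(1)] by blast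
  next
    case (add i x y)
    then obtain M N where M: "acts M x" "\<And>a b. a < e \<Longrightarrow> b < e \<Longrightarrow> cost_le A (C * i ^ 2) (M $$ (a, b))"
      and N: "acts N y" "\<And>a b. a < e \<Longrightarrow> b < e \<Longrightarrow> cost_le A (C * i ^ 2) (N $$ (a, b))" by blast
    have "cost_le A (C * (Suc i) ^ 2) ((M + N) $$ (r, s))" if "r < e" "s < e" for r s
    proof -
      have "(M + N) $$ (r, s) = M $$ (r, s) + N $$ (r, s)" using M N that by (auto simp: acts_def mat_over_def)
      moreover have "C * i ^ 2 < C * (Suc i) ^ 2" using C1 by (simp add: power2_eq_square algebra_simps)
      ultimately show ?thesis using M(2)[OF that] N(2)[OF that] by (simp add: cost_le_add)
    qed
    thus ?case using acts_add[OF M(1) N(1)] by blast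
  next
    case (Suc i x)
    then obtain M where M: "acts M x" "\<And>a b. a < e \<Longrightarrow> b < e \<Longrightarrow> cost_le A (C * i ^ 2) (M $$ (a, b))" by blast
    have "C * i ^ 2 \<le> C * (Suc i) ^ 2" by (simp add: power2_eq_square algebra_simps)
    thus ?case using M by (meson cost_le_mono)
  qed
  have ex: "\<exists>M. acts M z" if "z \<in> S" for z using that main unfolding S_def generated_subring_def by blast
  \<comment> \<open>\<open>z\<close> is an eigenvalue of \<open>M\<close>, so it divides a nonzero element of \<open>R\<close>, and its norm divides
    the norm of that element, which is a power of it\<close>
  have det0: "det M \<noteq> 0" if M: "acts M z" and z: "z \<in> S" "z \<noteq> 0" for M z
  proof -
    have M': "M \<in> carrier_mat e e" and MR: "\<And>i j. i < e \<Longrightarrow> j < e \<Longrightarrow> M $$ (i, j) \<in> R"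
      using M by (auto simp: acts_def mat_over_def)
    define v where "v = vec e (\<lambda>i. a ^ i)"
    have "v \<noteq> 0\<^sub>v e"
    proof
      assume "v = 0\<^sub>v e"
      hence "v $ 0 = 0\<^sub>v e $ 0" by simp
      thus False using e by (simp add: v_def)
    qed
    moreover have "M *\<^sub>v v = z \<cdot>\<^sub>v v"
      using M M' by (intro eq_vecI) (auto simp: v_def acts_def scalar_prod_def lessThan_atLeast0)
    ultimately have "eigenvector M v z" using M' by (auto simp: eigenvector_def v_def)
    hence "poly (char_poly M) z = 0"
      using eigenvalue_root_char_poly[OF M'] by (auto simp: eigenvalue_def)
    moreover have "char_poly M \<noteq> 0" using degree_monic_char_poly[OF M'] by auto
    ultimately obtain w where w: "w \<in> S" "z * w \<in> R" "w \<noteq> 0"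
      using algebraic_has_multiple[OF S RS z, of "char_poly M"] subring_char_poly[OF R M' MR] by blast
    obtain N where N: "acts N w" using ex[OF w(1)] by blast
    have N': "N \<in> carrier_mat e e" using N by (auto simp: acts_def mat_over_def)
    have "M * N = (z * w) \<cdot>\<^sub>m 1\<^sub>m e" using unique[OF acts_mult[OF M N] scalar[OF w(2)]] .
    hence "det M * det N = (z * w) ^ e" using det_mult[OF M' N'] by (simp add: det_smult)
    thus "det M \<noteq> 0" using z w e by auto
  qed
  show ?thesis
  proof (rule small_prime_separable_pullback[OF A])
    fix k :: nat assume k: "k \<ge> 1"
    define c where "c = C * e + 2 + fact e"
    have "\<exists>y. cost_le A (c * m ^ 2) y \<and> y \<noteq> 0 \<and>
        (\<forall>p \<phi>. prime p \<and> c * m ^ 2 < p \<and> local_rep p k (generated_subring A) \<phi> \<and> Zloc_unit_mat p k (\<phi> y) \<longrightarrow>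
          (\<exists>\<psi>. local_rep p (e * k) (generated_subring (insert a A)) \<psi> \<and> Zloc_unit_mat p (e * k) (\<psi> z)))"
      if z: "cost_le (insert a A) m z" "z \<noteq> 0" for m z
    proof -
      have zS: "z \<in> S" unfolding S_def using z cost_le_in_generated_subring by blast
      obtain M where M: "acts M z" "\<And>i j. i < e \<Longrightarrow> j < e \<Longrightarrow> cost_le A (C * m ^ 2) (M $$ (i, j))"
        using main[OF z(1)] by blast
      have M': "M \<in> carrier_mat e e" "mat_over R e M" using M by (auto simp: acts_def mat_over_def)
      have "cost_le A (c * m ^ 2) (det M)"
      proof (rule cost_le_mono[OF cost_le_det[OF M'(1) M(2)]])
        have "(2 + fact e) * 1 \<le> (2 + fact e) * m ^ 2" using cost_le_pos[OF z(1)] by (intro mult_left_mono) auto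
        thus "C * m\<^sup>2 * e + 2 + fact e \<le> c * m ^ 2" unfolding c_def by (simp add: algebra_simps)
      qed
      moreover have "det M \<noteq> 0" using det0[OF M(1) zS z(2)] .
      moreover have "\<exists>\<psi>. local_rep p (e * k) S \<psi> \<and> Zloc_unit_mat p (e * k) (\<psi> z)"
        if p: "prime p" and r: "local_rep p k R \<phi>" and u: "Zloc_unit_mat p k (\<phi> (det M))" for p \<phi>
      proof -
        define mt where "mt z = (THE M. acts M z)" for z
        have mt: "mt z = M" if "acts M z" for M z unfolding mt_def using that unique by blast
        have mt': "acts (mt z) z" if "z \<in> S" for z using ex[OF that] mt by auto
        have mtR: "mat_over R e (mt z)" if "z \<in> S" for z using mt'[OF that] by (simp add: acts_def)
        define \<psi> where "\<psi> z = extend_rep e k \<phi> (mt z)" for z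
        have "local_rep p (e * k) S \<psi>"
        proof (rule local_repI)
          fix x assume x: "x \<in> S"
          show "\<psi> x \<in> Zloc_mat p (e * k)" unfolding \<psi>_def
            using extend_rep_Zloc_mat[OF r R k mtR[OF x]] .
          fix y assume y: "y \<in> S"
          have "mt (x + y) = mt x + mt y" "mt (x * y) = mt x * mt y"
            using mt[OF acts_add[OF mt'[OF x] mt'[OF y]]] mt[OF acts_mult[OF mt'[OF x] mt'[OF y]]] by auto
          thus "\<psi> (x + y) = \<psi> x + \<psi> y" "\<psi> (x * y) = \<psi> x * \<psi> y"
            unfolding \<psi>_def
            using extend_rep_add[OF r R k mtR[OF x] mtR[OF y]] extend_rep_mult[OF r R k mtR[OF x] mtR[OF y]] by auto
        next
          have "(1::complex) \<cdot>\<^sub>m 1\<^sub>m e = 1\<^sub>m e" by (rule eq_matI) auto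
          hence "mt 1 = 1\<^sub>m e" using mt[OF scalar[of 1]] R by (simp add: is_subringD)
          thus "\<psi> 1 = 1\<^sub>m (e * k)" unfolding \<psi>_def using extend_rep_one[OF r R k] by simp
        qed
        moreover have "Zloc_unit_mat p (e * k) (\<psi> z)"
          unfolding \<psi>_def mt[OF M(1)] by (rule unit_extend_rep[OF r R k p M'(2) u])
        ultimately show ?thesis by blast
      qed
      ultimately show ?thesis unfolding R_def S_def by blast
    qed
    moreover have "e * k \<ge> 1" "c \<ge> 1" using e k by (auto simp: c_def)
    ultimately show "\<exists>l\<ge>1. \<exists>c\<ge>1. \<forall>m z. cost_le (insert a A) m z \<and> z \<noteq> 0 \<longrightarrow>
      (\<exists>y. cost_le A (c * m ^ 2) y \<and> y \<noteq> 0 \<and>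
        (\<forall>p \<phi>. prime p \<and> c * m ^ 2 < p \<and> local_rep p k (generated_subring A) \<phi> \<and> Zloc_unit_mat p k (\<phi> y) \<longrightarrow>
          (\<exists>\<psi>. local_rep p l (generated_subring (insert a A)) \<psi> \<and> Zloc_unit_mat p l (\<psi> z))))" by blast
  qed
qed

section \<open>Passing to subrings and inverting an element\<close>

text \<open>Replacing each element of \<open>B\<close> by an expression in \<open>A\<close> multiplies costs by a constant, and
  representations restrict to the subring.\<close>

lemma small_prime_separable_subset:
  assumes A: "small_prime_separable A" and B: "finite B" "B \<subseteq> generated_subring A"
  shows "small_prime_separable B"
proof -
  have "\<exists>K. cost_le A K b" if "b \<in> B" for b using B that unfolding generated_subring_def by blast
  then obtain K where K: "\<And>b. b \<in> B \<Longrightarrow> cost_le A (K b) b" by metis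
  define C where "C = Suc (\<Sum>b\<in>B. K b)"
  have C: "cost_le A C b" if "b \<in> B" for b
    using K[OF that] by (rule cost_le_mono) (use that B member_le_sum[of b B K] in \<open>auto simp: C_def\<close>)
  have C1: "C \<ge> 1" by (simp add: C_def)
  have main: "cost_le A (C * m) z" if "cost_le B m z" for m z
    using that
  proof induction
    case (mult i x j y)
    thus ?case by (auto intro!: cost_le_mult[of A "C * i" x "C * j" y] simp: algebra_simps)
  next
    case (add i x y)
    thus ?case using C1 by (intro cost_le_add[of A "C * i" x "C * i" y]) auto
  next
    case (Suc i x)
    show ?case by (rule cost_le_mono[OF Suc.IH]) simp
  next
    case zero show ?case using C1 by (intro cost_le_mono[OF cost_le.zero]) simp
  next
    case one show ?case using C1 by (intro cost_le_mono[OF cost_le.one]) simp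
  next
    case minus_one show ?case using C1 by (intro cost_le_mono[OF cost_le.minus_one]) simp
  next
    case (gen b) thus ?case using C[of b] by simp
  qed
  have sub: "generated_subring B \<subseteq> generated_subring A" by (rule generated_subring_least[OF is_subring_generated B(2)])
  show ?thesis
  proof (rule small_prime_separable_pullback[OF A])
    fix k :: nat assume k: "k \<ge> 1"
    have "\<exists>y. cost_le A (C * m ^ 2) y \<and> y \<noteq> 0 \<and>
        (\<forall>p \<phi>. prime p \<and> C * m ^ 2 < p \<and> local_rep p k (generated_subring A) \<phi> \<and> Zloc_unit_mat p k (\<phi> y) \<longrightarrow>
          (\<exists>\<psi>. local_rep p k (generated_subring B) \<psi> \<and> Zloc_unit_mat p k (\<psi> z)))" if z: "cost_le B m z" "z \<noteq> 0" for m z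
    proof (intro exI[of _ z] conjI allI impI)
      have "m * 1 \<le> m * m" using cost_le_pos[OF z(1)] by (intro mult_left_mono) auto
      hence "C * m \<le> C * m ^ 2" by (simp add: power2_eq_square)
      thus "cost_le A (C * m ^ 2) z" using main[OF z(1)] by (rule cost_le_mono[rotated])
      fix p \<phi> assume a: "prime p \<and> C * m ^ 2 < p \<and> local_rep p k (generated_subring A) \<phi> \<and> Zloc_unit_mat p k (\<phi> z)"
      have "local_rep p k (generated_subring B) \<phi>" using a sub unfolding local_rep_def by blast
      thus "\<exists>\<psi>. local_rep p k (generated_subring B) \<psi> \<and> Zloc_unit_mat p k (\<psi> z)" using a by blast
    qed (rule z(2))
    thus "\<exists>l\<ge>1. \<exists>c\<ge>1. \<forall>m z. cost_le B m z \<and> z \<noteq> 0 \<longrightarrow>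
      (\<exists>y. cost_le A (c * m ^ 2) y \<and> y \<noteq> 0 \<and>
        (\<forall>p \<phi>. prime p \<and> c * m ^ 2 < p \<and> local_rep p k (generated_subring A) \<phi> \<and> Zloc_unit_mat p k (\<phi> y) \<longrightarrow>
          (\<exists>\<psi>. local_rep p l (generated_subring B) \<psi> \<and> Zloc_unit_mat p l (\<psi> z))))" using k C1 by blast
  qed
qed

text \<open>Each unit of cost brings in at most one factor \<open>1 / d\<close>.\<close>

lemma clear_denominator:
  assumes d: "cost_le A K d" "d \<noteq> 0" and z: "cost_le (insert (1 / d) A) m z"
  shows "cost_le A ((K + 1) * m) (d ^ m * z)"
  using z
proof induction
  case zero show ?case by (simp, rule cost_le_mono[OF cost_le.zero]) simp
next
  case one show ?case using cost_le_mono[OF d(1), of "K + 1"] by simp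
next
  case minus_one show ?case using cost_le_uminus[OF d(1)] by simp
next
  case (gen b)
  show ?case
  proof (cases "b = 1 / d")
    case True thus ?thesis using d by (simp, intro cost_le_mono[OF cost_le.one]) simp
  next
    case False
    hence "b \<in> A" using gen by simp
    thus ?thesis using cost_le.mult[OF d(1) cost_le.gen[of b A]] by simp
  qed
next
  case (mult i x j y)
  have "cost_le A ((K + 1) * i + (K + 1) * j) ((d ^ i * x) * (d ^ j * y))"
    using mult.IH by (rule cost_le.mult)
  thus ?case by (simp add: power_add algebra_simps)
next
  case (add i x y)
  have "cost_le A (K + Suc ((K + 1) * i)) (d * (d ^ i * x + d ^ i * y))"
    using add.IH by (intro cost_le.mult[OF d(1)] cost_le.add)
  thus ?case by (simp add: algebra_simps)
next
  case (Suc i x)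
  have "cost_le A (K + (K + 1) * i) (d * (d ^ i * x))"
    using Suc.IH by (intro cost_le.mult[OF d(1)])
  hence "cost_le A (Suc (K + (K + 1) * i)) (d * (d ^ i * x))" by (rule cost_le.Suc)
  thus ?case by (simp add: algebra_simps)
qed

lemma Zloc_unit_mat_cancel:
  assumes u: "Zloc_unit_mat p k M" and c: "M \<in> carrier_mat k k" "Y \<in> carrier_mat k k" "Y' \<in> carrier_mat k k"
    and e: "M * Y = M * Y'"
  shows "Y = Y'"
proof -
  from u obtain L where L: "L \<in> Zloc_mat p k" "L * M = 1\<^sub>m k" unfolding Zloc_unit_mat_def by (elim bexE conjE)
  have L': "L \<in> carrier_mat k k" using L(1) by (rule Zloc_mat_carrier)
  have "Y = (L * M) * Y" unfolding L(2) by (rule left_mult_one_mat[OF c(2), symmetric])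
  also have "\<dots> = L * (M * Y')" unfolding e[symmetric] by (rule assoc_mult_mat[OF L' c(1,2)])
  also have "\<dots> = (L * M) * Y'" by (rule assoc_mult_mat[OF L' c(1,3), symmetric])
  also have "\<dots> = Y'" unfolding L(2) by (rule left_mult_one_mat[OF c(3)])
  finally show ?thesis .
qed

lemma Zloc_unit_matI_left:
  assumes "M \<in> carrier_mat k k" "N \<in> Zloc_mat p k" "N * M = 1\<^sub>m k"
  shows "Zloc_unit_mat p k M"
proof -
  have "M * N = 1\<^sub>m k" by (rule mat_mult_left_right_inverse[OF Zloc_mat_carrier[OF assms(2)] assms(1,3)])
  thus ?thesis unfolding Zloc_unit_mat_def using assms by (intro bexI[of _ N] conjI)
qed

lemma Zloc_unit_mat_mult:
  assumes p: "prime p" and u: "Zloc_unit_mat p k M" "Zloc_unit_mat p k N" and c: "M \<in> carrier_mat k k" "N \<in> carrier_mat k k"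
  shows "Zloc_unit_mat p k (M * N)"
proof -
  from u(1) obtain L where L: "L \<in> Zloc_mat p k" "L * M = 1\<^sub>m k" unfolding Zloc_unit_mat_def by (elim bexE conjE)
  from u(2) obtain L' where L': "L' \<in> Zloc_mat p k" "L' * N = 1\<^sub>m k" unfolding Zloc_unit_mat_def by (elim bexE conjE)
  have cL: "L \<in> carrier_mat k k" "L' \<in> carrier_mat k k" using L(1) L'(1) by (auto intro: Zloc_mat_carrier)
  have "(L' * L) * (M * N) = L' * (L * (M * N))" using cL c by (intro assoc_mult_mat) auto
  also have "L * (M * N) = (L * M) * N" by (rule assoc_mult_mat[OF cL(1) c, symmetric])
  also have "\<dots> = N" unfolding L(2) by (rule left_mult_one_mat[OF c(2)])
  finally have "(L' * L) * (M * N) = 1\<^sub>m k" unfolding L'(2) .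
  thus ?thesis using c by (intro Zloc_unit_matI_left[OF _ Zloc_mat_mult[OF p L'(1) L(1)]]) auto
qed

lemma Zloc_unit_mat_one: "prime p \<Longrightarrow> Zloc_unit_mat p k (1\<^sub>m k)"
  unfolding Zloc_unit_mat_def by (intro bexI[of _ "1\<^sub>m k"]) (auto simp: Zloc_mat_one)

text \<open>Ask for \<open>d * (d ^ m * z)\<close>, which lies in the ring \<open>R\<close> generated by \<open>A\<close>, to become invertible.
  Then \<open>d\<close> becomes invertible too, so the representation extends: an element \<open>x\<close> with
  \<open>d ^ n * x \<in> R\<close> is sent to the only matrix \<open>Y\<close> with \<open>\<phi> (d ^ n) * Y = \<phi> (d ^ n * x)\<close>.\<close>

lemma small_prime_separable_localize:
  assumes A: "small_prime_separable A" and d: "d \<in> generated_subring A" "d \<noteq> 0"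
  shows "small_prime_separable (insert (1 / d) A)"
proof -
  define R where "R = generated_subring A"
  have R: "is_subring R" unfolding R_def by (rule is_subring_generated)
  obtain K where K: "cost_le A K d" using d(1) unfolding generated_subring_def by blast
  define C where "C = K + 1"
  let ?S = "generated_subring (insert (1 / d) A)"
  have den: "\<exists>n. d ^ n * z \<in> R" if "z \<in> ?S" for z
  proof -
    from that obtain m where "cost_le (insert (1 / d) A) m z" unfolding generated_subring_def by blast
    from clear_denominator[OF K d(2) this] show ?thesis unfolding R_def using cost_le_in_generated_subring by blast
  qed
  have dR: "d ^ n \<in> R" for n using d(1) R by (simp add: R_def is_subringD)
  show ?thesis
  proof (rule small_prime_separable_pullback[OF A])
    fix k :: nat assume k: "k \<ge> 1"
    have "\<exists>y. cost_le A (2 * C * m ^ 2) y \<and> y \<noteq> 0 \<and>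
        (\<forall>p \<phi>. prime p \<and> 2 * C * m ^ 2 < p \<and> local_rep p k R \<phi> \<and> Zloc_unit_mat p k (\<phi> y) \<longrightarrow>
          (\<exists>\<psi>. local_rep p k ?S \<psi> \<and> Zloc_unit_mat p k (\<psi> z)))"
      if z: "cost_le (insert (1 / d) A) m z" "z \<noteq> 0" for m z
    proof (intro exI[of _ "d * (d ^ m * z)"] conjI allI impI)
      have m: "m \<ge> 1" by (rule cost_le_pos[OF z(1)])
      have "cost_le A (K + C * m) (d * (d ^ m * z))"
        unfolding C_def by (rule cost_le.mult[OF K clear_denominator[OF K d(2) z(1)]])
      moreover have "K + C * m \<le> 2 * C * m ^ 2"
      proof -
        have "C * m * 1 \<le> C * m * m" "C * 1 \<le> C * m" using m by (intro mult_left_mono; simp)+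
        thus ?thesis unfolding C_def by (simp add: power2_eq_square algebra_simps)
      qed
      ultimately show "cost_le A (2 * C * m ^ 2) (d * (d ^ m * z))" by (rule cost_le_mono)
      show "d * (d ^ m * z) \<noteq> 0" using d z by simp
      fix p \<phi> assume "prime p \<and> 2 * C * m ^ 2 < p \<and> local_rep p k R \<phi> \<and> Zloc_unit_mat p k (\<phi> (d * (d ^ m * z)))"
      hence p: "prime p" and r: "local_rep p k R \<phi>" and u: "Zloc_unit_mat p k (\<phi> (d * (d ^ m * z)))" by auto
      have d1: "d \<in> R" using dR[of 1] by simp
      have dm: "d ^ m * z \<in> R"
        using clear_denominator[OF K d(2) z(1)] cost_le_in_generated_subring unfolding R_def by blast
      have comm: "\<phi> x * \<phi> y = \<phi> y * \<phi> x" if "x \<in> R" "y \<in> R" for x y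
        using local_repD(5)[OF r that] local_repD(5)[OF r that(2,1)] by (simp add: mult.commute)
      have "Zloc_unit_mat p k (\<phi> d * \<phi> (d ^ m * z))" using u unfolding local_repD(5)[OF r d1 dm] .
      hence ud: "Zloc_unit_mat p k (\<phi> d)"
        by (rule Zloc_unit_mat_factor[OF p local_repD(2)[OF r d1] local_repD(2)[OF r dm] comm[OF d1 dm]])
      have "Zloc_unit_mat p k (\<phi> (d ^ m * z) * \<phi> d)" using u unfolding local_repD(5)[OF r d1 dm] comm[OF d1 dm] .
      hence uz: "Zloc_unit_mat p k (\<phi> (d ^ m * z))"
        by (rule Zloc_unit_mat_factor[OF p local_repD(2)[OF r dm] local_repD(2)[OF r d1] comm[OF dm d1]])
      have udn: "Zloc_unit_mat p k (\<phi> (d ^ n))" for n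
      proof (induction n)
        case 0 show ?case using Zloc_unit_mat_one[OF p] local_repD(3)[OF r] by simp
      next
        case (Suc n)
        show ?case using Zloc_unit_mat_mult[OF p ud Suc local_repD(1)[OF r d1] local_repD(1)[OF r dR]]
          unfolding local_repD(5)[OF r d1 dR, symmetric] by simp
      qed
      \<comment> \<open>\<open>Y\<close> is the value at \<open>x\<close> of the extension: it solves the equation that clears the denominator\<close>
      define val where "val x Y \<longleftrightarrow> Y \<in> Zloc_mat p k \<and> (\<exists>n. d ^ n * x \<in> R \<and> \<phi> (d ^ n) * Y = \<phi> (d ^ n * x))" for x Y
      \<comment> \<open>the exponent may be raised, so that two elements can be given a common denominator\<close>
      have shift: "d ^ (j + n) * x \<in> R \<and> \<phi> (d ^ (j + n)) * Y = \<phi> (d ^ (j + n) * x)"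
        if "d ^ n * x \<in> R" "\<phi> (d ^ n) * Y = \<phi> (d ^ n * x)" "Y \<in> Zloc_mat p k" for j n x Y
      proof -
        have e: "d ^ (j + n) * x = d ^ j * (d ^ n * x)" by (simp add: power_add)
        have Y: "Y \<in> carrier_mat k k" using that(3) by (rule Zloc_mat_carrier)
        have "\<phi> (d ^ (j + n)) * Y = (\<phi> (d ^ j) * \<phi> (d ^ n)) * Y" unfolding power_add local_repD(5)[OF r dR dR] ..
        also have "\<dots> = \<phi> (d ^ j) * (\<phi> (d ^ n) * Y)" by (rule assoc_mult_mat[OF local_repD(1)[OF r dR] local_repD(1)[OF r dR] Y])
        also have "\<dots> = \<phi> (d ^ j * (d ^ n * x))" unfolding that(2) local_repD(5)[OF r dR that(1)] ..
        finally show ?thesis unfolding e using is_subringD(5)[OF R dR that(1)] by simp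
      qed
      \<comment> \<open>compare both values at the exponent \<open>n + n'\<close>, where \<open>d ^ (n + n')\<close> acts invertibly\<close>
      have unique: "Y = Y'" if v: "val x Y" "val x Y'" for x Y Y'
      proof -
        from v obtain n n' where Y: "Y \<in> Zloc_mat p k" "d ^ n * x \<in> R" "\<phi> (d ^ n) * Y = \<phi> (d ^ n * x)"
          and Y': "Y' \<in> Zloc_mat p k" "d ^ n' * x \<in> R" "\<phi> (d ^ n') * Y' = \<phi> (d ^ n' * x)" unfolding val_def by blast
        have "\<phi> (d ^ (n' + n)) * Y = \<phi> (d ^ (n' + n) * x)" using shift[OF Y(2,3,1), of n'] by simp
        also have "\<dots> = \<phi> (d ^ (n' + n)) * Y'" using shift[OF Y'(2,3,1), of n] by (simp add: add.commute)
        finally show ?thesis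
          by (rule Zloc_unit_mat_cancel[OF udn local_repD(1)[OF r dR] Zloc_mat_carrier[OF Y(1)] Zloc_mat_carrier[OF Y'(1)]])
      qed
      have ex: "\<exists>Y. val x Y \<and> \<phi> (d ^ n) * Y = \<phi> (d ^ n * x)" if x: "d ^ n * x \<in> R" for x n
      proof -
        from udn[of n] obtain L where L: "L \<in> Zloc_mat p k" "\<phi> (d ^ n) * L = 1\<^sub>m k" unfolding Zloc_unit_mat_def by (elim bexE conjE)
        have "\<phi> (d ^ n) * (L * \<phi> (d ^ n * x)) = (\<phi> (d ^ n) * L) * \<phi> (d ^ n * x)"
          by (rule assoc_mult_mat[OF local_repD(1)[OF r dR] Zloc_mat_carrier[OF L(1)] local_repD(1)[OF r x], symmetric])
        also have "\<dots> = \<phi> (d ^ n * x)" unfolding L(2) by (rule left_mult_one_mat[OF local_repD(1)[OF r x]])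
        finally have e: "\<phi> (d ^ n) * (L * \<phi> (d ^ n * x)) = \<phi> (d ^ n * x)" .
        moreover have "L * \<phi> (d ^ n * x) \<in> Zloc_mat p k" by (rule Zloc_mat_mult[OF p L(1) local_repD(2)[OF r x]])
        ultimately have "val x (L * \<phi> (d ^ n * x))" unfolding val_def using x by blast
        thus ?thesis using e by blast
      qed
      define \<psi> where "\<psi> x = (THE Y. val x Y)" for x
      have \<psi>: "\<psi> x = Y" if "val x Y" for x Y unfolding \<psi>_def using that unique by blast
      have \<psi>': "val x (\<psi> x)" if x: "x \<in> ?S" for x
      proof -
        obtain Y where "val x Y" using den[OF x] ex by blast
        thus ?thesis using \<psi> by simp
      qed
      have "local_rep p k ?S \<psi>"
      proof (rule local_repI)
        fix x assume x: "x \<in> ?S"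
        obtain i where i: "\<psi> x \<in> Zloc_mat p k" "d ^ i * x \<in> R" "\<phi> (d ^ i) * \<psi> x = \<phi> (d ^ i * x)"
          using \<psi>'[OF x] unfolding val_def by blast
        show "\<psi> x \<in> Zloc_mat p k" by (rule i)
        fix y assume y: "y \<in> ?S"
        obtain j where j: "\<psi> y \<in> Zloc_mat p k" "d ^ j * y \<in> R" "\<phi> (d ^ j) * \<psi> y = \<phi> (d ^ j * y)"
          using \<psi>'[OF y] unfolding val_def by blast
        note c = Zloc_mat_carrier[OF i(1)] Zloc_mat_carrier[OF j(1)]
        define n where "n = j + i"
        have xn: "d ^ n * x \<in> R" "\<phi> (d ^ n) * \<psi> x = \<phi> (d ^ n * x)"
          using shift[OF i(2,3,1), of j] by (auto simp: n_def)
        have yn: "d ^ n * y \<in> R" "\<phi> (d ^ n) * \<psi> y = \<phi> (d ^ n * y)"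
          using shift[OF j(2,3,1), of i] by (auto simp: n_def add.commute)
        have "val (x + y) (\<psi> x + \<psi> y)" unfolding val_def
        proof (intro conjI exI[of _ n])
          show "\<psi> x + \<psi> y \<in> Zloc_mat p k" using i(1) j(1) Zloc_add[OF p] by (auto simp: Zloc_mat_def)
          show "d ^ n * (x + y) \<in> R" using xn yn by (simp add: distrib_left is_subringD[OF R])
          show "\<phi> (d ^ n) * (\<psi> x + \<psi> y) = \<phi> (d ^ n * (x + y))"
            unfolding mult_add_distrib_mat[OF local_repD(1)[OF r dR] c] xn yn distrib_left local_repD(4)[OF r xn(1) yn(1)] ..
        qed
        thus "\<psi> (x + y) = \<psi> x + \<psi> y" by (rule \<psi>)
        have "val (x * y) (\<psi> x * \<psi> y)" unfolding val_def
        proof (intro conjI exI[of _ "i + j"])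
          have e: "d ^ (i + j) * (x * y) = (d ^ i * x) * (d ^ j * y)" by (simp add: power_add)
          show "\<psi> x * \<psi> y \<in> Zloc_mat p k" by (rule Zloc_mat_mult[OF p i(1) j(1)])
          show "d ^ (i + j) * (x * y) \<in> R" unfolding e by (rule is_subringD(5)[OF R i(2) j(2)])
          note D = local_repD(1)[OF r dR]
          have "\<phi> (d ^ (i + j)) * (\<psi> x * \<psi> y) = (\<phi> (d ^ j) * \<phi> (d ^ i)) * (\<psi> x * \<psi> y)"
            unfolding power_add local_repD(5)[OF r dR dR] comm[OF dR dR] ..
          also have "\<dots> = \<phi> (d ^ j) * (\<phi> (d ^ i) * (\<psi> x * \<psi> y))" using c by (intro assoc_mult_mat[OF D D]) auto
          also have "\<phi> (d ^ i) * (\<psi> x * \<psi> y) = (\<phi> (d ^ i) * \<psi> x) * \<psi> y" by (rule assoc_mult_mat[OF D c, symmetric])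
          also have "\<dots> = \<phi> (d ^ i * x) * \<psi> y" unfolding i(3) ..
          also have "\<phi> (d ^ j) * \<dots> = (\<phi> (d ^ j) * \<phi> (d ^ i * x)) * \<psi> y"
            by (rule assoc_mult_mat[OF D local_repD(1)[OF r i(2)] c(2), symmetric])
          also have "\<dots> = (\<phi> (d ^ i * x) * \<phi> (d ^ j)) * \<psi> y" unfolding comm[OF dR i(2)] ..
          also have "\<dots> = \<phi> (d ^ i * x) * (\<phi> (d ^ j) * \<psi> y)" by (rule assoc_mult_mat[OF local_repD(1)[OF r i(2)] D c(2)])
          also have "\<dots> = \<phi> ((d ^ i * x) * (d ^ j * y))" unfolding j(3) local_repD(5)[OF r i(2) j(2)] ..
          finally show "\<phi> (d ^ (i + j)) * (\<psi> x * \<psi> y) = \<phi> (d ^ (i + j) * (x * y))" unfolding e .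
        qed
        thus "\<psi> (x * y) = \<psi> x * \<psi> y" by (rule \<psi>)
      next
        have "val 1 (1\<^sub>m k)" unfolding val_def
          using Zloc_mat_one[OF p] local_repD(3)[OF r] is_subringD(2)[OF R] by (intro conjI exI[of _ 0]) auto
        thus "\<psi> 1 = 1\<^sub>m k" by (rule \<psi>)
      qed
      moreover have "Zloc_unit_mat p k (\<psi> z)"
      proof -
        obtain Y where Y: "val z Y" "\<phi> (d ^ m) * Y = \<phi> (d ^ m * z)" using ex[OF dm] by blast
        have Yz: "Y \<in> Zloc_mat p k" using Y(1) by (simp add: val_def)
        from uz obtain L where L: "L \<in> Zloc_mat p k" "L * \<phi> (d ^ m * z) = 1\<^sub>m k" unfolding Zloc_unit_mat_def by (elim bexE conjE)
        have "(L * \<phi> (d ^ m)) * Y = L * (\<phi> (d ^ m) * Y)"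
          by (rule assoc_mult_mat[OF Zloc_mat_carrier[OF L(1)] local_repD(1)[OF r dR] Zloc_mat_carrier[OF Yz]])
        also have "\<dots> = 1\<^sub>m k" unfolding Y(2) by (rule L(2))
        finally show ?thesis unfolding \<psi>[OF Y(1)]
          by (rule Zloc_unit_matI_left[OF Zloc_mat_carrier[OF Yz] Zloc_mat_mult[OF p L(1) local_repD(2)[OF r dR]]])
      qed
      ultimately show "\<exists>\<psi>. local_rep p k ?S \<psi> \<and> Zloc_unit_mat p k (\<psi> z)" by blast
    qed
    moreover have "2 * C \<ge> 1" by (simp add: C_def)
    ultimately show "\<exists>l\<ge>1. \<exists>c\<ge>1. \<forall>m z. cost_le (insert (1 / d) A) m z \<and> z \<noteq> 0 \<longrightarrow>
      (\<exists>y. cost_le A (c * m ^ 2) y \<and> y \<noteq> 0 \<and>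
        (\<forall>p \<phi>. prime p \<and> c * m ^ 2 < p \<and> local_rep p k (generated_subring A) \<phi> \<and> Zloc_unit_mat p k (\<phi> y) \<longrightarrow>
          (\<exists>\<psi>. local_rep p l ?S \<psi> \<and> Zloc_unit_mat p l (\<psi> z))))" using k unfolding R_def by blast
  qed
qed

section \<open>Adjoining a transcendental element and the general case\<close>

lemma coeff_mult_top:
  fixes f g :: "'a::comm_ring_1 poly"
  assumes "degree f \<le> m" "degree g \<le> n"
  shows "coeff (f * g) (m + n) = coeff f m * coeff g n"
proof -
  have "coeff f i * coeff g (m + n - i) = (if i = m then coeff f m * coeff g n else 0)" if "i \<le> m + n" for i
    using assms that by (cases i m rule: linorder_cases) (auto simp: coeff_eq_0)
  thus ?thesis by (simp add: coeff_mult)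
qed

text \<open>The coefficient in the largest degree that the bounds permit is multiplicative, whether or not it
  is a leading coefficient.\<close>

lemma degree_coeff_prod_top:
  fixes f :: "'b \<Rightarrow> 'a::comm_ring_1 poly"
  assumes "finite I" "\<And>i. i \<in> I \<Longrightarrow> degree (f i) \<le> D"
  shows "degree (prod f I) \<le> card I * D \<and> coeff (prod f I) (card I * D) = (\<Prod>i\<in>I. coeff (f i) D)"
  using assms
proof (induction I)
  case (insert i I)
  hence IH: "degree (prod f I) \<le> card I * D" "coeff (prod f I) (card I * D) = (\<Prod>i\<in>I. coeff (f i) D)"
    and i: "degree (f i) \<le> D" by auto
  have "degree (f i * prod f I) \<le> D + card I * D"
    using degree_mult_le[of "f i" "prod f I"] IH(1) i by linarith
  thus ?case using insert.hyps coeff_mult_top[OF i IH(1)] IH(2) by simp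
qed simp

lemma
  fixes M :: "'a::comm_ring_1 poly mat"
  assumes M: "M \<in> carrier_mat k k" and D: "\<And>i j. i < k \<Longrightarrow> j < k \<Longrightarrow> degree (M $$ (i, j)) \<le> D"
  shows degree_det_le: "degree (det M) \<le> k * D"
    and coeff_det_top: "coeff (det M) (k * D) = det (map_mat (\<lambda>f. coeff f D) M)"
proof -
  have s: "signof \<pi> * f = smult (signof \<pi>) f" for \<pi> :: "nat \<Rightarrow> nat" and f :: "'a poly"
    by (simp add: sign_def)
  have t: "degree (\<Prod>i = 0..<k. M $$ (i, \<pi> i)) \<le> k * D"
    "coeff (\<Prod>i = 0..<k. M $$ (i, \<pi> i)) (k * D) = (\<Prod>i = 0..<k. coeff (M $$ (i, \<pi> i)) D)" if "\<pi> permutes {0..<k}" for \<pi>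
    using degree_coeff_prod_top[of "{0..<k}" "\<lambda>i. M $$ (i, \<pi> i)" D] that D
    by (auto simp: permutes_in_image[of \<pi> "{0..<k}", simplified])
  show "degree (det M) \<le> k * D" unfolding det_def'[OF M] s
    by (intro degree_sum_le) (auto simp: finite_permutations intro!: order_trans[OF degree_smult_le] t)
  have "coeff (det M) (k * D) = (\<Sum>\<pi> | \<pi> permutes {0..<k}. signof \<pi> * (\<Prod>i = 0..<k. coeff (M $$ (i, \<pi> i)) D))"
    unfolding det_def'[OF M] s coeff_sum by (intro sum.cong) (auto simp: t)
  also have "\<dots> = (\<Sum>\<pi> | \<pi> permutes {0..<k}. signof \<pi> * (\<Prod>i = 0..<k. map_mat (\<lambda>f. coeff f D) M $$ (i, \<pi> i)))"
  proof (rule sum.cong[OF refl])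
    fix \<pi> assume "\<pi> \<in> {\<pi>. \<pi> permutes {0..<k}}"
    hence "(\<Prod>i = 0..<k. coeff (M $$ (i, \<pi> i)) D) = (\<Prod>i = 0..<k. map_mat (\<lambda>f. coeff f D) M $$ (i, \<pi> i))"
      using M by (intro prod.cong) (auto simp: permutes_in_image[of \<pi> "{0..<k}", simplified])
    thus "signof \<pi> * (\<Prod>i = 0..<k. coeff (M $$ (i, \<pi> i)) D) =
      signof \<pi> * (\<Prod>i = 0..<k. map_mat (\<lambda>f. coeff f D) M $$ (i, \<pi> i))" by (rule arg_cong)
  qed
  also have "\<dots> = det (map_mat (\<lambda>f. coeff f D) M)"
    using M by (subst det_def'[of _ k]) auto
  finally show "coeff (det M) (k * D) = det (map_mat (\<lambda>f. coeff f D) M)" .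
qed

lemma poly_det:
  fixes M :: "'a::comm_ring_1 poly mat"
  assumes M: "M \<in> carrier_mat k k"
  shows "poly (det M) x = det (map_mat (\<lambda>f. poly f x) M)"
proof -
  have s: "signof \<pi> * f = smult (signof \<pi>) f" for \<pi> :: "nat \<Rightarrow> nat" and f :: "'a poly"
    by (simp add: sign_def)
  have "poly (det M) x = (\<Sum>\<pi> | \<pi> permutes {0..<k}. signof \<pi> * (\<Prod>i = 0..<k. poly (M $$ (i, \<pi> i)) x))"
    unfolding det_def'[OF M] s by (simp add: poly_sum poly_prod)
  also have "\<dots> = (\<Sum>\<pi> | \<pi> permutes {0..<k}. signof \<pi> * (\<Prod>i = 0..<k. map_mat (\<lambda>f. poly f x) M $$ (i, \<pi> i)))"
  proof (rule sum.cong[OF refl])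
    fix \<pi> assume "\<pi> \<in> {\<pi>. \<pi> permutes {0..<k}}"
    hence "(\<Prod>i = 0..<k. poly (M $$ (i, \<pi> i)) x) = (\<Prod>i = 0..<k. map_mat (\<lambda>f. poly f x) M $$ (i, \<pi> i))"
      using M by (intro prod.cong) (auto simp: permutes_in_image[of \<pi> "{0..<k}", simplified])
    thus "signof \<pi> * (\<Prod>i = 0..<k. poly (M $$ (i, \<pi> i)) x) =
      signof \<pi> * (\<Prod>i = 0..<k. map_mat (\<lambda>f. poly f x) M $$ (i, \<pi> i))" by (rule arg_cong)
  qed
  also have "\<dots> = det (map_mat (\<lambda>f. poly f x) M)"
    using M by (subst det_def'[of _ k]) auto
  finally show ?thesis .
qed

lemma Zloc_unit_det:
  assumes p: "prime p" and M: "M \<in> Zloc_mat p k" and u: "Zloc_unit_mat p k M"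
  shows "Zloc_unit p (det M)"
proof -
  from u obtain N where N: "N \<in> Zloc_mat p k" "M * N = 1\<^sub>m k" unfolding Zloc_unit_mat_def by (elim bexE conjE)
  have c: "M \<in> carrier_mat k k" "N \<in> carrier_mat k k" using M N(1) by (auto intro: Zloc_mat_carrier)
  have z: "det M \<in> Zloc p" "det N \<in> Zloc p"
    using subring_det[OF subring_Zloc[OF p] c(1)] subring_det[OF subring_Zloc[OF p] c(2)] M N(1)
    by (auto simp: Zloc_mat_def)
  have "det M * det N = 1" using det_mult[OF c] N(2) by simp
  hence "(residue p (det M) * residue p (det N)) mod int p = 1"
    using residue_mult[OF p z] Zloc_simps(6)[OF p] by simp
  hence "residue p (det M) \<noteq> 0" by auto
  thus ?thesis using z by (simp add: Zloc_unit_def)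
qed

text \<open>The ring is a polynomial ring over the ring \<open>R\<close> generated by \<open>A\<close>.  Make the leading coefficient of
  \<open>z\<close> invertible in a representation of \<open>R\<close> of size \<open>k\<close>.  If \<open>z\<close> has degree \<open>D\<close> in \<open>a\<close>, sending \<open>a\<close> to an
  indeterminate gives a matrix whose determinant has a unit as coefficient in degree \<open>k * D\<close>,
  the determinant of the leading coefficient.  Since \<open>k * D < p\<close>, the indeterminate can be
  specialized to an integer at which the determinant is a unit.\<close>

lemma small_prime_separable_transcendental:
  assumes A: "small_prime_separable A" and trans: "\<And>q. q \<noteq> 0 \<Longrightarrow> (\<And>i. coeff q i \<in> generated_subring A) \<Longrightarrow> poly q a \<noteq> 0"
  shows "small_prime_separable (insert a A)"
proof -
  define R where "R = generated_subring A"
  have R: "is_subring R" unfolding R_def by (rule is_subring_generated)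
  let ?S = "generated_subring (insert a A)"
  define P where "P = {q. \<forall>i. coeff q i \<in> R}"
  have P: "is_subring P" unfolding P_def by (rule subring_poly_coeffs[OF R])
  have unique: "q = r" if "q \<in> P" "r \<in> P" "poly q a = poly r a" for q r
  proof (rule ccontr)
    assume "q \<noteq> r"
    hence "poly (q - r) a \<noteq> 0"
      using is_subringD(6)[OF P that(1,2)] by (intro trans) (auto simp: P_def R_def)
    thus False using that(3) by simp
  qed
  have c0: "cost_le A (2 * m ^ 2) 0" if "m \<ge> 1" for m
    using that by (intro cost_le_mono[OF cost_le.zero]) (simp add: Suc_le_eq)
  \<comment> \<open>a coefficient of a product is a sum of at most \<open>i + j + 1\<close> products, a number absorbed by
    the excess \<open>4 * i * j\<close> of \<open>2 * (i + j) ^ 2\<close> over \<open>2 * i ^ 2 + 2 * j ^ 2\<close>\<close>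
  have main: "\<exists>q. poly q a = z \<and> degree q \<le> m \<and> (\<forall>i. cost_le A (2 * m ^ 2) (coeff q i))"
    if "cost_le (insert a A) m z" for m z
    using that
  proof induction
    case zero show ?case using c0[of 1] by (intro exI[of _ 0]) auto
  next
    case one
    show ?case using c0[of 1] cost_le_mono[OF cost_le.one, of 2 A]
      by (intro exI[of _ 1]) (auto simp: coeff_1)
  next
    case minus_one
    show ?case using c0[of 1] cost_le_mono[OF cost_le.minus_one, of 2 A]
      by (intro exI[of _ "[:-1:]"]) (auto simp: coeff_pCons split: nat.split)
  next
    case (gen b)
    show ?case
    proof (cases "b = a")
      case True
      show ?thesis using c0[of 1] cost_le_mono[OF cost_le.one, of 2 A] True
        by (intro exI[of _ "[:0, 1:]"]) (auto simp: coeff_pCons split: nat.split)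
    next
      case False
      hence "cost_le A 2 b" using gen cost_le_mono[OF cost_le.gen[of b A], of 2] by auto
      thus ?thesis using c0[of 1]
        by (intro exI[of _ "[:b:]"]) (auto simp: coeff_pCons split: nat.split)
    qed
  next
    case (mult i x j y)
    then obtain f g where f: "poly f a = x" "degree f \<le> i" "\<And>n. cost_le A (2 * i ^ 2) (coeff f n)"
      and g: "poly g a = y" "degree g \<le> j" "\<And>n. cost_le A (2 * j ^ 2) (coeff g n)" by blast
    have ij: "i \<ge> 1" "j \<ge> 1" using mult.hyps cost_le_pos by blast+
    have deg: "degree (f * g) \<le> i + j" using degree_mult_le[of f g] f(2) g(2) by linarith
    have "cost_le A (2 * (i + j) ^ 2) (coeff (f * g) n)" for n
    proof (cases "n \<le> i + j")
      case False
      hence "coeff (f * g) n = 0" using deg by (intro coeff_eq_0) auto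
      thus ?thesis using c0[of "i + j"] ij by simp
    next
      case True
      have "cost_le A ((2 * i ^ 2 + 2 * j ^ 2) + card {..n}) (coeff (f * g) n)"
        unfolding coeff_mult
      proof (rule cost_le_sum)
        show "1 \<le> 2 * i ^ 2 + 2 * j ^ 2" using ij by (simp add: Suc_le_eq)
      qed (use f(3) g(3) in \<open>auto intro!: cost_le.mult\<close>)
      moreover have "(2 * i ^ 2 + 2 * j ^ 2) + card {..n} \<le> 2 * (i + j) ^ 2"
      proof -
        have "i * 1 \<le> i * j" "1 * j \<le> i * j" "1 * 1 \<le> i * j" using ij by (intro mult_mono; simp)+
        hence "i + j + 1 \<le> 4 * (i * j)" by linarith
        hence "card {..n} \<le> 4 * (i * j)" using True by simp
        thus ?thesis by (simp add: power2_eq_square algebra_simps)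
      qed
      ultimately show ?thesis by (rule cost_le_mono)
    qed
    thus ?case using f(1) g(1) deg by (intro exI[of _ "f * g"]) auto
  next
    case (add i x y)
    then obtain f g where f: "poly f a = x" "degree f \<le> i" "\<And>n. cost_le A (2 * i ^ 2) (coeff f n)"
      and g: "poly g a = y" "degree g \<le> i" "\<And>n. cost_le A (2 * i ^ 2) (coeff g n)" by blast
    have l: "2 * i ^ 2 < 2 * (Suc i) ^ 2" by (simp add: power2_eq_square)
    have "cost_le A (2 * (Suc i) ^ 2) (coeff (f + g) n)" for n
      using cost_le_add[OF f(3) g(3) l l] by simp
    moreover have "degree (f + g) \<le> Suc i" using f(2) g(2) degree_add_le[of f i g] by simp
    ultimately show ?case using f(1) g(1) by (intro exI[of _ "f + g"]) auto
  next
    case (Suc i x)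
    then obtain f where f: "poly f a = x" "degree f \<le> i" "\<And>n. cost_le A (2 * i ^ 2) (coeff f n)" by blast
    have l: "2 * i ^ 2 \<le> 2 * (Suc i) ^ 2" by (simp add: power2_eq_square)
    show ?case using f(1,2) cost_le_mono[OF f(3) l] by (intro exI[of _ f]) auto
  qed
  have main': "\<exists>q\<in>P. poly q a = z" if "z \<in> ?S" for z
  proof -
    from that obtain m where "cost_le (insert a A) m z" unfolding generated_subring_def by blast
    from main[OF this] obtain q where "poly q a = z" "\<And>i. coeff q i \<in> R"
      using cost_le_in_generated_subring unfolding R_def by blast
    thus ?thesis unfolding P_def by blast
  qed
  show ?thesis
  proof (rule small_prime_separable_pullback[OF A])
    fix k :: nat assume k: "k \<ge> 1"
    have "\<exists>y. cost_le A ((k + 2) * m ^ 2) y \<and> y \<noteq> 0 \<and>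
        (\<forall>p \<phi>. prime p \<and> (k + 2) * m ^ 2 < p \<and> local_rep p k R \<phi> \<and> Zloc_unit_mat p k (\<phi> y) \<longrightarrow>
          (\<exists>\<psi>. local_rep p k ?S \<psi> \<and> Zloc_unit_mat p k (\<psi> z)))"
      if z: "cost_le (insert a A) m z" "z \<noteq> 0" for m z
    proof -
      obtain q where q: "poly q a = z" "degree q \<le> m" "\<And>i. cost_le A (2 * m ^ 2) (coeff q i)"
        using main[OF z(1)] by blast
      have qP: "q \<in> P" using q(3) cost_le_in_generated_subring unfolding P_def R_def by blast
      define D where "D = degree q"
      have m: "m \<ge> 1" by (rule cost_le_pos[OF z(1)])
      have "\<exists>\<psi>. local_rep p k ?S \<psi> \<and> Zloc_unit_mat p k (\<psi> z)"
        if p: "prime p" and large: "(k + 2) * m ^ 2 < p" and r: "local_rep p k R \<phi>" and u: "Zloc_unit_mat p k (\<phi> (coeff q D))" for p \<phi>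
      proof -
        \<comment> \<open>apply \<open>\<phi>\<close> to the coefficients; the matrices obtained are read as matrices of polynomials\<close>
        define W where "W f = mat k k (\<lambda>(i, j). map_poly (\<lambda>c. \<phi> c $$ (i, j)) f)" for f
        have coeff_W: "coeff (W f $$ (i, j)) n = \<phi> (coeff f n) $$ (i, j)" if "i < k" "j < k" for f i j n
          using that local_rep_zero[OF r R] by (simp add: W_def coeff_map_poly)
        have W_carrier: "W f \<in> carrier_mat k k" for f by (simp add: W_def)
        have W_Z: "coeff (W f $$ (i, j)) n \<in> Zloc p" if "f \<in> P" "i < k" "j < k" for f i j n
          unfolding coeff_W[OF that(2,3)] using that by (intro Zloc_matD[OF local_repD(2)[OF r]]) (auto simp: P_def)
        have W_mult: "W (f * g) = W f * W g" if f: "f \<in> P" and g: "g \<in> P" for f g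
        proof (rule eq_matI)
          fix i j assume "i < dim_row (W f * W g)" "j < dim_col (W f * W g)"
          hence ij: "i < k" "j < k" by (auto simp: W_def)
          show "W (f * g) $$ (i, j) = (W f * W g) $$ (i, j)"
          proof (rule poly_eqI)
            fix n
            have fg: "coeff f l \<in> R" "coeff g l \<in> R" for l using f g by (auto simp: P_def)
            have "coeff (W (f * g) $$ (i, j)) n = \<phi> (\<Sum>l\<le>n. coeff f l * coeff g (n - l)) $$ (i, j)"
              unfolding coeff_W[OF ij] coeff_mult ..
            also have "\<dots> = (\<Sum>l\<le>n. \<phi> (coeff f l * coeff g (n - l)) $$ (i, j))"
              by (intro local_rep_sum_index[OF r R _ _ ij] is_subringD(5)[OF R] fg) auto
            also have "\<dots> = (\<Sum>l\<le>n. \<Sum>s<k. \<phi> (coeff f l) $$ (i, s) * \<phi> (coeff g (n - l)) $$ (s, j))"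
            proof (rule sum.cong[OF refl])
              fix l
              show "\<phi> (coeff f l * coeff g (n - l)) $$ (i, j) = (\<Sum>s<k. \<phi> (coeff f l) $$ (i, s) * \<phi> (coeff g (n - l)) $$ (s, j))"
                unfolding local_repD(5)[OF r fg]
                using local_repD(1)[OF r fg(1)[of l]] local_repD(1)[OF r fg(2)[of "n - l"]] ij
                by (auto simp: scalar_prod_def lessThan_atLeast0)
            qed
            also have "\<dots> = (\<Sum>s<k. \<Sum>l\<le>n. coeff (W f $$ (i, s)) l * coeff (W g $$ (s, j)) (n - l))"
              by (subst sum.swap) (simp add: coeff_W ij)
            also have "\<dots> = coeff (\<Sum>s<k. W f $$ (i, s) * W g $$ (s, j)) n"
              by (simp add: coeff_sum coeff_mult)
            also have "(\<Sum>s<k. W f $$ (i, s) * W g $$ (s, j)) = (W f * W g) $$ (i, j)"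
              using ij W_carrier[of f] W_carrier[of g] by (auto simp: scalar_prod_def lessThan_atLeast0)
            finally show "coeff (W (f * g) $$ (i, j)) n = coeff ((W f * W g) $$ (i, j)) n" .
          qed
        qed (auto simp: W_def)
        have W_add: "W (f + g) $$ (i, j) = W f $$ (i, j) + W g $$ (i, j)"
          if f: "f \<in> P" and g: "g \<in> P" and ij: "i < k" "j < k" for f g i j
        proof (rule poly_eqI)
          fix n
          have fg: "coeff f n \<in> R" "coeff g n \<in> R" using f g by (auto simp: P_def)
          show "coeff (W (f + g) $$ (i, j)) n = coeff (W f $$ (i, j) + W g $$ (i, j)) n"
            using local_repD(4)[OF r fg] local_repD(1)[OF r fg(1)] local_repD(1)[OF r fg(2)] ij by (simp add: coeff_W)
        qed
        \<comment> \<open>the determinant has unit coefficient in degree \<open>k * D < p\<close>, hence a unit value at some integer,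
          to which \<open>a\<close> is sent\<close>
        define F where "F = det (W q)"
        have degW: "degree (W q $$ (i, j)) \<le> D" if "i < k" "j < k" for i j
          unfolding W_def D_def using that degree_map_poly_le by simp
        have "\<exists>x\<in>{..<p}. Zloc_unit p (poly F (of_nat x))"
        proof (rule poly_unit_value[OF p])
          show "coeff F i \<in> Zloc p" for i
          proof -
            have "det (W q) \<in> {f. \<forall>n. coeff f n \<in> Zloc p}"
              by (rule subring_det[OF subring_poly_coeffs[OF subring_Zloc[OF p]] W_carrier]) (use W_Z[OF qP] in blast)
            thus ?thesis by (simp add: F_def)
          qed
          show "degree F \<le> k * D" unfolding F_def by (rule degree_det_le[OF W_carrier degW])
          have qD: "coeff q D \<in> R" using qP by (simp add: P_def)
          have "map_mat (\<lambda>f. coeff f D) (W q) = \<phi> (coeff q D)"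
            using local_repD(1)[OF r qD] W_carrier[of q] by (intro eq_matI) (auto simp: coeff_W)
          hence "coeff F (k * D) = det (\<phi> (coeff q D))"
            unfolding F_def by (simp add: coeff_det_top[OF W_carrier degW])
          thus "Zloc_unit p (coeff F (k * D))" using Zloc_unit_det[OF p local_repD(2)[OF r qD] u] by simp
          have "k * D \<le> k * m" using q(2) by (simp add: D_def)
          also have "\<dots> \<le> (k + 2) * m ^ 2" using m by (intro mult_mono) (auto simp: power2_eq_square)
          finally show "card {..<p} > k * D" using large by simp
        qed auto
        then obtain x where x: "Zloc_unit p (poly F (of_nat x))" by blast
        define Ev where "Ev f = map_mat (\<lambda>h. poly h (of_nat x)) (W f)" for f
        have Ev_index: "Ev f $$ (i, j) = poly (W f $$ (i, j)) (of_nat x)" if "i < k" "j < k" for f i j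
          using that W_carrier[of f] by (simp add: Ev_def)
        have Ev_carrier: "Ev f \<in> carrier_mat k k" for f using W_carrier[of f] by (simp add: Ev_def)
        have Ev_Z: "Ev f \<in> Zloc_mat p k" if "f \<in> P" for f
          using Ev_carrier by (rule Zloc_matI)
            (auto simp: Ev_index intro!: subring_poly[OF subring_Zloc[OF p]] W_Z that Zloc_simps p)
        have Ev_mult: "Ev (f * g) = Ev f * Ev g" if "f \<in> P" "g \<in> P" for f g
        proof (rule eq_matI)
          fix i j assume "i < dim_row (Ev f * Ev g)" "j < dim_col (Ev f * Ev g)"
          hence ij: "i < k" "j < k" using Ev_carrier[of f] Ev_carrier[of g] by auto
          have "(W f * W g) $$ (i, j) = (\<Sum>s<k. W f $$ (i, s) * W g $$ (s, j))"
            using ij W_carrier[of f] W_carrier[of g] by (auto simp: scalar_prod_def lessThan_atLeast0)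
          hence "Ev (f * g) $$ (i, j) = (\<Sum>s<k. Ev f $$ (i, s) * Ev g $$ (s, j))"
            using ij by (simp add: Ev_index W_mult[OF that] poly_sum)
          thus "Ev (f * g) $$ (i, j) = (Ev f * Ev g) $$ (i, j)"
            using ij Ev_carrier[of f] Ev_carrier[of g] by (auto simp: scalar_prod_def lessThan_atLeast0)
        qed (use Ev_carrier[of f] Ev_carrier[of g] Ev_carrier[of "f * g"] in auto)
        have Ev_add: "Ev (f + g) = Ev f + Ev g" if "f \<in> P" "g \<in> P" for f g
        proof (rule eq_matI)
          fix i j assume "i < dim_row (Ev f + Ev g)" "j < dim_col (Ev f + Ev g)"
          hence ij: "i < k" "j < k" using Ev_carrier[of f] Ev_carrier[of g] by auto
          show "Ev (f + g) $$ (i, j) = (Ev f + Ev g) $$ (i, j)"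
            using ij Ev_carrier[of g] by (simp add: Ev_index W_add[OF that])
        qed (use Ev_carrier[of g] Ev_carrier[of "f + g"] in auto)
        have Ev_one: "Ev 1 = 1\<^sub>m k"
        proof (rule eq_matI)
          fix i j assume "i < dim_row (1\<^sub>m k :: rat mat)" "j < dim_col (1\<^sub>m k :: rat mat)"
          hence ij: "i < k" "j < k" by auto
          have "W 1 $$ (i, j) = [:1\<^sub>m k $$ (i, j):]"
            using ij local_rep_zero[OF r R] local_repD(3)[OF r]
            by (intro poly_eqI) (auto simp: coeff_W coeff_1 coeff_pCons split: nat.split)
          thus "Ev 1 $$ (i, j) = 1\<^sub>m k $$ (i, j)" using ij by (simp add: Ev_index)
        qed (use Ev_carrier[of 1] in auto)
        define pol where "pol z = (THE f. f \<in> P \<and> poly f a = z)" for z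
        have pol: "pol (poly f a) = f" if "f \<in> P" for f
          unfolding pol_def using that unique by blast
        define \<psi> where "\<psi> z = Ev (pol z)" for z
        have \<psi>: "\<psi> (poly f a) = Ev f" if "f \<in> P" for f by (simp add: \<psi>_def pol[OF that])
        have "local_rep p k ?S \<psi>"
        proof (rule local_repI)
          fix x assume "x \<in> ?S"
          then obtain f where f: "f \<in> P" "x = poly f a" using main' by blast
          show "\<psi> x \<in> Zloc_mat p k" unfolding f(2) \<psi>[OF f(1)] by (rule Ev_Z[OF f(1)])
          fix y assume "y \<in> ?S"
          then obtain g where g: "g \<in> P" "y = poly g a" using main' by blast
          show "\<psi> (x + y) = \<psi> x + \<psi> y"
            using \<psi>[OF is_subringD(4)[OF P f(1) g(1)]] Ev_add[OF f(1) g(1)] by (simp add: f g \<psi>)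
          show "\<psi> (x * y) = \<psi> x * \<psi> y"
            using \<psi>[OF is_subringD(5)[OF P f(1) g(1)]] Ev_mult[OF f(1) g(1)] by (simp add: f g \<psi>)
        next
          show "\<psi> 1 = 1\<^sub>m k" using \<psi>[OF is_subringD(2)[OF P]] Ev_one by simp
        qed
        moreover have "Zloc_unit_mat p k (\<psi> z)"
        proof -
          have "Zloc_unit p (det (Ev q))" using x unfolding F_def Ev_def poly_det[OF W_carrier] .
          thus ?thesis using Zloc_unit_matI_det[OF p Ev_Z[OF qP]] \<psi>[OF qP] q(1) by simp
        qed
        ultimately show ?thesis by blast
      qed
      moreover have "cost_le A ((k + 2) * m ^ 2) (coeff q D)"
        using q(3)[of D] by (rule cost_le_mono) simp
      moreover have "coeff q D \<noteq> 0" using q(1) z(2) unfolding D_def by auto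
      ultimately show ?thesis by blast
    qed
    moreover have "k + 2 \<ge> 1" by simp
    ultimately show "\<exists>l\<ge>1. \<exists>c\<ge>1. \<forall>m z. cost_le (insert a A) m z \<and> z \<noteq> 0 \<longrightarrow>
      (\<exists>y. cost_le A (c * m ^ 2) y \<and> y \<noteq> 0 \<and>
        (\<forall>p \<phi>. prime p \<and> c * m ^ 2 < p \<and> local_rep p k (generated_subring A) \<phi> \<and> Zloc_unit_mat p k (\<phi> y) \<longrightarrow>
          (\<exists>\<psi>. local_rep p l ?S \<psi> \<and> Zloc_unit_mat p l (\<psi> z))))" using k unfolding R_def by blast
  qed
qed

text \<open>Take a polynomial over the ring generated by \<open>A\<close> that vanishes at \<open>a\<close> and has minimal degree.
  After its leading coefficient is inverted, \<open>a\<close> is integral, and by minimality its powers below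
  that degree remain linearly independent.\<close>

lemma small_prime_separable_algebraic:
  assumes A: "small_prime_separable A" and fin: "finite A" and q: "q \<noteq> 0" "\<And>i. coeff q i \<in> generated_subring A" "poly q a = 0"
  shows "small_prime_separable (insert a A)"
proof -
  define R where "R = generated_subring A"
  have R: "is_subring R" unfolding R_def by (rule is_subring_generated)
  define Q where "Q f \<longleftrightarrow> f \<noteq> 0 \<and> (\<forall>i. coeff f i \<in> R) \<and> poly f a = 0" for f
  have "Q q" using q by (simp add: Q_def R_def)
  then obtain f where f: "Q f" and min: "\<And>g. Q g \<Longrightarrow> degree f \<le> degree g"
    using ex_has_least_nat[of Q q degree] by blast
  define e where "e = degree f"
  define d where "d = lead_coeff f"
  have d: "d \<in> R" "d \<noteq> 0" using f by (auto simp: d_def Q_def)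
  have e: "e \<ge> 1"
  proof (rule ccontr)
    assume "\<not> ?thesis"
    hence "degree f = 0" by (simp add: e_def)
    then obtain c where "f = [:c:]" by (auto elim: degree_eq_zeroE)
    thus False using f by (auto simp: Q_def)
  qed
  let ?B = "insert (1 / d) A"
  have B: "small_prime_separable ?B" using small_prime_separable_localize[OF A _ d(2)] d(1) by (simp add: R_def)
  have RB: "is_subring (generated_subring ?B)" by (rule is_subring_generated)
  have sub: "R \<subseteq> generated_subring ?B" unfolding R_def
    by (rule generated_subring_least[OF RB]) (auto intro: generated_subring_gen)
  have den: "\<exists>n. d ^ n * z \<in> R" if z: "z \<in> generated_subring ?B" for z
  proof -
    obtain K where K: "cost_le A K d" using d(1) unfolding R_def generated_subring_def by blast
    obtain m where "cost_le ?B m z" using z unfolding generated_subring_def by blast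
    from clear_denominator[OF K d(2) this] show ?thesis unfolding R_def using cost_le_in_generated_subring by blast
  qed
  have "small_prime_separable (insert a ?B)"
  proof (rule small_prime_separable_integral[OF B e])
    show "- coeff f i * (1 / d) \<in> generated_subring ?B" for i
    proof -
      have "coeff f i \<in> generated_subring ?B" using f sub by (auto simp: Q_def)
      moreover have "1 / d \<in> generated_subring ?B" by (rule generated_subring_gen) simp
      ultimately show ?thesis using is_subringD(5)[OF RB is_subringD(3)[OF RB]] by blast
    qed
    have "0 = (\<Sum>i\<le>e. coeff f i * a ^ i)" using f by (simp add: Q_def poly_altdef e_def)
    also have "\<dots> = (\<Sum>i<e. coeff f i * a ^ i) + d * a ^ e"
      by (simp add: lessThan_Suc_atMost[symmetric] d_def e_def)
    finally have "d * a ^ e = - (\<Sum>i<e. coeff f i * a ^ i)" by (simp add: eq_neg_iff_add_eq_0 add.commute)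
    hence "a ^ e = (1 / d) * - (\<Sum>i<e. coeff f i * a ^ i)" using d(2) by (simp add: field_simps)
    thus "a ^ e = (\<Sum>i<e. - coeff f i * (1 / d) * a ^ i)"
      by (simp add: sum_distrib_left sum_negf)
  next
    fix c assume c: "\<And>i. i < e \<Longrightarrow> c i \<in> generated_subring ?B" and s: "(\<Sum>i<e. c i * a ^ i) = 0"
    have "\<exists>n. d ^ n * c i \<in> R" if "i < e" for i using den[OF c[OF that]] .
    then obtain n where n: "\<And>i. i < e \<Longrightarrow> d ^ n i * c i \<in> R" by metis
    \<comment> \<open>a relation over the localization becomes one over \<open>R\<close> of degree below the minimal one\<close>
    define N where "N = (\<Sum>i<e. n i)"
    have N: "d ^ N * c i \<in> R" if i: "i < e" for i
    proof -
      have "n i \<le> N" unfolding N_def using i by (intro member_le_sum) auto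
      hence "d ^ N = d ^ (N - n i) * d ^ n i" using power_add[of d "N - n i" "n i"] by simp
      hence e: "d ^ N * c i = d ^ (N - n i) * (d ^ n i * c i)" by (simp only: mult.assoc)
      show ?thesis unfolding e by (rule is_subringD(5)[OF R is_subringD(7)[OF R d(1)] n[OF i]])
    qed
    define g where "g = (\<Sum>i<e. monom (d ^ N * c i) i)"
    have cg: "coeff g i = (if i < e then d ^ N * c i else 0)" for i
      by (simp add: g_def coeff_sum)
    have "g = 0"
    proof (rule ccontr)
      assume g: "g \<noteq> 0"
      have "degree g < e"
      proof (rule ccontr)
        assume "\<not> ?thesis"
        hence "lead_coeff g = 0" by (simp add: cg)
        thus False using g by simp
      qed
      moreover have "poly g a = d ^ N * (\<Sum>i<e. c i * a ^ i)"
        by (simp add: g_def poly_sum poly_monom sum_distrib_left mult.assoc)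
      hence "Q g" using g N s R by (auto simp: Q_def cg is_subringD)
      ultimately show False using min[of g] by (simp add: e_def)
    qed
    thus "\<forall>i<e. c i = 0" using cg d(2) by (metis coeff_0 mult_eq_0_iff power_not_zero)
  qed
  thus ?thesis
    by (rule small_prime_separable_subset) (use fin in \<open>auto intro: generated_subring_gen\<close>)
qed

lemma small_prime_separable_finite: "finite A \<Longrightarrow> small_prime_separable A"
proof (induction A rule: finite_induct)
  case empty show ?case by (rule small_prime_separable_empty)
next
  case (insert a A)
  show ?case
  proof (cases "\<exists>q. q \<noteq> 0 \<and> (\<forall>i. coeff q i \<in> generated_subring A) \<and> poly q a = 0")
    case True
    thus ?thesis using small_prime_separable_algebraic[OF insert.IH insert.hyps(1)] by blast
  next
    case False
    thus ?thesis using small_prime_separable_transcendental[OF insert.IH] by blast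
  qed
qed

section \<open>Reduction of a linear group modulo a prime\<close>

lemma residue_prod_cong:
  assumes p: "prime p" and "finite I" "\<And>i. i \<in> I \<Longrightarrow> f i \<in> Zloc p"
  shows "prod f I \<in> Zloc p \<and> [residue p (prod f I) = (\<Prod>i\<in>I. residue p (f i))] (mod int p)"
  using assms(2,3)
proof (induction I)
  case empty thus ?case by (simp add: Zloc_simps[OF p])
next
  case (insert i I)
  hence z: "f i \<in> Zloc p" "prod f I \<in> Zloc p" and c: "[residue p (prod f I) = (\<Prod>i\<in>I. residue p (f i))] (mod int p)" by auto
  have "[residue p (f i * prod f I) = residue p (f i) * residue p (prod f I)] (mod int p)"
    using residue_mult[OF p z] by (simp add: cong_def)
  moreover have "[residue p (f i) * residue p (prod f I) = residue p (f i) * (\<Prod>i\<in>I. residue p (f i))] (mod int p)"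
    using c by (intro cong_mult) auto
  ultimately have "[residue p (f i * prod f I) = residue p (f i) * (\<Prod>i\<in>I. residue p (f i))] (mod int p)"
    by (rule cong_trans)
  thus ?case using insert.hyps Zloc_mult[OF p z] by simp
qed

lemma residue_det_cong:
  assumes p: "prime p" and M: "M \<in> Zloc_mat p k"
  shows "[det (map_mat (residue p) M) = residue p (det M)] (mod int p)"
proof -
  have M': "M \<in> carrier_mat k k" using M by (rule Zloc_mat_carrier)
  let ?S = "{\<pi>. \<pi> permutes {0..<k}}"
  have bound: "\<pi> i < k" if "\<pi> \<in> ?S" "i \<in> {0..<k}" for \<pi> i
    using that by (auto simp: permutes_in_image[of \<pi> "{0..<k}", simplified])
  have pr: "(\<Prod>i = 0..<k. M $$ (i, \<pi> i)) \<in> Zloc p \<and>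
    [residue p (\<Prod>i = 0..<k. M $$ (i, \<pi> i)) = (\<Prod>i = 0..<k. residue p (M $$ (i, \<pi> i)))] (mod int p)" if "\<pi> \<in> ?S" for \<pi>
    using bound[OF that] by (intro residue_prod_cong[OF p]) (auto intro!: Zloc_matD[OF M])
  have s: "signof \<pi> \<in> Zloc p \<and> [residue p (signof \<pi>) = signof \<pi>] (mod int p)" for \<pi> :: "nat \<Rightarrow> nat"
    using Zloc_simps[OF p] residue_of_int[OF p, of "-1"] by (cases "evenperm \<pi>") (simp_all add: sign_def cong_def)
  have t: "signof \<pi> * (\<Prod>i = 0..<k. M $$ (i, \<pi> i)) \<in> Zloc p \<and>
    [residue p (signof \<pi> * (\<Prod>i = 0..<k. M $$ (i, \<pi> i))) = signof \<pi> * (\<Prod>i = 0..<k. residue p (M $$ (i, \<pi> i)))] (mod int p)"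
    if "\<pi> \<in> ?S" for \<pi>
  proof
    show "signof \<pi> * (\<Prod>i = 0..<k. M $$ (i, \<pi> i)) \<in> Zloc p" using Zloc_mult[OF p] s pr[OF that] by blast
    have "[residue p (signof \<pi> * (\<Prod>i = 0..<k. M $$ (i, \<pi> i))) = residue p (signof \<pi>) * residue p (\<Prod>i = 0..<k. M $$ (i, \<pi> i))] (mod int p)"
      using residue_mult[OF p conjunct1[OF s] conjunct1[OF pr[OF that]]] by (simp add: cong_def)
    moreover have "[residue p (signof \<pi>) * residue p (\<Prod>i = 0..<k. M $$ (i, \<pi> i)) = signof \<pi> * (\<Prod>i = 0..<k. residue p (M $$ (i, \<pi> i)))] (mod int p)"
      by (rule cong_mult[OF conjunct2[OF s] conjunct2[OF pr[OF that]]])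
    ultimately show "[residue p (signof \<pi> * (\<Prod>i = 0..<k. M $$ (i, \<pi> i))) = signof \<pi> * (\<Prod>i = 0..<k. residue p (M $$ (i, \<pi> i)))] (mod int p)"
      by (rule cong_trans)
  qed
  have "det (map_mat (residue p) M) = (\<Sum>\<pi>\<in>?S. signof \<pi> * (\<Prod>i = 0..<k. map_mat (residue p) M $$ (i, \<pi> i)))"
    by (rule det_def') (use M' in simp)
  also have "\<dots> = (\<Sum>\<pi>\<in>?S. signof \<pi> * (\<Prod>i = 0..<k. residue p (M $$ (i, \<pi> i))))"
  proof (rule sum.cong[OF refl])
    fix \<pi> assume "\<pi> \<in> ?S"
    hence "(\<Prod>i = 0..<k. map_mat (residue p) M $$ (i, \<pi> i)) = (\<Prod>i = 0..<k. residue p (M $$ (i, \<pi> i)))"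
      using M' bound by (intro prod.cong) auto
    thus "signof \<pi> * (\<Prod>i = 0..<k. map_mat (residue p) M $$ (i, \<pi> i)) = signof \<pi> * (\<Prod>i = 0..<k. residue p (M $$ (i, \<pi> i)))"
      by (rule arg_cong)
  qed
  finally have d: "det (map_mat (residue p) M) = (\<Sum>\<pi>\<in>?S. signof \<pi> * (\<Prod>i = 0..<k. residue p (M $$ (i, \<pi> i))))" .
  have "[(\<Sum>\<pi>\<in>?S. signof \<pi> * (\<Prod>i = 0..<k. residue p (M $$ (i, \<pi> i)))) =
      (\<Sum>\<pi>\<in>?S. residue p (signof \<pi> * (\<Prod>i = 0..<k. M $$ (i, \<pi> i))))] (mod int p)"
    by (rule cong_sum) (rule cong_sym[OF conjunct2[OF t]])
  moreover have "[(\<Sum>\<pi>\<in>?S. residue p (signof \<pi> * (\<Prod>i = 0..<k. M $$ (i, \<pi> i)))) = residue p (det M)] (mod int p)"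
  proof -
    have "residue p (\<Sum>\<pi>\<in>?S. signof \<pi> * (\<Prod>i = 0..<k. M $$ (i, \<pi> i)))
      = (\<Sum>\<pi>\<in>?S. residue p (signof \<pi> * (\<Prod>i = 0..<k. M $$ (i, \<pi> i)))) mod int p"
      by (rule residue_sum[OF p]) (use t finite_permutations[of "{0..<k}"] in blast)+
    thus ?thesis unfolding det_def'[OF M'] by (simp only: cong_def mod_mod_trivial)
  qed
  ultimately show ?thesis unfolding d by (rule cong_trans)
qed

lemma residue_mat_mult:
  assumes p: "prime p" and M: "M \<in> Zloc_mat p k" and N: "N \<in> Zloc_mat p k"
  shows "map_mat (\<lambda>x. x mod int p) (map_mat (residue p) M * map_mat (residue p) N) = map_mat (residue p) (M * N)"
proof (rule eq_matI)
  have c: "M \<in> carrier_mat k k" "N \<in> carrier_mat k k" using M N by (auto intro: Zloc_mat_carrier)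
  fix i j assume "i < dim_row (map_mat (residue p) (M * N))" "j < dim_col (map_mat (residue p) (M * N))"
  hence ij: "i < k" "j < k" using c by auto
  have z: "M $$ (i, s) \<in> Zloc p" "N $$ (s, j) \<in> Zloc p" if "s < k" for s
    using Zloc_matD[OF M ij(1) that] Zloc_matD[OF N that ij(2)] by auto
  have "(\<Sum>s = 0..<k. residue p (M $$ (i, s)) * residue p (N $$ (s, j))) mod int p
    = (\<Sum>s = 0..<k. (residue p (M $$ (i, s)) * residue p (N $$ (s, j))) mod int p) mod int p"
    by (rule mod_sum_eq[symmetric])
  also have "\<dots> = (\<Sum>s = 0..<k. residue p (M $$ (i, s) * N $$ (s, j))) mod int p"
    by (intro arg_cong[of _ _ "\<lambda>t. t mod int p"] sum.cong) (auto simp: residue_mult[OF p] z)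
  also have "\<dots> = residue p (\<Sum>s = 0..<k. M $$ (i, s) * N $$ (s, j))"
    by (rule residue_sum[OF p, symmetric]) (auto intro!: Zloc_mult[OF p] z)
  finally show "map_mat (\<lambda>x. x mod int p) (map_mat (residue p) M * map_mat (residue p) N) $$ (i, j) = map_mat (residue p) (M * N) $$ (i, j)"
    using ij c by (simp add: scalar_prod_def)
qed (use M N in \<open>auto dest: Zloc_mat_carrier\<close>)

lemma mat_trace_commute:
  fixes A B :: "'a::comm_semiring_0 mat"
  assumes "A \<in> carrier_mat n n" "B \<in> carrier_mat n n"
  shows "mat_trace (A * B) = mat_trace (B * A)"
proof -
  have "mat_trace (A * B) = (\<Sum>i<n. \<Sum>j<n. A $$ (i, j) * B $$ (j, i))"
    using assms by (simp add: mat_trace_def scalar_prod_def lessThan_atLeast0)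
  also have "\<dots> = (\<Sum>j<n. \<Sum>i<n. B $$ (j, i) * A $$ (i, j))"
    by (subst sum.swap) (simp add: mult.commute)
  also have "\<dots> = mat_trace (B * A)"
    using assms by (simp add: mat_trace_def scalar_prod_def lessThan_atLeast0)
  finally show ?thesis .
qed

context
  fixes G :: "('a, 'b) monoid_scheme" and \<rho> :: "'a \<Rightarrow> complex mat" and n :: nat
  assumes G: "group G" and \<rho>: "\<rho> \<in> hom G (SL n)"
begin

lemma SL_rep_carrier: "\<gamma> \<in> carrier G \<Longrightarrow> \<rho> \<gamma> \<in> carrier_mat n n"
  using hom_in_carrier[OF \<rho>] by (simp add: SL_def)

lemma SL_rep_mult: "\<gamma> \<in> carrier G \<Longrightarrow> \<eta> \<in> carrier G \<Longrightarrow> \<rho> (\<gamma> \<otimes>\<^bsub>G\<^esub> \<eta>) = \<rho> \<gamma> * \<rho> \<eta>"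
  using hom_mult[OF \<rho>] by (simp add: SL_def)

lemma SL_rep_one: "\<rho> \<one>\<^bsub>G\<^esub> = 1\<^sub>m n"
proof -
  interpret group G by (rule G)
  define E where "E = \<rho> \<one>\<^bsub>G\<^esub>"
  have E: "E \<in> carrier_mat n n" "det E = 1"
    using hom_in_carrier[OF \<rho> one_closed] by (auto simp: E_def SL_def)
  have EE: "E * E = E"
    unfolding E_def SL_rep_mult[OF one_closed one_closed, symmetric] l_one[OF one_closed] ..
  have s: "(1::complex) \<cdot>\<^sub>m 1\<^sub>m n = 1\<^sub>m n" by (rule eq_matI) auto
  have a: "adj_mat E * E = 1\<^sub>m n" using adj_mat(3)[OF E(1)] E(2) s by simp
  have "1\<^sub>m n * E = adj_mat E * (E * E)"
    unfolding a[symmetric] by (rule assoc_mult_mat[OF adj_mat(1)[OF E(1)] E(1) E(1)])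
  hence "E = 1\<^sub>m n" unfolding EE a left_mult_one_mat[OF E(1)] .
  thus ?thesis by (simp add: E_def)
qed

lemma mat_trace_conj_inv:
  assumes "\<gamma> \<in> carrier G" "\<delta> \<in> carrier G"
  shows "mat_trace (\<rho> (\<delta> \<otimes>\<^bsub>G\<^esub> \<gamma> \<otimes>\<^bsub>G\<^esub> inv\<^bsub>G\<^esub> \<delta>)) = mat_trace (\<rho> \<gamma>)"
proof -
  interpret group G by (rule G)
  have "mat_trace (\<rho> (\<delta> \<otimes>\<^bsub>G\<^esub> \<gamma> \<otimes>\<^bsub>G\<^esub> inv\<^bsub>G\<^esub> \<delta>)) = mat_trace (\<rho> (\<delta> \<otimes>\<^bsub>G\<^esub> \<gamma>) * \<rho> (inv\<^bsub>G\<^esub> \<delta>))"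
    using assms by (subst SL_rep_mult) auto
  also have "\<dots> = mat_trace (\<rho> (inv\<^bsub>G\<^esub> \<delta>) * \<rho> (\<delta> \<otimes>\<^bsub>G\<^esub> \<gamma>))"
    using assms by (intro mat_trace_commute[of _ n] SL_rep_carrier) auto
  also have "\<rho> (inv\<^bsub>G\<^esub> \<delta>) * \<rho> (\<delta> \<otimes>\<^bsub>G\<^esub> \<gamma>) = \<rho> \<gamma>"
  proof -
    have "inv\<^bsub>G\<^esub> \<delta> \<otimes>\<^bsub>G\<^esub> (\<delta> \<otimes>\<^bsub>G\<^esub> \<gamma>) = (inv\<^bsub>G\<^esub> \<delta> \<otimes>\<^bsub>G\<^esub> \<delta>) \<otimes>\<^bsub>G\<^esub> \<gamma>"
      by (rule m_assoc[symmetric]) (use assms in auto)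
    also have "\<dots> = \<gamma>" using assms by simp
    finally show ?thesis using SL_rep_mult[of "inv\<^bsub>G\<^esub> \<delta>" "\<delta> \<otimes>\<^bsub>G\<^esub> \<gamma>"] assms by simp
  qed
  finally show ?thesis .
qed

text \<open>Replacing the entries of \<open>\<rho> \<gamma>\<close> by blocks and reducing modulo \<open>p\<close> represents \<open>G\<close> over the field with
  \<open>p\<close> elements, and the direct sum with the contragredient representation lies in the special linear
  group.  The sum of the diagonal blocks of the image of \<open>\<gamma>\<close> is the
  residue of the image under \<open>\<phi>\<close> of the trace of \<open>\<rho> \<gamma>\<close>; as the trace is invariant under conjugation by elements of \<open>G\<close>,
  conjugacy within the image of \<open>G\<close> would make the image of the difference of the traces vanish
  modulo \<open>p\<close>.\<close>

lemma separation:
  assumes ent: "\<And>\<gamma>. \<gamma> \<in> carrier G \<Longrightarrow> mat_over R n (\<rho> \<gamma>)" and R: "is_subring R"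
    and p: "prime p" and k: "k \<ge> 1" and r: "local_rep p k R \<phi>"
    and \<gamma>: "\<gamma> \<in> carrier G" and \<eta>: "\<eta> \<in> carrier G"
    and u: "Zloc_unit_mat p k (\<phi> (mat_trace (\<rho> \<gamma>) - mat_trace (\<rho> \<eta>)))"
  shows "\<exists>\<Psi>\<in>hom G (SL_Fp (n * k + n * k) p).
    group ((SL_Fp (n * k + n * k) p)\<lparr>carrier := \<Psi> ` carrier G\<rparr>) \<and>
    \<not> conjugate_in ((SL_Fp (n * k + n * k) p)\<lparr>carrier := \<Psi> ` carrier G\<rparr>) (\<Psi> \<gamma>) (\<Psi> \<eta>)"
proof -
  interpret G: group G by (rule G)
  define N where "N = n * k"
  define \<Phi> where "\<Phi> \<gamma> = extend_rep n k \<phi> (\<rho> \<gamma>)" for \<gamma>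
  have \<Phi>_Z: "\<Phi> \<gamma> \<in> Zloc_mat p N" if "\<gamma> \<in> carrier G" for \<gamma>
    unfolding \<Phi>_def N_def by (rule extend_rep_Zloc_mat[OF r R k ent[OF that]])
  have \<Phi>_c: "\<Phi> \<gamma> \<in> carrier_mat N N" if "\<gamma> \<in> carrier G" for \<gamma> using \<Phi>_Z[OF that] by (rule Zloc_mat_carrier)
  have \<Phi>_mult: "\<Phi> (\<gamma> \<otimes>\<^bsub>G\<^esub> \<eta>) = \<Phi> \<gamma> * \<Phi> \<eta>" if "\<gamma> \<in> carrier G" "\<eta> \<in> carrier G" for \<gamma> \<eta>
    unfolding \<Phi>_def SL_rep_mult[OF that] by (rule extend_rep_mult[OF r R k ent[OF that(1)] ent[OF that(2)]])
  have \<Phi>_one: "\<Phi> \<one>\<^bsub>G\<^esub> = 1\<^sub>m N" unfolding \<Phi>_def SL_rep_one N_def by (rule extend_rep_one[OF r R k])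
  \<comment> \<open>adding the contragredient block makes the determinant \<open>1\<close>\<close>
  define \<Theta> where "\<Theta> \<gamma> = four_block_mat (\<Phi> \<gamma>) (0\<^sub>m N N) (0\<^sub>m N N) (transpose_mat (\<Phi> (inv\<^bsub>G\<^esub> \<gamma>)))" for \<gamma>
  have \<Theta>_c: "\<Theta> \<gamma> \<in> carrier_mat (N + N) (N + N)" if "\<gamma> \<in> carrier G" for \<gamma>
    unfolding \<Theta>_def using \<Phi>_c that by (intro four_block_carrier_mat) auto
  have \<Theta>_Z: "\<Theta> \<gamma> \<in> Zloc_mat p (N + N)" if g: "\<gamma> \<in> carrier G" for \<gamma>
  proof (rule Zloc_matI[OF \<Theta>_c[OF g]])
    fix i j assume ij: "i < N + N" "j < N + N"
    have i: "inv\<^bsub>G\<^esub> \<gamma> \<in> carrier G" using g by simp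
    show "\<Theta> \<gamma> $$ (i, j) \<in> Zloc p"
      using ij \<Phi>_c[OF g] \<Phi>_c[OF i] Zloc_matD[OF \<Phi>_Z[OF g], of i j] Zloc_matD[OF \<Phi>_Z[OF i], of "j - N" "i - N"]
      by (auto simp: \<Theta>_def Zloc_simps[OF p])
  qed
  have \<Theta>_mult: "\<Theta> (\<gamma> \<otimes>\<^bsub>G\<^esub> \<eta>) = \<Theta> \<gamma> * \<Theta> \<eta>" if g: "\<gamma> \<in> carrier G" "\<eta> \<in> carrier G" for \<gamma> \<eta>
  proof -
    have i: "inv\<^bsub>G\<^esub> \<gamma> \<in> carrier G" "inv\<^bsub>G\<^esub> \<eta> \<in> carrier G" using g by auto
    have t: "transpose_mat (\<Phi> (inv\<^bsub>G\<^esub> (\<gamma> \<otimes>\<^bsub>G\<^esub> \<eta>))) = transpose_mat (\<Phi> (inv\<^bsub>G\<^esub> \<gamma>)) * transpose_mat (\<Phi> (inv\<^bsub>G\<^esub> \<eta>))"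
      unfolding G.inv_mult_group[OF g] \<Phi>_mult[OF i(2,1)] by (rule transpose_mult[OF \<Phi>_c[OF i(2)] \<Phi>_c[OF i(1)]])
    note c = \<Phi>_c[OF g(1)] \<Phi>_c[OF g(2)] transpose_carrier_mat[THEN iffD2, OF \<Phi>_c[OF i(1)]] transpose_carrier_mat[THEN iffD2, OF \<Phi>_c[OF i(2)]]
    have "\<Theta> \<gamma> * \<Theta> \<eta> = four_block_mat (\<Phi> \<gamma> * \<Phi> \<eta>) (0\<^sub>m N N) (0\<^sub>m N N) (transpose_mat (\<Phi> (inv\<^bsub>G\<^esub> \<gamma>)) * transpose_mat (\<Phi> (inv\<^bsub>G\<^esub> \<eta>)))"
      unfolding \<Theta>_def
      by (subst mult_four_block_mat[OF c(1) zero_carrier_mat zero_carrier_mat c(3) c(2) zero_carrier_mat zero_carrier_mat c(4)])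
        (use c in auto)
    thus ?thesis unfolding \<Theta>_def t \<Phi>_mult[OF g] ..
  qed
  have \<Theta>_one: "\<Theta> \<one>\<^bsub>G\<^esub> = 1\<^sub>m (N + N)"
    unfolding \<Theta>_def by (simp add: \<Phi>_one)
  have \<Theta>_det: "det (\<Theta> \<gamma>) = 1" if g: "\<gamma> \<in> carrier G" for \<gamma>
  proof -
    have i: "inv\<^bsub>G\<^esub> \<gamma> \<in> carrier G" using g by simp
    have "det (\<Theta> \<gamma>) = det (\<Phi> \<gamma>) * det (transpose_mat (\<Phi> (inv\<^bsub>G\<^esub> \<gamma>)))"
      unfolding \<Theta>_def using \<Phi>_c[OF g] \<Phi>_c[OF i] by (intro det_four_block_mat_upper_right_zero[of _ N _ N]) auto
    also have "\<dots> = det (\<Phi> \<gamma> * \<Phi> (inv\<^bsub>G\<^esub> \<gamma>))"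
      unfolding det_transpose[OF \<Phi>_c[OF i]] det_mult[OF \<Phi>_c[OF g] \<Phi>_c[OF i]] ..
    also have "\<dots> = 1" unfolding \<Phi>_mult[OF g i, symmetric] using g by (simp add: \<Phi>_one)
    finally show ?thesis .
  qed
  let ?S = "SL_Fp (N + N) p"
  define \<Psi> where "\<Psi> \<gamma> = map_mat (residue p) (\<Theta> \<gamma>)" for \<gamma>
  have \<Psi>_mult: "\<Psi> (\<gamma> \<otimes>\<^bsub>G\<^esub> \<eta>) = \<Psi> \<gamma> \<otimes>\<^bsub>?S\<^esub> \<Psi> \<eta>" if g: "\<gamma> \<in> carrier G" "\<eta> \<in> carrier G" for \<gamma> \<eta>
    unfolding \<Psi>_def \<Theta>_mult[OF g] by (simp add: SL_Fp_def residue_mat_mult[OF p \<Theta>_Z[OF g(1)] \<Theta>_Z[OF g(2)]])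
  have \<Psi>_one: "\<Psi> \<one>\<^bsub>G\<^esub> = \<one>\<^bsub>?S\<^esub>"
    unfolding \<Psi>_def \<Theta>_one by (rule eq_matI) (auto simp: SL_Fp_def Zloc_simps[OF p])
  have hom: "\<Psi> \<in> hom G ?S"
  proof (rule homI)
    fix \<gamma> assume g: "\<gamma> \<in> carrier G"
    have "elements_mat (\<Psi> \<gamma>) \<subseteq> carrier (residue_ring (int p))"
    proof
      fix x assume "x \<in> elements_mat (\<Psi> \<gamma>)"
      then obtain i j where "i < dim_row (\<Psi> \<gamma>)" "j < dim_col (\<Psi> \<gamma>)" "x = \<Psi> \<gamma> $$ (i, j)"
        using elements_matD by blast
      moreover from this have "i < N + N" "j < N + N" using \<Theta>_c[OF g] by (auto simp: \<Psi>_def)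
      ultimately have "x = residue p (\<Theta> \<gamma> $$ (i, j))" "\<Theta> \<gamma> $$ (i, j) \<in> Zloc p"
        using Zloc_matD[OF \<Theta>_Z[OF g]] \<Theta>_c[OF g] by (auto simp: \<Psi>_def)
      thus "x \<in> carrier (residue_ring (int p))" using residue_range[OF p] by (simp add: residue_ring_def)
    qed
    moreover have "[det (\<Psi> \<gamma>) = 1] (mod int p)"
      using residue_det_cong[OF p \<Theta>_Z[OF g]] unfolding \<Theta>_det[OF g] \<Psi>_def Zloc_simps(6)[OF p] .
    moreover have "\<Psi> \<gamma> \<in> carrier_mat (N + N) (N + N)" using \<Theta>_c[OF g] by (simp add: \<Psi>_def)
    ultimately show "\<Psi> \<gamma> \<in> carrier ?S" by (simp add: SL_Fp_def)
  qed (rule \<Psi>_mult)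
  let ?H = "?S\<lparr>carrier := \<Psi> ` carrier G\<rparr>"
  have H: "group ?H"
  proof -
    have "group (?S\<lparr>carrier := \<Psi> ` carrier G, one := \<Psi> \<one>\<^bsub>G\<^esub>\<rparr>)" by (rule G.hom_imp_img_group[OF hom])
    moreover have "?S\<lparr>carrier := \<Psi> ` carrier G, one := \<one>\<^bsub>?S\<^esub>\<rparr> = ?H" by simp
    ultimately show ?thesis unfolding \<Psi>_one by metis
  qed
  have "\<not> conjugate_in ?H (\<Psi> \<gamma>) (\<Psi> \<eta>)"
  proof
    assume "conjugate_in ?H (\<Psi> \<gamma>) (\<Psi> \<eta>)"
    then obtain \<delta> where \<delta>: "\<delta> \<in> carrier G" and e: "\<Psi> \<eta> = \<Psi> \<delta> \<otimes>\<^bsub>?S\<^esub> \<Psi> \<gamma> \<otimes>\<^bsub>?S\<^esub> inv\<^bsub>?H\<^esub> (\<Psi> \<delta>)"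
      by (auto simp: conjugate_in_def)
    have "inv\<^bsub>?H\<^esub> (\<Psi> \<delta>) = \<Psi> (inv\<^bsub>G\<^esub> \<delta>)"
    proof (rule group.inv_equality[OF H])
      show "\<Psi> (inv\<^bsub>G\<^esub> \<delta>) \<otimes>\<^bsub>?H\<^esub> \<Psi> \<delta> = \<one>\<^bsub>?H\<^esub>"
        using \<delta> \<Psi>_mult[of "inv\<^bsub>G\<^esub> \<delta>" \<delta>] \<Psi>_one by simp
    qed (use \<delta> in auto)
    \<comment> \<open>the conjugating element comes from \<open>G\<close>, so \<open>\<eta>\<close> has the image of a conjugate \<open>\<xi>\<close> of \<open>\<gamma>\<close>\<close>
    define \<xi> where "\<xi> = \<delta> \<otimes>\<^bsub>G\<^esub> \<gamma> \<otimes>\<^bsub>G\<^esub> inv\<^bsub>G\<^esub> \<delta>"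
    have \<xi>: "\<xi> \<in> carrier G" using \<delta> \<gamma> by (simp add: \<xi>_def)
    have "\<Psi> \<eta> = \<Psi> \<xi>"
      unfolding e \<open>inv\<^bsub>?H\<^esub> (\<Psi> \<delta>) = \<Psi> (inv\<^bsub>G\<^esub> \<delta>)\<close> \<xi>_def using \<delta> \<gamma> by (simp add: \<Psi>_mult)
    have same: "residue p (\<Phi> \<eta> $$ (i, j)) = residue p (\<Phi> \<xi> $$ (i, j))" if ij: "i < N" "j < N" for i j
    proof -
      have "\<Psi> x $$ (i, j) = residue p (\<Phi> x $$ (i, j))" if "x \<in> carrier G" for x
        using ij \<Phi>_c[OF that] \<Phi>_c[of "inv\<^bsub>G\<^esub> x"] that by (simp add: \<Psi>_def \<Theta>_def)
      thus ?thesis using \<open>\<Psi> \<eta> = \<Psi> \<xi>\<close> \<eta> \<xi> by metis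
    qed
    have entR: "\<rho> x $$ (i, i) \<in> R" if "x \<in> carrier G" "i < n" for x i
      using ent[OF that(1)] that(2) by (auto simp: mat_over_def)
    have trR: "mat_trace (\<rho> x) \<in> R" if "x \<in> carrier G" for x
      using SL_rep_carrier[OF that] entR[OF that] by (auto simp: mat_trace_def intro!: subring_sum[OF R])
    have tr: "\<phi> (mat_trace (\<rho> x)) $$ (a, b) = (\<Sum>i<n. \<Phi> x $$ (i * k + a, i * k + b))"
      if x: "x \<in> carrier G" and ab: "a < k" "b < k" for x a b
    proof -
      have "\<phi> (mat_trace (\<rho> x)) $$ (a, b) = (\<Sum>i<n. \<phi> (\<rho> x $$ (i, i)) $$ (a, b))"
        unfolding mat_trace_def using SL_rep_carrier[OF x] entR[OF x]
        by (subst local_rep_sum_index[OF r R _ _ ab]) auto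
      thus ?thesis unfolding \<Phi>_def extend_rep_def using ab by (simp add: block_mat_index)
    qed
    have \<Phi>_loc: "\<Phi> x $$ (i * k + a, i * k + b) \<in> Zloc p" if "x \<in> carrier G" "i < n" "a < k" "b < k" for x i a b
      using that by (intro Zloc_matD[OF \<Phi>_Z]) (auto simp: N_def block_index_less)
    have redtr: "residue p (\<phi> (mat_trace (\<rho> \<eta>)) $$ (a, b)) = residue p (\<phi> (mat_trace (\<rho> \<xi>)) $$ (a, b))"
      if ab: "a < k" "b < k" for a b
    proof -
      have "residue p (\<Sum>i<n. \<Phi> x $$ (i * k + a, i * k + b)) = (\<Sum>i<n. residue p (\<Phi> x $$ (i * k + a, i * k + b))) mod int p"
        if "x \<in> carrier G" for x
        using that ab by (intro residue_sum[OF p]) (auto intro: \<Phi>_loc)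
      moreover have "(\<Sum>i<n. residue p (\<Phi> \<eta> $$ (i * k + a, i * k + b))) = (\<Sum>i<n. residue p (\<Phi> \<xi> $$ (i * k + a, i * k + b)))"
        using ab by (intro sum.cong refl same) (auto simp: N_def block_index_less)
      ultimately show ?thesis using tr[OF \<eta> ab] tr[OF \<xi> ab] \<eta> \<xi> by simp
    qed
    define z where "z = mat_trace (\<rho> \<gamma>) - mat_trace (\<rho> \<eta>)"
    have z: "z = mat_trace (\<rho> \<xi>) - mat_trace (\<rho> \<eta>)"
      unfolding z_def \<xi>_def mat_trace_conj_inv[OF \<gamma> \<delta>] ..
    have zR: "z \<in> R" unfolding z_def by (rule is_subringD(6)[OF R trR[OF \<gamma>] trR[OF \<eta>]])
    \<comment> \<open>hence \<open>\<phi> z\<close> vanishes modulo \<open>p\<close>, although it is invertible\<close>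
    have rz: "residue p (\<phi> z $$ (a, b)) = 0" if ab: "a < k" "b < k" for a b
    proof -
      let ?x = "\<phi> (mat_trace (\<rho> \<xi>)) $$ (a, b)" and ?y = "\<phi> (mat_trace (\<rho> \<eta>)) $$ (a, b)"
      have xy: "?x \<in> Zloc p" "?y \<in> Zloc p"
        using Zloc_matD[OF local_repD(2)[OF r trR] ab] \<xi> \<eta> by auto
      have d: "\<phi> z $$ (a, b) = ?x - ?y" unfolding z by (rule local_rep_diff_index[OF r R trR[OF \<xi>] trR[OF \<eta>] ab])
      have "residue p ?x = (residue p (?x - ?y) + residue p ?y) mod int p"
        using residue_add[OF p Zloc_diff[OF p xy] xy(2)] by simp
      hence "residue p ?x mod int p = (residue p (?x - ?y) + residue p ?y) mod int p" by (metis mod_mod_trivial)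
      hence "[residue p (?x - ?y) + residue p ?y = 0 + residue p ?y] (mod int p)" unfolding redtr[OF ab] cong_def by simp
      hence "[residue p (?x - ?y) = 0] (mod int p)" by (simp only: cong_add_rcancel)
      moreover have "residue p (?x - ?y) \<in> {0..<int p}" by (rule residue_range[OF p Zloc_diff[OF p xy]])
      ultimately show ?thesis unfolding d by (auto simp: cong_def)
    qed
    from u obtain L where L: "L \<in> Zloc_mat p k" "\<phi> z * L = 1\<^sub>m k"
      unfolding Zloc_unit_mat_def z_def[symmetric] by (elim bexE conjE)
    have zc: "\<phi> z \<in> Zloc_mat p k" by (rule local_repD(2)[OF r zR])
    have k0: "0 < k" using k by simp
    have t: "\<phi> z $$ (0, s) \<in> Zloc p" "L $$ (s, 0) \<in> Zloc p" if "s < k" for s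
      using Zloc_matD[OF zc k0 that] Zloc_matD[OF L(1) that k0] by auto
    have "(\<phi> z * L) $$ (0, 0) = (\<Sum>s<k. \<phi> z $$ (0, s) * L $$ (s, 0))"
      using k0 Zloc_mat_carrier[OF zc] Zloc_mat_carrier[OF L(1)] by (auto simp: scalar_prod_def lessThan_atLeast0)
    hence "(\<Sum>s<k. \<phi> z $$ (0, s) * L $$ (s, 0)) = 1" using k0 L(2) by simp
    hence "1 = residue p (\<Sum>s<k. \<phi> z $$ (0, s) * L $$ (s, 0))" using Zloc_simps(6)[OF p] by simp
    also have "\<dots> = (\<Sum>s<k. residue p (\<phi> z $$ (0, s) * L $$ (s, 0))) mod int p"
      by (rule residue_sum[OF p]) (auto intro!: Zloc_mult[OF p] t)
    also have "(\<Sum>s<k. residue p (\<phi> z $$ (0, s) * L $$ (s, 0))) = 0"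
      by (rule sum.neutral) (auto simp: residue_mult[OF p] t rz k0)
    finally show False by simp
  qed
  thus ?thesis using hom H unfolding N_def by blast
qed

end

lemma card_SL_Fp_le:
  assumes "prime p"
  shows "finite (carrier (SL_Fp M p)) \<and> card (carrier (SL_Fp M p)) \<le> p ^ (M * M)"
proof -
  let ?F = "PiE ({..<M} \<times> {..<M}) (\<lambda>_. {0..<int p})"
  have fin: "finite ?F" by (intro finite_PiE) auto
  have sub: "carrier (SL_Fp M p) \<subseteq> mat M M ` ?F"
  proof
    fix A assume "A \<in> carrier (SL_Fp M p)"
    hence A: "A \<in> carrier_mat M M" "elements_mat A \<subseteq> {0..<int p}" by (auto simp: SL_Fp_def residue_ring_def)
    have "A = mat M M (restrict (\<lambda>x. A $$ x) ({..<M} \<times> {..<M}))" using A(1) by (intro eq_matI) auto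
    moreover have "A $$ (i, j) \<in> {0..<int p}" if "i < M" "j < M" for i j
      using A(2) elements_matI[OF A(1) that refl] by blast
    hence "restrict (\<lambda>x. A $$ x) ({..<M} \<times> {..<M}) \<in> ?F" by (intro restrict_PiE_iff[THEN iffD2]) auto
    ultimately show "A \<in> mat M M ` ?F" by blast
  qed
  have "card (carrier (SL_Fp M p)) \<le> card ?F" using surj_card_le[OF fin sub] .
  also have "\<dots> = p ^ (M * M)" by (simp add: card_PiE)
  finally show ?thesis using finite_subset[OF sub] fin by blast
qed

lemma CD_le:
  fixes H :: "('c, 'd) monoid_scheme"
  assumes G: "group G" and H: "group H" and fin: "finite (carrier H)" and \<phi>: "\<phi> \<in> hom G H"
    and c: "\<gamma> \<in> c" "\<eta> \<in> d" and sub: "c \<subseteq> carrier G" "d \<subseteq> carrier G"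
    and nc: "\<not> conjugate_in H (\<phi> \<gamma>) (\<phi> \<eta>)"
  shows "CD G c d \<le> enat (order H)"
proof -
  interpret H: group H by (rule H)
  \<comment> \<open>transport the structure of \<open>H\<close> to its image under an injection into the natural numbers\<close>
  obtain f :: "'c \<Rightarrow> nat" where f: "inj_on f (carrier H)" using finite_imp_inj_to_nat_seg[OF fin] by blast
  define g where "g = the_inv_into (carrier H) f"
  have gf: "g (f x) = x" if "x \<in> carrier H" for x unfolding g_def using f that by (rule the_inv_into_f_f)
  define Q :: "nat monoid" where
    "Q = \<lparr>carrier = f ` carrier H, monoid.mult = (\<lambda>x y. f (g x \<otimes>\<^bsub>H\<^esub> g y)), one = f \<one>\<^bsub>H\<^esub>\<rparr>"
  have cQ: "carrier Q = f ` carrier H" by (simp add: Q_def)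
  have fh: "f \<in> hom H Q" by (rule homI) (auto simp: Q_def gf)
  have "group (Q\<lparr>carrier := f ` carrier H, one := f \<one>\<^bsub>H\<^esub>\<rparr>)" by (rule H.hom_imp_img_group[OF fh])
  hence Q: "group Q" by (simp add: Q_def)
  interpret Q: group Q by (rule Q)
  interpret f: group_hom H Q f by (unfold_locales) (rule fh)
  have hom: "f \<circ> \<phi> \<in> hom G Q" using hom_compose[OF \<phi> fh] .
  have \<phi>c: "\<phi> \<gamma> \<in> carrier H" "\<phi> \<eta> \<in> carrier H" using hom_in_carrier[OF \<phi>] c sub by auto
  have "\<not> conjugate_in Q ((f \<circ> \<phi>) \<gamma>) ((f \<circ> \<phi>) \<eta>)"
  proof
    assume "conjugate_in Q ((f \<circ> \<phi>) \<gamma>) ((f \<circ> \<phi>) \<eta>)"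
    then obtain q where q: "q \<in> carrier Q" "f (\<phi> \<eta>) = q \<otimes>\<^bsub>Q\<^esub> f (\<phi> \<gamma>) \<otimes>\<^bsub>Q\<^esub> inv\<^bsub>Q\<^esub> q"
      by (auto simp: conjugate_in_def)
    obtain h where h: "h \<in> carrier H" "q = f h" using q(1) unfolding cQ by blast
    have "f (h \<otimes>\<^bsub>H\<^esub> \<phi> \<gamma> \<otimes>\<^bsub>H\<^esub> inv\<^bsub>H\<^esub> h) = f h \<otimes>\<^bsub>Q\<^esub> f (\<phi> \<gamma>) \<otimes>\<^bsub>Q\<^esub> inv\<^bsub>Q\<^esub> (f h)"
      using h(1) \<phi>c by simp
    hence "f (\<phi> \<eta>) = f (h \<otimes>\<^bsub>H\<^esub> \<phi> \<gamma> \<otimes>\<^bsub>H\<^esub> inv\<^bsub>H\<^esub> h)"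
      unfolding q(2) h(2) by (rule sym)
    hence "\<phi> \<eta> = h \<otimes>\<^bsub>H\<^esub> \<phi> \<gamma> \<otimes>\<^bsub>H\<^esub> inv\<^bsub>H\<^esub> h"
      by (rule inj_onD[OF f]) (use h \<phi>c in auto)
    thus False using nc h(1) unfolding conjugate_in_def by blast
  qed
  moreover have "finite (carrier Q)" using fin by (simp add: cQ)
  moreover have "order Q = order H" using f by (simp add: order_def cQ card_image)
  ultimately have "enat (order H) \<in> {enat (order Q) | Q :: nat monoid.
     group Q \<and> finite (carrier Q) \<and>
     (\<exists>\<phi>\<in>hom G Q. \<exists>\<gamma>\<in>c. \<exists>\<eta>\<in>d. \<not> conjugate_in Q (\<phi> \<gamma>) (\<phi> \<eta>))}"
    using Q hom c
    by (intro CollectI exI[of _ Q] conjI bexI[of _ "f \<circ> \<phi>"] bexI[of _ \<gamma>] bexI[of _ \<eta>]) simp_all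
  thus ?thesis unfolding CD_def by (rule Inf_lower)
qed

section \<open>Finite quotients and word length\<close>

lemma foldr_mult_append:
  assumes "group G" "set ws \<subseteq> carrier G" "set vs \<subseteq> carrier G"
  shows "foldr (\<otimes>\<^bsub>G\<^esub>) ws \<one>\<^bsub>G\<^esub> \<in> carrier G \<and>
    foldr (\<otimes>\<^bsub>G\<^esub>) (ws @ vs) \<one>\<^bsub>G\<^esub> = foldr (\<otimes>\<^bsub>G\<^esub>) ws \<one>\<^bsub>G\<^esub> \<otimes>\<^bsub>G\<^esub> foldr (\<otimes>\<^bsub>G\<^esub>) vs \<one>\<^bsub>G\<^esub>"
proof -
  interpret group G by (rule assms(1))
  have c: "foldr (\<otimes>\<^bsub>G\<^esub>) vs \<one>\<^bsub>G\<^esub> \<in> carrier G" if "set vs \<subseteq> carrier G" for vs using that by (induction vs) auto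
  show ?thesis using assms(2) c[OF assms(3)] by (induction ws) (auto simp: c m_assoc)
qed

lemma word_exists:
  fixes G (structure)
  assumes G: "group G" and X: "finite_generating_set G X" and \<gamma>: "\<gamma> \<in> carrier G"
  shows "\<exists>ws. length ws = word_length G X \<gamma> \<and> set ws \<subseteq> X \<union> m_inv G ` X \<and> foldr (\<otimes>\<^bsub>G\<^esub>) ws \<one>\<^bsub>G\<^esub> = \<gamma>"
proof -
  interpret group G by (rule G)
  have Xc: "X \<union> m_inv G ` X \<subseteq> carrier G" using X by (auto simp: finite_generating_set_def)
  have "\<gamma> \<in> generate G X" using X \<gamma> by (simp add: finite_generating_set_def)
  hence "\<exists>ws. set ws \<subseteq> X \<union> m_inv G ` X \<and> foldr (\<otimes>\<^bsub>G\<^esub>) ws \<one>\<^bsub>G\<^esub> = \<gamma>"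
  proof induction
    case one show ?case by (rule exI[of _ "[]"]) simp
  next
    case (incl h)
    hence "h \<in> carrier G" using Xc by auto
    thus ?case using incl by (intro exI[of _ "[h]"]) auto
  next
    case (inv h)
    hence "inv h \<in> carrier G" using Xc by auto
    thus ?case using inv by (intro exI[of _ "[inv h]"]) auto
  next
    case (eng a b)
    then obtain v w where "set v \<subseteq> X \<union> m_inv G ` X" "foldr (\<otimes>\<^bsub>G\<^esub>) v \<one>\<^bsub>G\<^esub> = a"
      "set w \<subseteq> X \<union> m_inv G ` X" "foldr (\<otimes>\<^bsub>G\<^esub>) w \<one>\<^bsub>G\<^esub> = b" by blast
    moreover from this have "set v \<subseteq> carrier G" "set w \<subseteq> carrier G" using Xc by auto
    ultimately show ?case using foldr_mult_append[OF G, of v w] by (intro exI[of _ "v @ w"]) auto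
  qed
  hence "\<exists>k ws. length ws = k \<and> set ws \<subseteq> X \<union> m_inv G ` X \<and> foldr (\<otimes>\<^bsub>G\<^esub>) ws \<one>\<^bsub>G\<^esub> = \<gamma>" by blast
  thus ?thesis unfolding word_length_def by (rule LeastI_ex)
qed

lemma conj_class_eq:
  fixes G (structure)
  assumes G: "group G" and x: "x \<in> carrier G" and xy': "conjugate_in G x y"
  shows "conj_class G x = conj_class G y"
proof -
  interpret group G by (rule G)
  from xy' obtain g where g: "g \<in> carrier G" "y = g \<otimes> x \<otimes> inv g" by (auto simp: conjugate_in_def)
  have yc: "y \<in> carrier G" using g x by simp
  have xy: "x = inv g \<otimes> y \<otimes> g" unfolding g(2) using g(1) x by (simp add: m_assoc) (simp add: m_assoc[symmetric])
  have "conjugate_in G x z \<longleftrightarrow> conjugate_in G y z" for z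
  proof
    assume "conjugate_in G x z"
    then obtain h where h: "h \<in> carrier G" "z = h \<otimes> x \<otimes> inv h" by (auto simp: conjugate_in_def)
    have "z = (h \<otimes> inv g) \<otimes> y \<otimes> inv (h \<otimes> inv g)"
      unfolding h(2) xy using h(1) g(1) yc by (simp add: m_assoc inv_mult_group)
    thus "conjugate_in G y z" using h(1) g(1) by (auto simp: conjugate_in_def)
  next
    assume "conjugate_in G y z"
    then obtain h where h: "h \<in> carrier G" "z = h \<otimes> y \<otimes> inv h" by (auto simp: conjugate_in_def)
    have "z = (h \<otimes> g) \<otimes> x \<otimes> inv (h \<otimes> g)"
      unfolding h(2) g(2) using h(1) g(1) x by (simp add: m_assoc inv_mult_group)
    thus "conjugate_in G x z" using h(1) g(1) by (auto simp: conjugate_in_def)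
  qed
  thus ?thesis unfolding conj_class_def by simp
qed

lemma class_ball_representative:
  fixes G (structure)
  assumes G: "group G" and c: "c \<in> class_ball G X N"
  obtains \<gamma> where "\<gamma> \<in> c" "\<gamma> \<in> carrier G" "c = conj_class G \<gamma>" "word_length G X \<gamma> \<le> N"
proof -
  interpret group G by (rule G)
  from c obtain x where x: "x \<in> carrier G" "c = conj_class G x" and l: "class_length G X c \<le> N"
    by (auto simp: class_ball_def conj_classes_def)
  have "x \<in> c" using x by (auto simp: conj_class_def conjugate_in_def intro!: bexI[of _ "\<one>"])
  hence "\<exists>k. k \<in> word_length G X ` c" by blast
  hence "class_length G X c \<in> word_length G X ` c" unfolding class_length_def by (rule LeastI_ex)
  then obtain y where y: "y \<in> c" "word_length G X y = class_length G X c" by auto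
  have yc: "y \<in> carrier G" using y(1) unfolding x(2) conj_class_def by simp
  have "c = conj_class G y" unfolding x(2) using y(1) by (intro conj_class_eq[OF G x(1)]) (simp add: x(2) conj_class_def)
  thus ?thesis using that[of y] y yc l by simp
qed

text \<open>Each further letter costs at most \<open>L\<close> for its entries and \<open>n\<close> for the summation in the matrix
  product.\<close>

lemma word_entries:
  assumes G: "group G" and \<rho>: "\<rho> \<in> hom G (SL n)" and Y: "Y \<subseteq> carrier G"
    and L: "\<And>x i j. x \<in> Y \<Longrightarrow> i < n \<Longrightarrow> j < n \<Longrightarrow> cost_le A L (\<rho> x $$ (i, j))"
    and ws: "set ws \<subseteq> Y" and ij: "i < n" "j < n"
  shows "cost_le A (1 + length ws * (L + n)) (\<rho> (foldr (\<otimes>\<^bsub>G\<^esub>) ws \<one>\<^bsub>G\<^esub>) $$ (i, j))"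
  using ws ij
proof (induction ws arbitrary: i j)
  case Nil
  thus ?case using cost_le.one[of A] cost_le.zero[of A] by (simp add: SL_rep_one[OF G \<rho>])
next
  case (Cons x ws)
  let ?w = "foldr (\<otimes>\<^bsub>G\<^esub>) ws \<one>\<^bsub>G\<^esub>"
  have x: "x \<in> Y" "x \<in> carrier G" using Cons.prems Y by auto
  have w: "?w \<in> carrier G" using foldr_mult_append[OF G, of ws "[]"] Cons.prems Y by auto
  have c: "\<rho> x \<in> carrier_mat n n" "\<rho> ?w \<in> carrier_mat n n"
    by (rule SL_rep_carrier[OF G \<rho> x(2)], rule SL_rep_carrier[OF G \<rho> w])
  have "\<rho> (foldr (\<otimes>\<^bsub>G\<^esub>) (x # ws) \<one>\<^bsub>G\<^esub>) = \<rho> x * \<rho> ?w"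
    using SL_rep_mult[OF G \<rho> x(2) w] by simp
  hence e: "\<rho> (foldr (\<otimes>\<^bsub>G\<^esub>) (x # ws) \<one>\<^bsub>G\<^esub>) $$ (i, j) = (\<Sum>l<n. \<rho> x $$ (i, l) * \<rho> ?w $$ (l, j))"
    using c Cons.prems by (simp add: scalar_prod_def lessThan_atLeast0)
  have "cost_le A ((L + (1 + length ws * (L + n))) + card {..<n}) (\<Sum>l<n. \<rho> x $$ (i, l) * \<rho> ?w $$ (l, j))"
    using Cons x L by (intro cost_le_sum cost_le.mult) auto
  thus ?case unfolding e by (rule cost_le_mono) (simp add: algebra_simps)
qed

section \<open>Polynomial bound and separating quotients\<close>

theorem theorem1p4:
  fixes G :: "('a, 'b) monoid_scheme"
  assumes "group G"
    and "infinite (carrier G)"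
    and "\<exists>X. finite_generating_set G X"
    and "property_A G"
  shows "(\<exists>d\<ge>1. \<forall>X. finite_generating_set G X \<longrightarrow> Conj G X \<preceq>\<^sub>g (\<lambda>n. enat (n ^ d))) \<and>
    (\<exists>n\<^sub>0\<ge>1. \<forall>\<gamma>\<in>carrier G. \<forall>\<eta>\<in>carrier G. \<not> conjugate_in G \<gamma> \<eta> \<longrightarrow>
      (\<exists>p. prime p \<and>
        (\<exists>\<phi>\<in>hom G (SL_Fp n\<^sub>0 p).
          \<not> conjugate_in ((SL_Fp n\<^sub>0 p)\<lparr>carrier := \<phi> ` carrier G\<rparr>) (\<phi> \<gamma>) (\<phi> \<eta>))))"
proof -
  note G = assms(1)
  interpret group G by (rule G)
  from assms(4) obtain n \<rho> where n: "n \<ge> 1" and \<rho>: "\<rho> \<in> hom G (SL n :: complex mat monoid)"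
    and sep: "\<And>\<gamma> \<eta>. \<gamma> \<in> carrier G \<Longrightarrow> \<eta> \<in> carrier G \<Longrightarrow> \<not> conjugate_in G \<gamma> \<eta> \<Longrightarrow> mat_trace (\<rho> \<gamma>) \<noteq> mat_trace (\<rho> \<eta>)"
    unfolding property_A_def by blast
  from assms(3) obtain X\<^sub>0 where X\<^sub>0: "finite_generating_set G X\<^sub>0" by blast
  define A where "A = (\<lambda>(x, i, j). \<rho> x $$ (i, j)) ` ((X\<^sub>0 \<union> m_inv G ` X\<^sub>0) \<times> {..<n} \<times> {..<n})"
  have gens: "X \<union> m_inv G ` X \<subseteq> carrier G" if "finite_generating_set G X" for X
    using that by (auto simp: finite_generating_set_def)
  have "finite A" using X\<^sub>0 by (auto simp: A_def finite_generating_set_def)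
  hence "small_prime_separable A" by (rule small_prime_separable_finite)
  then obtain k C e where k: "k \<ge> 1" "C \<ge> 1" and separate: "\<And>m z. cost_le A m z \<Longrightarrow> z \<noteq> 0 \<Longrightarrow>
     \<exists>p \<phi>. prime p \<and> m < p \<and> p \<le> C * m ^ e \<and> local_rep p k (generated_subring A) \<phi> \<and> Zloc_unit_mat p k (\<phi> z)"
    unfolding small_prime_separable_def by blast
  have entries: "\<exists>m. \<forall>i<n. \<forall>j<n. cost_le A m (\<rho> \<gamma> $$ (i, j))" if g: "\<gamma> \<in> carrier G" for \<gamma>
  proof -
    obtain ws where ws: "set ws \<subseteq> X\<^sub>0 \<union> m_inv G ` X\<^sub>0" "foldr (\<otimes>\<^bsub>G\<^esub>) ws \<one>\<^bsub>G\<^esub> = \<gamma>"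
      using word_exists[OF G X\<^sub>0 g] by blast
    have "cost_le A 1 (\<rho> x $$ (i, j))" if "x \<in> X\<^sub>0 \<union> m_inv G ` X\<^sub>0" "i < n" "j < n" for x i j
      by (rule cost_le.gen) (use that in \<open>force simp: A_def\<close>)
    from word_entries[OF G \<rho> gens[OF X\<^sub>0] this ws(1)] show ?thesis unfolding ws(2) by blast
  qed
  have ent: "mat_over (generated_subring A) n (\<rho> \<gamma>)" if g: "\<gamma> \<in> carrier G" for \<gamma>
    using entries[OF g] SL_rep_carrier[OF G \<rho> g] unfolding mat_over_def generated_subring_def by blast
  have trace_cost: "cost_le A (m + n) (mat_trace (\<rho> \<gamma>))"
    if "\<gamma> \<in> carrier G" "m \<ge> 1" "\<And>i j. i < n \<Longrightarrow> j < n \<Longrightarrow> cost_le A m (\<rho> \<gamma> $$ (i, j))" for \<gamma> m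
    using cost_le_sum[of "{..<n}" A m "\<lambda>i. \<rho> \<gamma> $$ (i, i)"] that SL_rep_carrier[OF G \<rho> that(1)]
    by (simp add: mat_trace_def)
  define M where "M = n * k + n * k"
  have M: "M \<ge> 1" using n k by (simp add: M_def Suc_le_eq)
  have key: "\<exists>p. prime p \<and> p \<le> C * m ^ e \<and> (\<exists>\<Psi>\<in>hom G (SL_Fp M p).
      group ((SL_Fp M p)\<lparr>carrier := \<Psi> ` carrier G\<rparr>) \<and>
      \<not> conjugate_in ((SL_Fp M p)\<lparr>carrier := \<Psi> ` carrier G\<rparr>) (\<Psi> \<gamma>) (\<Psi> \<eta>))"
    if g: "\<gamma> \<in> carrier G" "\<eta> \<in> carrier G" "\<not> conjugate_in G \<gamma> \<eta>"
      and z: "cost_le A m (mat_trace (\<rho> \<gamma>) - mat_trace (\<rho> \<eta>))" for \<gamma> \<eta> m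
  proof -
    have "mat_trace (\<rho> \<gamma>) - mat_trace (\<rho> \<eta>) \<noteq> 0" using sep[OF g] by simp
    from separate[OF z this] obtain p \<phi> where p: "prime p" "p \<le> C * m ^ e" and r: "local_rep p k (generated_subring A) \<phi>"
      and u: "Zloc_unit_mat p k (\<phi> (mat_trace (\<rho> \<gamma>) - mat_trace (\<rho> \<eta>)))" by blast
    show ?thesis
      using separation[OF G \<rho> ent is_subring_generated p(1) k(1) r g(1,2) u] p unfolding M_def by blast
  qed
  have part2: "\<exists>p. prime p \<and> (\<exists>\<phi>\<in>hom G (SL_Fp M p).
      \<not> conjugate_in ((SL_Fp M p)\<lparr>carrier := \<phi> ` carrier G\<rparr>) (\<phi> \<gamma>) (\<phi> \<eta>))"
    if g: "\<gamma> \<in> carrier G" "\<eta> \<in> carrier G" "\<not> conjugate_in G \<gamma> \<eta>" for \<gamma> \<eta>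
  proof -
    have "mat_trace (\<rho> x) \<in> generated_subring A" if "x \<in> carrier G" for x
      using SL_rep_carrier[OF G \<rho> that] ent[OF that]
      by (auto simp: mat_trace_def mat_over_def intro!: subring_sum[OF is_subring_generated])
    hence "mat_trace (\<rho> \<gamma>) - mat_trace (\<rho> \<eta>) \<in> generated_subring A"
      using g by (intro is_subringD(6)[OF is_subring_generated])
    then obtain m where "cost_le A m (mat_trace (\<rho> \<gamma>) - mat_trace (\<rho> \<eta>))" unfolding generated_subring_def by blast
    from key[OF g this] show ?thesis by blast
  qed
  define d where "d = Suc (e * (M * M))"
  have part1: "Conj G X \<preceq>\<^sub>g (\<lambda>n. enat (n ^ d))" if X: "finite_generating_set G X" for X
  proof -
    let ?Y = "X \<union> m_inv G ` X"
    have finY: "finite ?Y" using X by (simp add: finite_generating_set_def)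
    have "\<exists>m. \<forall>i<n. \<forall>j<n. cost_le A m (\<rho> x $$ (i, j))" if "x \<in> ?Y" for x
      using entries gens[OF X] that by blast
    then obtain l where l: "\<And>x i j. x \<in> ?Y \<Longrightarrow> i < n \<Longrightarrow> j < n \<Longrightarrow> cost_le A (l x) (\<rho> x $$ (i, j))" by metis
    define L where "L = (\<Sum>x\<in>?Y. l x)"
    have L: "cost_le A L (\<rho> x $$ (i, j))" if "x \<in> ?Y" "i < n" "j < n" for x i j
      using l[OF that] by (rule cost_le_mono) (use that finY in \<open>auto simp: L_def intro!: member_le_sum\<close>)
    \<comment> \<open>\<open>B * N\<close> bounds the cost of a difference of two traces at words of length at most \<open>N\<close>\<close>
    define B where "B = (1 + L + n) + n + 2"
    define C' where "C' = C ^ (M * M) * B"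
    have C': "C' \<ge> 1" "C ^ (M * M) \<le> C'" "B \<le> C'"
    proof -
      have CB: "1 \<le> C ^ (M * M)" "1 \<le> B" using one_le_power[OF k(2)] by (auto simp: B_def)
      have "C ^ (M * M) * 1 \<le> C'" "1 * B \<le> C'" unfolding C'_def using CB by (intro mult_mono; simp)+
      thus "C' \<ge> 1" "C ^ (M * M) \<le> C'" "B \<le> C'" using CB by linarith+
    qed
    have bound: "Conj G X N \<le> enat C' * enat ((C' * N) ^ d)" if N: "N \<ge> 1" for N
      unfolding Conj_def
    proof (rule Sup_least)
      fix t assume "t \<in> {CD G c d | c d. c \<in> class_ball G X N \<and> d \<in> class_ball G X N \<and> c \<noteq> d}"
      then obtain c c' where t: "t = CD G c c'" and c: "c \<in> class_ball G X N"
        and c': "c' \<in> class_ball G X N" and ne: "c \<noteq> c'" by blast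
      obtain \<gamma> where \<gamma>: "\<gamma> \<in> c" "\<gamma> \<in> carrier G" "c = conj_class G \<gamma>" "word_length G X \<gamma> \<le> N"
        using class_ball_representative[OF G c] .
      obtain \<eta> where \<eta>: "\<eta> \<in> c'" "\<eta> \<in> carrier G" "c' = conj_class G \<eta>" "word_length G X \<eta> \<le> N"
        using class_ball_representative[OF G c'] .
      have nc: "\<not> conjugate_in G \<gamma> \<eta>" using conj_class_eq[OF G \<gamma>(2)] ne \<gamma>(3) \<eta>(3) by metis
      have tr: "cost_le A ((1 + L + n) * N + n) (mat_trace (\<rho> x))" if x: "x \<in> carrier G" "word_length G X x \<le> N" for x
      proof (rule trace_cost[OF x(1)])
        show "1 \<le> (1 + L + n) * N" using N by simp
        fix i j assume ij: "i < n" "j < n"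
        obtain ws where ws: "length ws = word_length G X x" "set ws \<subseteq> ?Y" "foldr (\<otimes>\<^bsub>G\<^esub>) ws \<one>\<^bsub>G\<^esub> = x"
          using word_exists[OF G X x(1)] by blast
        have "cost_le A (1 + length ws * (L + n)) (\<rho> x $$ (i, j))"
          using word_entries[OF G \<rho> gens[OF X] L ws(2) ij] unfolding ws(3) .
        moreover have "1 + length ws * (L + n) \<le> (1 + L + n) * N"
        proof -
          have "length ws * (L + n) \<le> N * (L + n)" using ws(1) x(2) by (intro mult_right_mono) auto
          thus ?thesis using N by (simp add: algebra_simps)
        qed
        ultimately show "cost_le A ((1 + L + n) * N) (\<rho> x $$ (i, j))" by (rule cost_le_mono)
      qed
      have "cost_le A ((1 + L + n) * N + n + 2) (mat_trace (\<rho> \<gamma>) + (- mat_trace (\<rho> \<eta>)))"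
        using \<gamma> \<eta> by (intro cost_le_add[OF tr cost_le_uminus[OF tr]]) auto
      moreover have "(1 + L + n) * N + n + 2 \<le> B * N"
      proof -
        have "(n + 2) * 1 \<le> (n + 2) * N" using N by (intro mult_left_mono) auto
        thus ?thesis by (simp add: B_def algebra_simps)
      qed
      ultimately have "cost_le A (B * N) (mat_trace (\<rho> \<gamma>) + (- mat_trace (\<rho> \<eta>)))" by (rule cost_le_mono)
      hence "cost_le A (B * N) (mat_trace (\<rho> \<gamma>) - mat_trace (\<rho> \<eta>))" by simp
      from key[OF \<gamma>(2) \<eta>(2) nc this] obtain p \<Psi> where p: "prime p" "p \<le> C * (B * N) ^ e"
        and \<Psi>: "\<Psi> \<in> hom G (SL_Fp M p)" and H: "group ((SL_Fp M p)\<lparr>carrier := \<Psi> ` carrier G\<rparr>)"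
        and ncH: "\<not> conjugate_in ((SL_Fp M p)\<lparr>carrier := \<Psi> ` carrier G\<rparr>) (\<Psi> \<gamma>) (\<Psi> \<eta>)" by blast
      let ?H = "(SL_Fp M p)\<lparr>carrier := \<Psi> ` carrier G\<rparr>"
      have sub: "\<Psi> ` carrier G \<subseteq> carrier (SL_Fp M p)" by (rule hom_carrier[OF \<Psi>])
      have finS: "finite (carrier (SL_Fp M p))" and cardS: "card (carrier (SL_Fp M p)) \<le> p ^ (M * M)"
        using card_SL_Fp_le[OF p(1), of M] by auto
      have fin: "finite (carrier ?H)" using finite_subset[OF sub finS] by simp
      have hom: "\<Psi> \<in> hom G ?H" using \<Psi> by (simp add: hom_def)
      have "CD G c c' \<le> enat (order ?H)"
        by (rule CD_le[OF G H fin hom \<gamma>(1) \<eta>(1) _ _ ncH]) (auto simp: \<gamma>(3) \<eta>(3) conj_class_def)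
      also have "\<dots> \<le> enat (C' * (C' * N) ^ d)"
      proof -
        have "order ?H \<le> card (carrier (SL_Fp M p))" using card_mono[OF finS sub] by (simp add: order_def)
        also have "\<dots> \<le> p ^ (M * M)" by (rule cardS)
        also have "\<dots> \<le> (C * (B * N) ^ e) ^ (M * M)" using p(2) by (intro power_mono) auto
        also have "\<dots> = C ^ (M * M) * (B * N) ^ (e * (M * M))"
          unfolding power_mult_distrib[of C] power_mult[of "B * N" e] ..
        also have "\<dots> \<le> C' * (C' * N) ^ (e * (M * M))"
          using C' by (intro mult_mono power_mono) auto
        also have "\<dots> \<le> C' * (C' * N) ^ d"
          using C' N by (intro mult_left_mono power_increasing) (auto simp: d_def Suc_le_eq)
        finally show ?thesis by simp
      qed
      finally show "t \<le> enat C' * enat ((C' * N) ^ d)" unfolding t by simp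
    qed
    show ?thesis unfolding growth_le_def using C'(1) bound by blast
  qed
  show ?thesis
  proof
    show "\<exists>d\<ge>1. \<forall>X. finite_generating_set G X \<longrightarrow> Conj G X \<preceq>\<^sub>g (\<lambda>n. enat (n ^ d))"
      by (rule exI[of _ d]) (use part1 in \<open>auto simp: d_def\<close>)
    show "\<exists>n\<^sub>0\<ge>1. \<forall>\<gamma>\<in>carrier G. \<forall>\<eta>\<in>carrier G. \<not> conjugate_in G \<gamma> \<eta> \<longrightarrow>
      (\<exists>p. prime p \<and>
        (\<exists>\<phi>\<in>hom G (SL_Fp n\<^sub>0 p).
          \<not> conjugate_in ((SL_Fp n\<^sub>0 p)\<lparr>carrier := \<phi> ` carrier G\<rparr>) (\<phi> \<gamma>) (\<phi> \<eta>)))"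
      using part2 M by blast
  qed
qed

end
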